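(* Let $\Lambda$ and $\Gamma$ be left and right noetherian rings and let ${}_{\Lambda}U$ be a Wakamatsu tilting module with $\Gamma=\mathrm{End}({}_{\Lambda}U)$. If ${}_{\Lambda}U$ is $k$-Gorenstein for all $k$ and both $\mathrm{l.id}_{\Lambda}(U)$ and $\mathrm{r.id}_{\Gamma}(U)$ are finite, then $\mathrm{l.id}_{\Lambda}(U)=\mathrm{r.id}_{\Gamma}(U)$.
   Context: $\text{mod }\Lambda$ is the category of finitely generated left $\Lambda$-modules and $\text{mod }\Gamma^{op}$ that of finitely generated right $\Gamma$-modules. $\mathrm{add}_{\Lambda}U$ is the class of direct summands of finite direct sums of copies of ${}_{\Lambda}U$. $\mathrm{l.id}_{\Lambda}(U)$ and $\mathrm{r.id}_{\Gamma}(U)$ are the injective dimensions of the left $\Lambda$-module ${}_{\Lambda}U$ and the right $\Gamma$-module $U_{\Gamma}$. Wakamatsu tilting: ${}_{\Lambda}U\in\text{mod }\Lambda$ is a Wakamatsu tilting module if $\mathrm{Ext}_{\Lambda}^i(U,U)=0$ for all $i\geq 1$ and there is an exact sequence $0\to{}_{\Lambda}\Lambda\to U_0\to U_1\to\cdots\to U_i\to\cdots$ with all $U_i\in\mathrm{add}_{\Lambda}U$ that remains exact after applying $\mathrm{Hom}_{\Lambda}(-,U)$. With $\Gamma=\mathrm{End}({}_{\Lambda}U)$ (endomorphisms acting on the right), $U$ is a $\Lambda$-$\Gamma$-bimodule. For $A\in\text{mod }\Lambda$, $\text{grade}_UA\geq n$ means $\mathrm{Ext}_{\Lambda}^i(A,U)=0$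 for all $0\leq i<n$; $\text{s.grade}_UA\geq n$ means $\text{grade}_UB\geq n$ for all submodules $B$ of $A$. ${}_{\Lambda}U$ is $k$-Gorenstein if $\text{s.grade}_U\,\mathrm{Ext}_{\Gamma}^i(N,U)\geq i$ for any $N\in\text{mod }\Gamma^{op}$ and $1\leq i\leq k$, where $\mathrm{Ext}_{\Gamma}^i(N,U)$ (formed in right $\Gamma$-modules) is regarded as a left $\Lambda$-module. *)

theory Defs
  imports "HOL-Algebra.Module" "HOL-Algebra.AbelCoset" "HOL-Library.Extended_Nat"
begin

section \<open>Modules over a noncommutative ring\<close>

text \<open>The library locale \<^locale>\<open>module\<close> demands a commutative ring. Its record type
  and its \<^locale>\<open>submodule\<close> do not, and are used here. A right module over \<open>R\<close> is a left
  module over \<open>op_ring R\<close>; the \<open>mult\<close> and \<open>one\<close> fields of a module record are irrelevant.\<close>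

locale left_module = R?: ring R + M?: abelian_group M
  for R :: "('r, 'c) ring_scheme" (structure) and M :: "('r, 'm) module" (structure) +
  assumes smult_closed: "\<lbrakk>a \<in> carrier R; x \<in> carrier M\<rbrakk> \<Longrightarrow> a \<odot>\<^bsub>M\<^esub> x \<in> carrier M"
    and smult_l_distr: "\<lbrakk>a \<in> carrier R; b \<in> carrier R; x \<in> carrier M\<rbrakk>
      \<Longrightarrow> (a \<oplus>\<^bsub>R\<^esub> b) \<odot>\<^bsub>M\<^esub> x = a \<odot>\<^bsub>M\<^esub> x \<oplus>\<^bsub>M\<^esub> b \<odot>\<^bsub>M\<^esub> x"
    and smult_r_distr: "\<lbrakk>a \<in> carrier R; x \<in> carrier M; y \<in> carrier M\<rbrakk>
      \<Longrightarrow> a \<odot>\<^bsub>M\<^esub> (x \<oplus>\<^bsub>M\<^esub> y) = a \<odot>\<^bsub>M\<^esub> x \<oplus>\<^bsub>M\<^esub> a \<odot>\<^bsub>M\<^esub> y"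
    and smult_assoc1: "\<lbrakk>a \<in> carrier R; b \<in> carrier R; x \<in> carrier M\<rbrakk>
      \<Longrightarrow> (a \<otimes>\<^bsub>R\<^esub> b) \<odot>\<^bsub>M\<^esub> x = a \<odot>\<^bsub>M\<^esub> (b \<odot>\<^bsub>M\<^esub> x)"
    and smult_one: "x \<in> carrier M \<Longrightarrow> \<one>\<^bsub>R\<^esub> \<odot>\<^bsub>M\<^esub> x = x"

definition op_ring :: "('r, 'c) ring_scheme \<Rightarrow> ('r, 'c) ring_scheme" where
  "op_ring R = R\<lparr>mult := \<lambda>x y. y \<otimes>\<^bsub>R\<^esub> x\<rparr>"

definition regular_module :: "('r, 'c) ring_scheme \<Rightarrow> ('r, 'r) module" where
  "regular_module R = \<lparr>carrier = carrier R, mult = mult R, one = one R, zero = zero R,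
     add = add R, smult = mult R\<rparr>"

definition zero_module :: "('m, 'd) ring_scheme \<Rightarrow> bool" where
  "zero_module M \<longleftrightarrow> carrier M = {\<zero>\<^bsub>M\<^esub>}"

definition fg_module :: "('r, 'c) ring_scheme \<Rightarrow> ('r, 'm) module \<Rightarrow> bool" where
  "fg_module R M \<longleftrightarrow> left_module R M \<and>
     (\<exists>S. finite S \<and> S \<subseteq> carrier M \<and>
          (\<forall>H. submodule H R M \<and> S \<subseteq> H \<longrightarrow> H = carrier M))"

definition left_noetherian :: "('r, 'c) ring_scheme \<Rightarrow> bool" where
  "left_noetherian R \<longleftrightarrow> ring R \<and>
     (\<forall>I. submodule I R (regular_module R) \<longrightarrow> fg_module R ((regular_module R)\<lparr>carrier := I\<rparr>))"

definition right_noetherian :: "('r, 'c) ring_scheme \<Rightarrow> bool" where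
  "right_noetherian R \<longleftrightarrow> left_noetherian (op_ring R)"

definition mod_hom :: "('r, 'c) ring_scheme \<Rightarrow> ('r, 'm) module \<Rightarrow> ('r, 'n) module \<Rightarrow> ('m \<Rightarrow> 'n) set"
  where "mod_hom R M N = {f \<in> hom (add_monoid M) (add_monoid N).
     \<forall>r\<in>carrier R. \<forall>x\<in>carrier M. f (r \<odot>\<^bsub>M\<^esub> x) = r \<odot>\<^bsub>N\<^esub> f x}"

definition mod_isomorphic :: "('r, 'c) ring_scheme \<Rightarrow> ('r, 'm) module \<Rightarrow> ('r, 'n) module \<Rightarrow> bool"
  where "mod_isomorphic R M N \<longleftrightarrow> (\<exists>f \<in> mod_hom R M N. bij_betw f (carrier M) (carrier N))"

definition exact_at ::
  "('a, 'x) ring_scheme \<Rightarrow> ('a \<Rightarrow> 'b) \<Rightarrow> ('b, 'y) ring_scheme \<Rightarrow> ('b \<Rightarrow> 'c) \<Rightarrow> ('c, 'z) ring_scheme \<Rightarrow> bool"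
  where "exact_at A f B g C \<longleftrightarrow> f ` carrier A = a_kernel B C g"

text \<open>The direct sum of copies of \<open>M\<close> indexed by \<open>X\<close>: finitely supported functions.\<close>

definition copower :: "'x set \<Rightarrow> ('r, 'm) module \<Rightarrow> ('r, 'x \<Rightarrow> 'm) module" where
  "copower X M = \<lparr>carrier = {f. (\<forall>x\<in>X. f x \<in> carrier M) \<and> (\<forall>x. x \<notin> X \<longrightarrow> f x = \<zero>\<^bsub>M\<^esub>) \<and>
                          finite {x. f x \<noteq> \<zero>\<^bsub>M\<^esub>}},
     mult = undefined, one = undefined, zero = (\<lambda>_. \<zero>\<^bsub>M\<^esub>),
     add = (\<lambda>f g x. f x \<oplus>\<^bsub>M\<^esub> g x), smult = (\<lambda>r f x. r \<odot>\<^bsub>M\<^esub> f x)\<rparr>"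

definition free_module :: "('r, 'c) ring_scheme \<Rightarrow> 'x set \<Rightarrow> ('r, 'x \<Rightarrow> 'r) module" where
  "free_module R X = copower X (regular_module R)"

definition direct_summand :: "('r, 'c) ring_scheme \<Rightarrow> 'm set \<Rightarrow> ('r, 'm) module \<Rightarrow> bool" where
  "direct_summand R S M \<longleftrightarrow> submodule S R M \<and>
     (\<exists>T. submodule T R M \<and> S \<inter> T = {\<zero>\<^bsub>M\<^esub>} \<and> S <+>\<^bsub>M\<^esub> T = carrier M)"

definition in_add :: "('r, 'c) ring_scheme \<Rightarrow> ('r, 'u) module \<Rightarrow> ('r, 'v) module \<Rightarrow> bool" where
  "in_add R U V \<longleftrightarrow> left_module R V \<and>
     (\<exists>(n::nat) S. direct_summand R S (copower {..<n} U) \<and>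
        mod_isomorphic R V ((copower {..<n} U)\<lparr>carrier := S\<rparr>))"

section \<open>Hom and Ext\<close>

text \<open>Homomorphisms are extensional, so that equality of elements is equality on the carrier.\<close>

definition Hom_group :: "('r, 'c) ring_scheme \<Rightarrow> ('r, 'm) module \<Rightarrow> ('r, 'n) module \<Rightarrow> ('m \<Rightarrow> 'n) ring"
  where "Hom_group R M N = \<lparr>carrier = mod_hom R M N \<inter> extensional (carrier M),
     mult = undefined, one = undefined, zero = (\<lambda>x\<in>carrier M. \<zero>\<^bsub>N\<^esub>),
     add = (\<lambda>f g. \<lambda>x\<in>carrier M. f x \<oplus>\<^bsub>N\<^esub> g x)\<rparr>"

text \<open>\<open>pullback A f\<close> is \<open>Hom(f, -)\<close> for a homomorphism \<open>f\<close> with domain \<open>A\<close>.\<close>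

definition pullback :: "('r, 'a) module \<Rightarrow> ('a \<Rightarrow> 'b) \<Rightarrow> ('b \<Rightarrow> 'c) \<Rightarrow> ('a \<Rightarrow> 'c)" where
  "pullback A f h = compose (carrier A) h f"

text \<open>A free resolution \<open>\<cdots> \<rightarrow> R\<^bsup>(X 1)\<^esup> \<rightarrow> R\<^bsup>(X 0)\<^esup> \<rightarrow> A \<rightarrow> 0\<close> with augmentation \<open>e\<close> and
  differentials \<open>d i : R\<^bsup>(X (i+1))\<^esup> \<rightarrow> R\<^bsup>(X i)\<^esup>\<close>.\<close>

definition free_resolution :: "('r, 'c) ring_scheme \<Rightarrow> ('r, 'a) module \<Rightarrow> (nat \<Rightarrow> 'x set)
    \<Rightarrow> (nat \<Rightarrow> ('x \<Rightarrow> 'r) \<Rightarrow> ('x \<Rightarrow> 'r)) \<Rightarrow> (('x \<Rightarrow> 'r) \<Rightarrow> 'a) \<Rightarrow> bool" where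
  "free_resolution R A X d e \<longleftrightarrow>
     e \<in> mod_hom R (free_module R (X 0)) A \<and>
     e ` carrier (free_module R (X 0)) = carrier A \<and>
     (\<forall>i. d i \<in> mod_hom R (free_module R (X (Suc i))) (free_module R (X i))) \<and>
     exact_at (free_module R (X 1)) (d 0) (free_module R (X 0)) e A \<and>
     (\<forall>i. exact_at (free_module R (X (Suc (Suc i)))) (d (Suc i))
            (free_module R (X (Suc i))) (d i) (free_module R (X i)))"

definition cocycles :: "('r, 'c) ring_scheme \<Rightarrow> (nat \<Rightarrow> 'x set) \<Rightarrow> (nat \<Rightarrow> ('x \<Rightarrow> 'r) \<Rightarrow> ('x \<Rightarrow> 'r))
    \<Rightarrow> ('r, 'm) module \<Rightarrow> nat \<Rightarrow> (('x \<Rightarrow> 'r) \<Rightarrow> 'm) set" where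
  "cocycles R X d M i =
     a_kernel (Hom_group R (free_module R (X i)) M) (Hom_group R (free_module R (X (Suc i))) M)
       (pullback (free_module R (X (Suc i))) (d i))"

definition coboundaries :: "('r, 'c) ring_scheme \<Rightarrow> (nat \<Rightarrow> 'x set) \<Rightarrow> (nat \<Rightarrow> ('x \<Rightarrow> 'r) \<Rightarrow> ('x \<Rightarrow> 'r))
    \<Rightarrow> ('r, 'm) module \<Rightarrow> nat \<Rightarrow> (('x \<Rightarrow> 'r) \<Rightarrow> 'm) set" where
  "coboundaries R X d M i = (case i of
       0 \<Rightarrow> {\<zero>\<^bsub>Hom_group R (free_module R (X 0)) M\<^esub>}
     | Suc j \<Rightarrow> pullback (free_module R (X i)) (d j) ` carrier (Hom_group R (free_module R (X j)) M))"

definition cocycle_group :: "('r, 'c) ring_scheme \<Rightarrow> (nat \<Rightarrow> 'x set) \<Rightarrow> (nat \<Rightarrow> ('x \<Rightarrow> 'r) \<Rightarrow> ('x \<Rightarrow> 'r))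
    \<Rightarrow> ('r, 'm) module \<Rightarrow> nat \<Rightarrow> (('x \<Rightarrow> 'r) \<Rightarrow> 'm) ring" where
  "cocycle_group R X d M i =
     (Hom_group R (free_module R (X i)) M)\<lparr>carrier := cocycles R X d M i\<rparr>"

definition cohomology :: "('r, 'c) ring_scheme \<Rightarrow> (nat \<Rightarrow> 'x set) \<Rightarrow> (nat \<Rightarrow> ('x \<Rightarrow> 'r) \<Rightarrow> ('x \<Rightarrow> 'r))
    \<Rightarrow> ('r, 'm) module \<Rightarrow> nat \<Rightarrow> (('x \<Rightarrow> 'r) \<Rightarrow> 'm) set ring" where
  "cohomology R X d M i =
     (let Z = cocycle_group R X d M i; B = coboundaries R X d M i in
      \<lparr>carrier = a_rcosets\<^bsub>Z\<^esub> B, mult = undefined, one = undefined, zero = B, add = set_add Z\<rparr>)"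

text \<open>An additive action on \<open>M\<close> commuting with that of \<open>R\<close> makes the cohomology
  of \<open>Hom(P, M)\<close> a module, by \<open>(s f)(x) = s (f x)\<close> on cocycles \<open>f\<close>.\<close>

definition cohomology_smult :: "('r, 'c) ring_scheme \<Rightarrow> (nat \<Rightarrow> 'x set) \<Rightarrow> (nat \<Rightarrow> ('x \<Rightarrow> 'r) \<Rightarrow> ('x \<Rightarrow> 'r))
    \<Rightarrow> ('r, 'm) module \<Rightarrow> ('s \<Rightarrow> 'm \<Rightarrow> 'm) \<Rightarrow> nat
    \<Rightarrow> 's \<Rightarrow> (('x \<Rightarrow> 'r) \<Rightarrow> 'm) set \<Rightarrow> (('x \<Rightarrow> 'r) \<Rightarrow> 'm) set" where
  "cohomology_smult R X d M act i s c =
     (\<Union>f\<in>c. coboundaries R X d M i +>\<^bsub>cocycle_group R X d M i\<^esub>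
               (\<lambda>x\<in>carrier (free_module R (X i)). act s (f x)))"

text \<open>Ext is the cohomology of \<open>Hom(P, M)\<close> for a free resolution \<open>P\<close> of \<open>A\<close>; up to isomorphism
  the choice of \<open>P\<close> does not matter. Basis elements are taken from \<open>('a + 'r) list\<close>, a type with
  \<open>max(|'a|, |'r|, \<aleph>\<^sub>0)\<close> elements, which suffices for a free resolution of any \<open>A\<close>: by induction,
  each syzygy again has at most that many elements.\<close>

definition chosen_resolution :: "('r, 'c) ring_scheme \<Rightarrow> ('r, 'a) module \<Rightarrow>
    (nat \<Rightarrow> ('a + 'r) list set) \<times> (nat \<Rightarrow> (('a + 'r) list \<Rightarrow> 'r) \<Rightarrow> (('a + 'r) list \<Rightarrow> 'r))" where
  "chosen_resolution R A = (SOME (X, d). \<exists>e. free_resolution R A X d e)"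

definition Ext_group :: "('r, 'c) ring_scheme \<Rightarrow> ('r, 'a) module \<Rightarrow> ('r, 'm) module \<Rightarrow> nat
    \<Rightarrow> ((('a + 'r) list \<Rightarrow> 'r) \<Rightarrow> 'm) set ring" where
  "Ext_group R A M i = (case chosen_resolution R A of (X, d) \<Rightarrow> cohomology R X d M i)"

definition Ext_module :: "('r, 'c) ring_scheme \<Rightarrow> ('r, 'a) module \<Rightarrow> ('r, 'm) module
    \<Rightarrow> ('s \<Rightarrow> 'm \<Rightarrow> 'm) \<Rightarrow> nat \<Rightarrow> ('s, ((('a + 'r) list \<Rightarrow> 'r) \<Rightarrow> 'm) set) module" where
  "Ext_module R A M act i = ring.extend (Ext_group R A M i)
     (module.fields (case chosen_resolution R A of (X, d) \<Rightarrow> cohomology_smult R X d M act i))"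

section \<open>Injective dimension\<close>

text \<open>HOL cannot quantify over all types inside a definition, so injective modules and
  injective resolutions are taken in a type that is large enough. Put
  \<open>\<kappa> = max(|'m|, \<aleph>\<^sub>0)\<^bsup>|'r|\<^esup>\<close>, the cardinality of \<open>('r, 'm) large\<close>. Then \<open>\<kappa>\<close> is infinite,
  \<open>|'r| \<le> \<kappa>\<close> and \<open>\<kappa>\<^bsup>|'r|\<^esup> = \<kappa>\<close>, whence: (1) every \<open>R\<close>-module with at most \<open>\<kappa>\<close> elements embeds
  into an injective one with at most \<open>\<kappa>\<close> elements, namely \<open>Hom\<^sub>\<int>(R, D)\<close> with \<open>D\<close> the divisible
  hull of its additive group, so every module with elements of type \<open>'m\<close> has an injective
  resolution by modules with elements of type \<open>('r, 'm) large\<close>; (2) all finitely generated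
  modules, in particular \<open>R\<close>, have copies in \<open>('r, 'm) large\<close>, so by Baer's criterion the
  extension property for test modules of this type implies it for all modules.\<close>

type_synonym ('r, 'm) large = "'r \<Rightarrow> 'm \<times> nat"

definition injective_module :: "('r, 'c) ring_scheme \<Rightarrow> ('r, 'm) module \<Rightarrow> bool" where
  "injective_module R I \<longleftrightarrow> left_module R I \<and>
     (\<forall>(M :: ('r, ('r, 'm) large) module) H h.
        left_module R M \<and> submodule H R M \<and> h \<in> mod_hom R (M\<lparr>carrier := H\<rparr>) I \<longrightarrow>
        (\<exists>g \<in> mod_hom R M I. \<forall>x\<in>H. g x = h x))"

definition injective_resolution :: "('r, 'c) ring_scheme \<Rightarrow> ('r, 'm) module \<Rightarrow> (nat \<Rightarrow> ('r, 'i) module)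
    \<Rightarrow> ('m \<Rightarrow> 'i) \<Rightarrow> (nat \<Rightarrow> 'i \<Rightarrow> 'i) \<Rightarrow> bool" where
  "injective_resolution R M I e d \<longleftrightarrow>
     (\<forall>i. injective_module R (I i)) \<and>
     e \<in> mod_hom R M (I 0) \<and> inj_on e (carrier M) \<and>
     (\<forall>i. d i \<in> mod_hom R (I i) (I (Suc i))) \<and>
     exact_at M e (I 0) (d 0) (I 1) \<and>
     (\<forall>i. exact_at (I i) (d i) (I (Suc i)) (d (Suc i)) (I (Suc (Suc i))))"

definition inj_dim_le :: "('r, 'c) ring_scheme \<Rightarrow> ('r, 'm) module \<Rightarrow> nat \<Rightarrow> bool" where
  "inj_dim_le R M n \<longleftrightarrow>
     (\<exists>(I :: nat \<Rightarrow> ('r, ('r, 'm) large) module) e d.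
        injective_resolution R M I e d \<and> (\<forall>i>n. zero_module (I i)))"

text \<open>The infimum of the empty set is \<open>\<infinity>\<close>; the zero module gets dimension \<open>0\<close>.\<close>

definition inj_dim :: "('r, 'c) ring_scheme \<Rightarrow> ('r, 'm) module \<Rightarrow> enat" where
  "inj_dim R M = Inf {enat n | n. inj_dim_le R M n}"

section \<open>Wakamatsu tilting and \<open>k\<close>-Gorenstein modules\<close>

text \<open>Endomorphisms act on the right: \<open>u (f g) = (u f) g\<close>, so \<open>f g\<close> is first \<open>f\<close>, then \<open>g\<close>.\<close>

definition End_ring :: "('r, 'c) ring_scheme \<Rightarrow> ('r, 'u) module \<Rightarrow> ('u \<Rightarrow> 'u) ring" where
  "End_ring R U = (Hom_group R U U)
     \<lparr>mult := \<lambda>f g. compose (carrier U) g f, one := \<lambda>x\<in>carrier U. x\<rparr>"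

text \<open>\<open>U\<close> as a right module over its endomorphism ring, i.e. as a left
  \<open>op_ring (End_ring R U)\<close>-module.\<close>

definition over_End :: "('r, 'u) module \<Rightarrow> ('u \<Rightarrow> 'u, 'u) module" where
  "over_End U = \<lparr>carrier = carrier U, mult = undefined, one = undefined, zero = \<zero>\<^bsub>U\<^esub>,
     add = add U, smult = (\<lambda>f u. f u)\<rparr>"

text \<open>Every module in \<open>add U\<close> is isomorphic to a submodule of some \<open>U\<^bsup>n\<^esup>\<close>, so it loses no
  generality to take the \<open>V i\<close> with elements of type \<open>nat \<Rightarrow> 'u\<close>.\<close>

definition wakamatsu_tilting :: "('r, 'c) ring_scheme \<Rightarrow> ('r, 'u) module \<Rightarrow> bool" where
  "wakamatsu_tilting R U \<longleftrightarrow> fg_module R U \<and>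
     (\<forall>i\<ge>1. zero_module (Ext_group R U U i)) \<and>
     (\<exists>(V :: nat \<Rightarrow> ('r, nat \<Rightarrow> 'u) module) e d.
        (\<forall>i. in_add R U (V i)) \<and>
        e \<in> mod_hom R (regular_module R) (V 0) \<and>
        (\<forall>i. d i \<in> mod_hom R (V i) (V (Suc i))) \<and>
        inj_on e (carrier R) \<and>
        exact_at (regular_module R) e (V 0) (d 0) (V 1) \<and>
        (\<forall>i. exact_at (V i) (d i) (V (Suc i)) (d (Suc i)) (V (Suc (Suc i)))) \<and>
        pullback (regular_module R) e ` carrier (Hom_group R (V 0) U)
          = carrier (Hom_group R (regular_module R) U) \<and>
        exact_at (Hom_group R (V 1) U) (pullback (V 0) (d 0)) (Hom_group R (V 0) U)
          (pullback (regular_module R) e) (Hom_group R (regular_module R) U) \<and>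
        (\<forall>i. exact_at (Hom_group R (V (Suc (Suc i))) U) (pullback (V (Suc i)) (d (Suc i)))
               (Hom_group R (V (Suc i)) U) (pullback (V i) (d i)) (Hom_group R (V i) U)))"

definition grade_ge :: "('r, 'c) ring_scheme \<Rightarrow> ('r, 'u) module \<Rightarrow> ('r, 'a) module \<Rightarrow> nat \<Rightarrow> bool" where
  "grade_ge R U A n \<longleftrightarrow> (\<forall>i<n. zero_module (Ext_group R A U i))"

definition s_grade_ge :: "('r, 'c) ring_scheme \<Rightarrow> ('r, 'u) module \<Rightarrow> ('r, 'a) module \<Rightarrow> nat \<Rightarrow> bool" where
  "s_grade_ge R U A n \<longleftrightarrow> (\<forall>B. submodule B R A \<longrightarrow> grade_ge R U (A\<lparr>carrier := B\<rparr>) n)"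

text \<open>Up to isomorphism a finitely generated module over \<open>\<Gamma>\<close> is a quotient of some \<open>\<Gamma>\<^bsup>n\<^esup>\<close>,
  a set of cosets; hence the type of the elements of \<open>N\<close>.\<close>

definition gorenstein :: "('r, 'c) ring_scheme \<Rightarrow> ('r, 'u) module \<Rightarrow> nat \<Rightarrow> bool" where
  "gorenstein R U k \<longleftrightarrow>
     (\<forall>(N :: ('u \<Rightarrow> 'u, (nat \<Rightarrow> 'u \<Rightarrow> 'u) set) module) i.
        fg_module (op_ring (End_ring R U)) N \<and> 1 \<le> i \<and> i \<le> k \<longrightarrow>
        s_grade_ge R U (Ext_module (op_ring (End_ring R U)) N (over_End U) (smult U) i) i)"

end

theory Submission
  imports Defs
begin

text \<open>Let \<open>S\<close> be the opposite of \<open>\<Gamma>\<close> and \<open>V\<close> the \<open>S\<close>-module \<open>U\<close>, and let \<open>m\<close> and \<open>n\<close> be the injective dimensions of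
  \<open>U\<close> over \<open>\<Lambda>\<close> and of \<open>V\<close> over \<open>S\<close>. The proof rests on three facts.

  (1) Biduality. Wakamatsu tilting modules are symmetric: each of the two rings is the endomorphism ring of the
  module over the other one, and \<open>U\<close> and \<open>V\<close> are both self-orthogonal (locales \<open>wakamatsu\<close> and \<open>dualizing\<close>). As both
  dimensions are finite, a finitely generated module over either ring is zero as soon as all its \<open>Ext\<close> groups
  into \<open>U\<close> (or \<open>V\<close>) vanish (\<open>zero_if_all_ext_zero\<close>).

  (2) The hypothesis. For finitely generated \<open>N\<close> and \<open>i \<ge> 1\<close>, submodules of \<open>Ext i (N, V)\<close> have \<open>U\<close>-grade at least \<open>i\<close>.

  (3) Its mirror image. For finitely generated \<open>M\<close>, submodules of \<open>Ext i (M, U)\<close> have \<open>V\<close>-grade at least \<open>i\<close>; so the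
  Gorenstein condition is left-right symmetric (\<open>ext_zero_submodule\<close>).

  If \<open>m < n\<close>, take a cyclic \<open>N\<close> with \<open>Ext n (N, V) \<noteq> 0\<close> and a nonzero cyclic submodule \<open>Z\<close> of this \<open>\<Lambda>\<close>-module. By (2)
  \<open>Ext j (Z, U)\<close> vanishes for \<open>j < n\<close>, and for \<open>j \<ge> n\<close> it vanishes because \<open>m < n\<close>; so \<open>Z = 0\<close> by (1), a contradiction. If
  \<open>n < m\<close>, the same argument works with (3) in place of (2).

  The proof of (3) is by induction on \<open>i\<close>. Dualizing a free resolution of \<open>M\<close> gives a complex \<open>W\<close> of \<open>S\<close>-modules,
  and \<open>Ext i (M, U)\<close> sits inside the cokernel \<open>T\<close> of \<open>W (i - 1) \<rightarrow> W i\<close>. Let \<open>Y\<close> be a submodule of \<open>Ext i (M, U)\<close> and \<open>j < i\<close>. Dimension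
  shifting along the earlier cokernels shows that \<open>Ext j (T, V) \<rightarrow> Ext j (Y, V)\<close> is zero. So the connecting map embeds
  \<open>Ext j (Y, V)\<close> into \<open>Ext (j + 1) (T / Y, V)\<close>, and by (2) it has \<open>U\<close>-grade at least \<open>j + 1\<close>. But if \<open>j\<close> is the first degree in
  which \<open>Ext j (Y, V)\<close> is not zero, such a grade is impossible (\<open>staircase\<close>).

  \<open>Ext\<close> is defined by free resolutions. The arguments above use a finite injective resolution \<open>J\<close> of \<open>V\<close> instead:
  \<open>Hom(-, J q)\<close> is exact, so that long exact sequences are plain diagram chases. The section on balancing compares the
  two, and also the two ways in which \<open>\<Lambda>\<close> acts on \<open>Ext\<close>.\<close>

section \<open>Modules, submodules and homomorphisms\<close>

context left_module begin

declare smult_closed [simp, intro] smult_one [simp]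

lemma ring_R: "ring R" ..
lemma group_M: "abelian_group M" ..

lemma smult_zero_left [simp]: "x \<in> carrier M \<Longrightarrow> \<zero>\<^bsub>R\<^esub> \<odot>\<^bsub>M\<^esub> x = \<zero>\<^bsub>M\<^esub>"
  by (metis M.add.r_cancel_one' R.l_zero R.zero_closed smult_closed smult_l_distr)

lemma smult_zero_right [simp]: "a \<in> carrier R \<Longrightarrow> a \<odot>\<^bsub>M\<^esub> \<zero>\<^bsub>M\<^esub> = \<zero>\<^bsub>M\<^esub>"
  by (metis M.add.r_cancel_one' M.l_zero M.zero_closed smult_closed smult_r_distr)

lemma smult_minus_right: "a \<in> carrier R \<Longrightarrow> x \<in> carrier M \<Longrightarrow> a \<odot>\<^bsub>M\<^esub> (\<ominus>\<^bsub>M\<^esub> x) = \<ominus>\<^bsub>M\<^esub> (a \<odot>\<^bsub>M\<^esub> x)"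
  by (metis M.add.inv_closed M.minus_equality M.l_neg smult_closed smult_r_distr smult_zero_right)

lemma neg_conv_smult: "x \<in> carrier M \<Longrightarrow> \<ominus>\<^bsub>M\<^esub> x = (\<ominus>\<^bsub>R\<^esub> \<one>\<^bsub>R\<^esub>) \<odot>\<^bsub>M\<^esub> x"
  by (metis M.minus_equality R.a_inv_closed R.l_neg R.one_closed smult_closed smult_l_distr smult_one smult_zero_left)

lemma diff_eq_zero_iff [simp]:
  "x \<in> carrier M \<Longrightarrow> y \<in> carrier M \<Longrightarrow> x \<ominus>\<^bsub>M\<^esub> y = \<zero>\<^bsub>M\<^esub> \<longleftrightarrow> x = y"
  by (metis M.add.inv_closed M.minus_equality M.minus_minus M.r_neg minus_eq)

lemma add_diff_cancel [simp]:
  "x \<in> carrier M \<Longrightarrow> y \<in> carrier M \<Longrightarrow> (x \<ominus>\<^bsub>M\<^esub> y) \<oplus>\<^bsub>M\<^esub> y = x"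
  by (simp add: minus_eq M.a_assoc M.l_neg)

lemma diff_zero [simp]: "x \<in> carrier M \<Longrightarrow> x \<ominus>\<^bsub>M\<^esub> \<zero>\<^bsub>M\<^esub> = x"
  by (simp add: minus_eq)

lemma diff_self [simp]: "x \<in> carrier M \<Longrightarrow> x \<ominus>\<^bsub>M\<^esub> x = \<zero>\<^bsub>M\<^esub>"
  by simp

lemma smult_diff:
  "a \<in> carrier R \<Longrightarrow> x \<in> carrier M \<Longrightarrow> y \<in> carrier M \<Longrightarrow>
   a \<odot>\<^bsub>M\<^esub> (x \<ominus>\<^bsub>M\<^esub> y) = a \<odot>\<^bsub>M\<^esub> x \<ominus>\<^bsub>M\<^esub> a \<odot>\<^bsub>M\<^esub> y"
  by (simp add: minus_eq smult_r_distr smult_minus_right)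

lemma diff_add_diff:
  "\<lbrakk>x \<in> carrier M; y \<in> carrier M; z \<in> carrier M; w \<in> carrier M\<rbrakk> \<Longrightarrow>
   (x \<oplus>\<^bsub>M\<^esub> y) \<ominus>\<^bsub>M\<^esub> (z \<oplus>\<^bsub>M\<^esub> w) = (x \<ominus>\<^bsub>M\<^esub> z) \<oplus>\<^bsub>M\<^esub> (y \<ominus>\<^bsub>M\<^esub> w)"
  by (simp add: minus_eq M.minus_add M.a_ac)

lemma smult_finsum:
  assumes "finite A" "a \<in> carrier R" "f \<in> A \<rightarrow> carrier M"
  shows "a \<odot>\<^bsub>M\<^esub> (\<Oplus>\<^bsub>M\<^esub> i\<in>A. f i) = (\<Oplus>\<^bsub>M\<^esub> i\<in>A. a \<odot>\<^bsub>M\<^esub> f i)"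
  using assms by (induct set: finite) (simp_all add: Pi_def smult_r_distr)

lemma submodule_iff:
  "submodule H R M \<longleftrightarrow> H \<subseteq> carrier M \<and> \<zero>\<^bsub>M\<^esub> \<in> H \<and> (\<forall>x\<in>H. \<forall>y\<in>H. x \<oplus>\<^bsub>M\<^esub> y \<in> H) \<and>
     (\<forall>a\<in>carrier R. \<forall>x\<in>H. a \<odot>\<^bsub>M\<^esub> x \<in> H)" (is "?L \<longleftrightarrow> ?R")
proof
  assume ?L
  then interpret submodule H R M .
  show ?R using subset one_closed m_closed smult_closed by auto
next
  assume r: ?R
  have "\<ominus>\<^bsub>M\<^esub> x \<in> H" if "x \<in> H" for x
    using that r neg_conv_smult R.a_inv_closed R.one_closed by (metis subsetD)
  then show ?L
    using r unfolding submodule_def submodule_axioms_def subgroup_def by (auto simp: a_inv_def)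
qed

lemma submodule_left_module:
  assumes "submodule H R M" shows "left_module R (M\<lparr>carrier := H\<rparr>)"
proof -
  interpret H: submodule H R M by fact
  have H: "x \<in> carrier M" if "x \<in> H" for x using that H.subset by auto
  have neg: "\<ominus>\<^bsub>M\<^esub> x \<in> H" if "x \<in> H" for x
    using H.m_inv_closed that by (simp add: a_inv_def)
  have "abelian_group (M\<lparr>carrier := H\<rparr>)"
  proof (rule abelian_groupI)
    fix x assume "x \<in> carrier (M\<lparr>carrier := H\<rparr>)"
    then show "\<exists>y\<in>carrier (M\<lparr>carrier := H\<rparr>). y \<oplus>\<^bsub>M\<lparr>carrier := H\<rparr>\<^esub> x = \<zero>\<^bsub>M\<lparr>carrier := H\<rparr>\<^esub>"
      using neg H by (auto intro!: bexI[of _ "\<ominus>\<^bsub>M\<^esub> x"] M.l_neg)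
  qed (use assms[unfolded submodule_iff] H in \<open>auto simp: M.a_ac\<close>)
  then show ?thesis
    unfolding left_module_def left_module_axioms_def
    using ring_R H.subset by (auto simp: smult_l_distr smult_r_distr smult_assoc1 subset_iff)
qed

lemma submodule_carrier: "submodule (carrier M) R M"
  by (simp add: submodule_iff)

lemma submodule_zero: "submodule {\<zero>\<^bsub>M\<^esub>} R M"
  by (simp add: submodule_iff)

end

lemma left_moduleI:
  assumes "ring R"
    and "\<And>x y. \<lbrakk>x \<in> carrier M; y \<in> carrier M\<rbrakk> \<Longrightarrow> x \<oplus>\<^bsub>M\<^esub> y \<in> carrier M"
    and "\<zero>\<^bsub>M\<^esub> \<in> carrier M"
    and "\<And>x y z. \<lbrakk>x \<in> carrier M; y \<in> carrier M; z \<in> carrier M\<rbrakk> \<Longrightarrow> (x \<oplus>\<^bsub>M\<^esub> y) \<oplus>\<^bsub>M\<^esub> z = x \<oplus>\<^bsub>M\<^esub> (y \<oplus>\<^bsub>M\<^esub> z)"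
    and "\<And>x y. \<lbrakk>x \<in> carrier M; y \<in> carrier M\<rbrakk> \<Longrightarrow> x \<oplus>\<^bsub>M\<^esub> y = y \<oplus>\<^bsub>M\<^esub> x"
    and "\<And>x. x \<in> carrier M \<Longrightarrow> \<zero>\<^bsub>M\<^esub> \<oplus>\<^bsub>M\<^esub> x = x"
    and "\<And>x. x \<in> carrier M \<Longrightarrow> \<exists>y\<in>carrier M. y \<oplus>\<^bsub>M\<^esub> x = \<zero>\<^bsub>M\<^esub>"
    and "\<And>a x. \<lbrakk>a \<in> carrier R; x \<in> carrier M\<rbrakk> \<Longrightarrow> a \<odot>\<^bsub>M\<^esub> x \<in> carrier M"
    and "\<And>a b x. \<lbrakk>a \<in> carrier R; b \<in> carrier R; x \<in> carrier M\<rbrakk>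
      \<Longrightarrow> (a \<oplus>\<^bsub>R\<^esub> b) \<odot>\<^bsub>M\<^esub> x = a \<odot>\<^bsub>M\<^esub> x \<oplus>\<^bsub>M\<^esub> b \<odot>\<^bsub>M\<^esub> x"
    and "\<And>a x y. \<lbrakk>a \<in> carrier R; x \<in> carrier M; y \<in> carrier M\<rbrakk>
      \<Longrightarrow> a \<odot>\<^bsub>M\<^esub> (x \<oplus>\<^bsub>M\<^esub> y) = a \<odot>\<^bsub>M\<^esub> x \<oplus>\<^bsub>M\<^esub> a \<odot>\<^bsub>M\<^esub> y"
    and "\<And>a b x. \<lbrakk>a \<in> carrier R; b \<in> carrier R; x \<in> carrier M\<rbrakk>
      \<Longrightarrow> (a \<otimes>\<^bsub>R\<^esub> b) \<odot>\<^bsub>M\<^esub> x = a \<odot>\<^bsub>M\<^esub> (b \<odot>\<^bsub>M\<^esub> x)"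
    and "\<And>x. x \<in> carrier M \<Longrightarrow> \<one>\<^bsub>R\<^esub> \<odot>\<^bsub>M\<^esub> x = x"
  shows "left_module R M"
proof -
  have "abelian_group M" by (rule abelian_groupI) (use assms in auto)
  with assms show ?thesis unfolding left_module_def left_module_axioms_def by auto
qed

lemma mod_homI:
  assumes "\<And>x. x \<in> carrier M \<Longrightarrow> f x \<in> carrier N"
    and "\<And>x y. \<lbrakk>x \<in> carrier M; y \<in> carrier M\<rbrakk> \<Longrightarrow> f (x \<oplus>\<^bsub>M\<^esub> y) = f x \<oplus>\<^bsub>N\<^esub> f y"
    and "\<And>r x. \<lbrakk>r \<in> carrier R; x \<in> carrier M\<rbrakk> \<Longrightarrow> f (r \<odot>\<^bsub>M\<^esub> x) = r \<odot>\<^bsub>N\<^esub> f x"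
  shows "f \<in> mod_hom R M N"
  using assms by (auto simp: mod_hom_def hom_def)

lemma mod_hom_closed: "\<lbrakk>f \<in> mod_hom R M N; x \<in> carrier M\<rbrakk> \<Longrightarrow> f x \<in> carrier N"
  by (auto simp: mod_hom_def hom_def)

lemma mod_hom_add:
  "\<lbrakk>f \<in> mod_hom R M N; x \<in> carrier M; y \<in> carrier M\<rbrakk> \<Longrightarrow> f (x \<oplus>\<^bsub>M\<^esub> y) = f x \<oplus>\<^bsub>N\<^esub> f y"
  by (auto simp: mod_hom_def hom_def)

lemma mod_hom_smult:
  "\<lbrakk>f \<in> mod_hom R M N; r \<in> carrier R; x \<in> carrier M\<rbrakk> \<Longrightarrow> f (r \<odot>\<^bsub>M\<^esub> x) = r \<odot>\<^bsub>N\<^esub> f x"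
  by (auto simp: mod_hom_def)

lemma mod_hom_zero:
  assumes "left_module R M" "left_module R N" "f \<in> mod_hom R M N"
  shows "f \<zero>\<^bsub>M\<^esub> = \<zero>\<^bsub>N\<^esub>"
proof -
  interpret M: left_module R M by fact
  interpret N: left_module R N by fact
  show ?thesis
    using mod_hom_smult[OF assms(3), of "\<zero>\<^bsub>R\<^esub>" "\<zero>\<^bsub>M\<^esub>"] mod_hom_closed[OF assms(3), of "\<zero>\<^bsub>M\<^esub>"] by simp
qed

lemma mod_hom_diff:
  assumes "left_module R M" "left_module R N" "f \<in> mod_hom R M N" "x \<in> carrier M" "y \<in> carrier M"
  shows "f (x \<ominus>\<^bsub>M\<^esub> y) = f x \<ominus>\<^bsub>N\<^esub> f y"
proof -
  interpret M: left_module R M by fact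
  interpret N: left_module R N by fact
  show ?thesis
    using assms by (simp add: a_minus_def M.neg_conv_smult N.neg_conv_smult mod_hom_add
        mod_hom_smult mod_hom_closed)
qed

lemma mod_hom_eq_iff:
  assumes "left_module R M" "left_module R N" "f \<in> mod_hom R M N" "x \<in> carrier M" "y \<in> carrier M"
  shows "f x = f y \<longleftrightarrow> f (x \<ominus>\<^bsub>M\<^esub> y) = \<zero>\<^bsub>N\<^esub>"
proof -
  interpret N: left_module R N by fact
  show ?thesis using assms by (simp add: mod_hom_diff[OF assms] mod_hom_closed)
qed

lemma mod_hom_finsum:
  assumes "left_module R M" "left_module R N" "f \<in> mod_hom R M N" "finite A" "g \<in> A \<rightarrow> carrier M"
  shows "f (\<Oplus>\<^bsub>M\<^esub> i\<in>A. g i) = (\<Oplus>\<^bsub>N\<^esub> i\<in>A. f (g i))"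
proof -
  interpret M: left_module R M by fact
  interpret N: left_module R N by fact
  show ?thesis using assms(4,5)
    by (induct set: finite)
      (simp_all add: Pi_def mod_hom_zero[OF assms(1-3)] mod_hom_add[OF assms(3)] mod_hom_closed[OF assms(3)])
qed

lemma mod_hom_comp:
  "\<lbrakk>f \<in> mod_hom R M N; g \<in> mod_hom R N P\<rbrakk> \<Longrightarrow> (\<lambda>x. g (f x)) \<in> mod_hom R M P"
  by (rule mod_homI) (simp_all add: mod_hom_closed mod_hom_add mod_hom_smult)

lemma mod_hom_cong:
  "left_module R M \<Longrightarrow> f \<in> mod_hom R M N \<Longrightarrow> (\<And>x. x \<in> carrier M \<Longrightarrow> f x = g x) \<Longrightarrow> g \<in> mod_hom R M N"
proof -
  assume "left_module R M" and f: "f \<in> mod_hom R M N" and eq: "\<And>x. x \<in> carrier M \<Longrightarrow> f x = g x"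
  then interpret M: left_module R M by simp
  show "g \<in> mod_hom R M N"
    by (rule mod_homI) (use f in \<open>simp_all add: eq[symmetric] mod_hom_closed mod_hom_add mod_hom_smult\<close>)
qed

lemma mod_hom_plus:
  assumes "left_module R N" "f \<in> mod_hom R M N" "g \<in> mod_hom R M N"
  shows "(\<lambda>x. f x \<oplus>\<^bsub>N\<^esub> g x) \<in> mod_hom R M N"
proof -
  interpret N: left_module R N by fact
  show ?thesis
    by (rule mod_homI)
      (use assms in \<open>simp_all add: mod_hom_closed mod_hom_add mod_hom_smult N.smult_r_distr N.M.a_ac\<close>)
qed

lemma mod_hom_minus:
  assumes "left_module R N" "f \<in> mod_hom R M N" "g \<in> mod_hom R M N"
  shows "(\<lambda>x. f x \<ominus>\<^bsub>N\<^esub> g x) \<in> mod_hom R M N"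
proof -
  interpret N: left_module R N by fact
  show ?thesis
    by (rule mod_homI)
      (use assms in \<open>simp_all add: mod_hom_closed mod_hom_add mod_hom_smult N.smult_diff N.diff_add_diff\<close>)
qed

lemma mod_hom_const_zero:
  assumes "left_module R N" shows "(\<lambda>x. \<zero>\<^bsub>N\<^esub>) \<in> mod_hom R M N"
proof -
  interpret N: left_module R N by fact
  show ?thesis by (rule mod_homI) simp_all
qed

lemma mod_hom_restrict_dom:
  "f \<in> mod_hom R M N \<Longrightarrow> H \<subseteq> carrier M \<Longrightarrow> f \<in> mod_hom R (M\<lparr>carrier := H\<rparr>) N"
  by (auto simp: mod_hom_def hom_def subset_iff)

lemma mod_hom_restrict_cod:
  "f \<in> mod_hom R M N \<Longrightarrow> (\<And>x. x \<in> carrier M \<Longrightarrow> f x \<in> H) \<Longrightarrow> f \<in> mod_hom R M (N\<lparr>carrier := H\<rparr>)"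
  by (auto simp: mod_hom_def hom_def)

lemma mod_hom_extend_cod:
  "f \<in> mod_hom R M (N\<lparr>carrier := H\<rparr>) \<Longrightarrow> H \<subseteq> carrier N \<Longrightarrow> f \<in> mod_hom R M N"
  by (auto simp: mod_hom_def hom_def)

lemma kernel_submodule:
  assumes "left_module R M" "left_module R N" "f \<in> mod_hom R M N"
  shows "submodule {x \<in> carrier M. f x = \<zero>\<^bsub>N\<^esub>} R M"
proof -
  interpret M: left_module R M by fact
  interpret N: left_module R N by fact
  show ?thesis unfolding M.submodule_iff
    using assms by (auto simp: mod_hom_zero mod_hom_add mod_hom_smult)
qed

lemma image_submodule:
  assumes "left_module R M" "left_module R N" "f \<in> mod_hom R M N"
  shows "submodule (f ` carrier M) R N"
proof -
  interpret M: left_module R M by fact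
  interpret N: left_module R N by fact
  have "f x \<oplus>\<^bsub>N\<^esub> f y \<in> f ` carrier M" if "x \<in> carrier M" "y \<in> carrier M" for x y
    using that by (metis M.add.m_closed assms(3) imageI mod_hom_add)
  moreover have "a \<odot>\<^bsub>N\<^esub> f x \<in> f ` carrier M" if "a \<in> carrier R" "x \<in> carrier M" for a x
    using that by (metis M.smult_closed assms(3) imageI mod_hom_smult)
  moreover have "\<zero>\<^bsub>N\<^esub> \<in> f ` carrier M"
    by (metis M.M.zero_closed assms imageI mod_hom_zero)
  ultimately show ?thesis unfolding N.submodule_iff
    using assms by (auto simp: mod_hom_closed)
qed

lemma submodule_finsum:
  assumes M: "left_module R M" and K: "submodule K R M" and "finite A" "\<And>i. i \<in> A \<Longrightarrow> g i \<in> K"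
  shows "(\<Oplus>\<^bsub>M\<^esub> i\<in>A. g i) \<in> K"
proof -
  interpret M: left_module R M by fact
  have K': "K \<subseteq> carrier M" "\<zero>\<^bsub>M\<^esub> \<in> K" "\<And>x y. x \<in> K \<Longrightarrow> y \<in> K \<Longrightarrow> x \<oplus>\<^bsub>M\<^esub> y \<in> K"
    using K by (auto simp: M.submodule_iff)
  from assms(3,4) show ?thesis
  proof (induct set: finite)
    case (insert x B)
    have "g \<in> B \<rightarrow> carrier M" "g x \<in> carrier M" using insert(4) K'(1) by auto
    then show ?case using insert K'(3) by (simp add: M.M.finsum_insert)
  qed (simp add: K'(2))
qed

lemma mod_hom_sum_fun:
  assumes N: "left_module R N" and A: "finite A" and g: "\<And>i. i \<in> A \<Longrightarrow> g i \<in> mod_hom R M N"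
  shows "(\<lambda>x. \<Oplus>\<^bsub>N\<^esub> i\<in>A. g i x) \<in> mod_hom R M N"
proof -
  interpret N: left_module R N by fact
  have c: "g i x \<in> carrier N" if "i \<in> A" "x \<in> carrier M" for i x
    using mod_hom_closed[OF g] that by blast
  show ?thesis
  proof (rule mod_homI)
    fix x assume x: "x \<in> carrier M"
    show "(\<Oplus>\<^bsub>N\<^esub> i\<in>A. g i x) \<in> carrier N" using c[OF _ x] by (intro N.M.finsum_closed) auto
    fix y assume y: "y \<in> carrier M"
    have "(\<Oplus>\<^bsub>N\<^esub> i\<in>A. g i (x \<oplus>\<^bsub>M\<^esub> y)) = (\<Oplus>\<^bsub>N\<^esub> i\<in>A. g i x \<oplus>\<^bsub>N\<^esub> g i y)"
      using c[OF _ x] c[OF _ y] mod_hom_add[OF g x y] by (intro N.M.finsum_cong') auto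
    also have "\<dots> = (\<Oplus>\<^bsub>N\<^esub> i\<in>A. g i x) \<oplus>\<^bsub>N\<^esub> (\<Oplus>\<^bsub>N\<^esub> i\<in>A. g i y)"
      using c[OF _ x] c[OF _ y] by (intro N.M.finsum_addf) auto
    finally show "(\<Oplus>\<^bsub>N\<^esub> i\<in>A. g i (x \<oplus>\<^bsub>M\<^esub> y)) = \<dots>" .
  next
    fix r x assume r: "r \<in> carrier R" and x: "x \<in> carrier M"
    have "(\<Oplus>\<^bsub>N\<^esub> i\<in>A. g i (r \<odot>\<^bsub>M\<^esub> x)) = (\<Oplus>\<^bsub>N\<^esub> i\<in>A. r \<odot>\<^bsub>N\<^esub> g i x)"
      using c[OF _ x] mod_hom_smult[OF g r x] r by (intro N.M.finsum_cong') auto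
    also have "\<dots> = r \<odot>\<^bsub>N\<^esub> (\<Oplus>\<^bsub>N\<^esub> i\<in>A. g i x)"
      using c[OF _ x] by (intro N.smult_finsum[symmetric] A r) auto
    finally show "(\<Oplus>\<^bsub>N\<^esub> i\<in>A. g i (r \<odot>\<^bsub>M\<^esub> x)) = \<dots>" .
  qed
qed

text \<open>All maps out of quotients, images and cokernels are obtained from this universal property.\<close>

lemma factor_through_surjection:
  assumes M: "left_module R M" and N: "left_module R N" and P: "left_module R P"
    and g: "g \<in> mod_hom R M N" and sur: "g ` carrier M = carrier N"
    and f: "f \<in> mod_hom R M P" and ker: "\<And>x. x \<in> carrier M \<Longrightarrow> g x = \<zero>\<^bsub>N\<^esub> \<Longrightarrow> f x = \<zero>\<^bsub>P\<^esub>"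
  obtains h where "h \<in> mod_hom R N P" "\<And>x. x \<in> carrier M \<Longrightarrow> h (g x) = f x"
proof -
  interpret M: left_module R M by fact
  interpret N: left_module R N by fact
  interpret P: left_module R P by fact
  define h where "h y = f (SOME x. x \<in> carrier M \<and> g x = y)" for y
  have h: "h (g x) = f x" if x: "x \<in> carrier M" for x
  proof -
    define x' where "x' = (SOME z. z \<in> carrier M \<and> g z = g x)"
    have x': "x' \<in> carrier M \<and> g x' = g x"
      unfolding x'_def by (rule someI[of _ x]) (simp add: x)
    then have "f x' = f x"
      using x ker mod_hom_eq_iff[OF M N g] mod_hom_eq_iff[OF M P f] M.M.minus_closed by metis
    then show ?thesis by (simp add: h_def x'_def)
  qed
  have "h \<in> mod_hom R N P"
  proof (rule mod_homI)
    fix y assume "y \<in> carrier N" then show "h y \<in> carrier P"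
      using h mod_hom_closed[OF f] by (auto simp flip: sur)
  next
    fix y z assume "y \<in> carrier N" "z \<in> carrier N"
    then obtain a b where "a \<in> carrier M" "b \<in> carrier M" "y = g a" "z = g b" by (auto simp flip: sur)
    then show "h (y \<oplus>\<^bsub>N\<^esub> z) = h y \<oplus>\<^bsub>P\<^esub> h z"
      by (simp add: h mod_hom_add[OF g, symmetric] mod_hom_add[OF f])
  next
    fix r y assume "r \<in> carrier R" "y \<in> carrier N"
    then obtain a where "a \<in> carrier M" "y = g a" using sur by auto
    then show "h (r \<odot>\<^bsub>N\<^esub> y) = r \<odot>\<^bsub>P\<^esub> h y"
      using \<open>r \<in> carrier R\<close> by (simp add: h mod_hom_smult[OF g, symmetric] mod_hom_smult[OF f])
  qed
  then show ?thesis using h that by blast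
qed

text \<open>Used for structures that are given only through a surjection: modules of cosets and copies of the ring
  in another type.\<close>

lemma left_module_image:
  assumes M: "left_module R M" and surj: "carrier N = p ` carrier M"
    and add: "\<And>x y. \<lbrakk>x \<in> carrier M; y \<in> carrier M\<rbrakk> \<Longrightarrow> p (x \<oplus>\<^bsub>M\<^esub> y) = p x \<oplus>\<^bsub>N\<^esub> p y"
    and smult: "\<And>r x. \<lbrakk>r \<in> carrier R; x \<in> carrier M\<rbrakk> \<Longrightarrow> p (r \<odot>\<^bsub>M\<^esub> x) = r \<odot>\<^bsub>N\<^esub> p x"
    and zero: "p \<zero>\<^bsub>M\<^esub> = \<zero>\<^bsub>N\<^esub>"
  shows "left_module R N"
proof -
  interpret M: left_module R M by fact
  show ?thesis
  proof (rule left_moduleI)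
    fix y assume "y \<in> carrier N"
    then obtain x where x: "x \<in> carrier M" "y = p x" using surj by auto
    then have "p (\<ominus>\<^bsub>M\<^esub> x) \<oplus>\<^bsub>N\<^esub> y = \<zero>\<^bsub>N\<^esub>" by (simp add: M.M.l_neg zero flip: add)
    then show "\<exists>z\<in>carrier N. z \<oplus>\<^bsub>N\<^esub> y = \<zero>\<^bsub>N\<^esub>" using x surj by auto
  qed (auto simp: surj zero[symmetric] add[symmetric] smult[symmetric] M.ring_R M.M.a_ac
        M.smult_l_distr M.smult_r_distr M.smult_assoc1)
qed

section \<open>Quotients\<close>

definition quotient_module :: "('r, 'm) module \<Rightarrow> 'm set \<Rightarrow> ('r, 'm set) module" where
  "quotient_module M H = \<lparr>carrier = a_rcosets\<^bsub>M\<^esub> H, mult = undefined, one = undefined, zero = H,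
     add = set_add M, smult = (\<lambda>r c. \<Union>x\<in>c. H +>\<^bsub>M\<^esub> (r \<odot>\<^bsub>M\<^esub> x))\<rparr>"

lemma submodule_abelian_subgroup:
  assumes "left_module R M" "submodule H R M" shows "abelian_subgroup H M"
proof -
  interpret M: left_module R M by fact
  show ?thesis using assms(2)
    by (auto intro!: abelian_subgroupI3 additive_subgroup.intro M.group_M simp: submodule_def)
qed

lemma coset_eq_iff:
  assumes "abelian_subgroup H M" "x \<in> carrier M" "y \<in> carrier M"
  shows "H +>\<^bsub>M\<^esub> x = H +>\<^bsub>M\<^esub> y \<longleftrightarrow> x \<ominus>\<^bsub>M\<^esub> y \<in> H"
proof -
  interpret abelian_subgroup H M by fact
  show ?thesis
    using a_rcos_module[OF assms(3,2)] a_repr_independence'[OF _ assms(3), of x] a_rcos_self[OF assms(2)]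
    by (auto simp: minus_eq)
qed

lemma
  assumes M: "left_module R M" and H: "submodule H R M"
  shows quotient_left_module: "left_module R (quotient_module M H)"
    and quotient_hom: "(\<lambda>x. H +>\<^bsub>M\<^esub> x) \<in> mod_hom R M (quotient_module M H)"
    and quotient_surj: "(\<lambda>x. H +>\<^bsub>M\<^esub> x) ` carrier M = carrier (quotient_module M H)"
    and quotient_ker: "x \<in> carrier M \<Longrightarrow> H +>\<^bsub>M\<^esub> x = \<zero>\<^bsub>quotient_module M H\<^esub> \<longleftrightarrow> x \<in> H"
proof -
  interpret M: left_module R M by fact
  interpret H: abelian_subgroup H M by (rule submodule_abelian_subgroup[OF M H])
  have sub: "H \<subseteq> carrier M" by (rule H.a_subset)
  show surj: "(\<lambda>x. H +>\<^bsub>M\<^esub> x) ` carrier M = carrier (quotient_module M H)"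
    by (auto simp: quotient_module_def A_RCOSETS_def')
  have smult: "H +>\<^bsub>M\<^esub> (r \<odot>\<^bsub>M\<^esub> x) = r \<odot>\<^bsub>quotient_module M H\<^esub> (H +>\<^bsub>M\<^esub> x)"
    if r: "r \<in> carrier R" and x: "x \<in> carrier M" for r x
  proof -
    have "H +>\<^bsub>M\<^esub> (r \<odot>\<^bsub>M\<^esub> y) = H +>\<^bsub>M\<^esub> (r \<odot>\<^bsub>M\<^esub> x)" if y: "y \<in> H +>\<^bsub>M\<^esub> x" for y
    proof -
      have yM: "y \<in> carrier M" using y x sub H.a_elemrcos_carrier by blast
      have "H +>\<^bsub>M\<^esub> y = H +>\<^bsub>M\<^esub> x" using H.a_repr_independence'[OF y x] by simp
      then have "y \<ominus>\<^bsub>M\<^esub> x \<in> H" using coset_eq_iff[OF H.abelian_subgroup_axioms yM x] by simp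
      then have "r \<odot>\<^bsub>M\<^esub> y \<ominus>\<^bsub>M\<^esub> r \<odot>\<^bsub>M\<^esub> x \<in> H"
        using H r x yM by (simp add: M.submodule_iff flip: M.smult_diff)
      then show ?thesis using coset_eq_iff[OF H.abelian_subgroup_axioms] r x yM by simp
    qed
    then have "(\<Union>y\<in>H +>\<^bsub>M\<^esub> x. H +>\<^bsub>M\<^esub> (r \<odot>\<^bsub>M\<^esub> y)) = (\<Union>y\<in>H +>\<^bsub>M\<^esub> x. H +>\<^bsub>M\<^esub> (r \<odot>\<^bsub>M\<^esub> x))"
      by (rule SUP_cong[OF refl])
    also have "\<dots> = H +>\<^bsub>M\<^esub> (r \<odot>\<^bsub>M\<^esub> x)" using H.a_rcos_self[OF x] by (metis UN_constant empty_iff)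
    finally show ?thesis by (simp add: quotient_module_def)
  qed
  have add: "H +>\<^bsub>M\<^esub> (x \<oplus>\<^bsub>M\<^esub> y) = (H +>\<^bsub>M\<^esub> x) \<oplus>\<^bsub>quotient_module M H\<^esub> (H +>\<^bsub>M\<^esub> y)"
    if "x \<in> carrier M" "y \<in> carrier M" for x y
    using that H.a_rcos_sum by (simp add: quotient_module_def)
  have zero: "H +>\<^bsub>M\<^esub> \<zero>\<^bsub>M\<^esub> = \<zero>\<^bsub>quotient_module M H\<^esub>"
    using sub by (simp add: quotient_module_def)
  show "left_module R (quotient_module M H)"
    by (rule left_module_image[OF M surj[symmetric] add smult zero])
  show "(\<lambda>x. H +>\<^bsub>M\<^esub> x) \<in> mod_hom R M (quotient_module M H)"
    using surj add smult by (auto intro!: mod_homI)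
  show "H +>\<^bsub>M\<^esub> x = \<zero>\<^bsub>quotient_module M H\<^esub> \<longleftrightarrow> x \<in> H" if "x \<in> carrier M"
    unfolding zero[symmetric] using coset_eq_iff[OF H.abelian_subgroup_axioms that] that by simp
qed

lemma regular_module_simps [simp]:
  "carrier (regular_module R) = carrier R" "add (regular_module R) = add R"
  "zero (regular_module R) = zero R" "smult (regular_module R) = mult R"
  by (simp_all add: regular_module_def)

lemma regular_left_module: "ring R \<Longrightarrow> left_module R (regular_module R)"
proof -
  assume "ring R" then interpret ring R .
  show ?thesis
  proof (rule left_moduleI)
    fix x assume "x \<in> carrier (regular_module R)"
    then show "\<exists>y\<in>carrier (regular_module R). y \<oplus>\<^bsub>regular_module R\<^esub> x = \<zero>\<^bsub>regular_module R\<^esub>"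
      by (auto intro!: bexI[of _ "\<ominus>\<^bsub>R\<^esub> x"] l_neg)
  qed (simp_all add: a_ac m_assoc l_distr r_distr \<open>ring R\<close>)
qed

lemma smult_hom:
  assumes "left_module R M" "x \<in> carrier M"
  shows "(\<lambda>r. r \<odot>\<^bsub>M\<^esub> x) \<in> mod_hom R (regular_module R) M"
proof -
  interpret left_module R M by fact
  show ?thesis by (rule mod_homI) (use assms in \<open>simp_all add: smult_l_distr smult_assoc1\<close>)
qed

section \<open>Direct sums and free modules\<close>

lemma copower_carrier:
  "carrier (copower X M) = {f. (\<forall>x\<in>X. f x \<in> carrier M) \<and> (\<forall>x. x \<notin> X \<longrightarrow> f x = \<zero>\<^bsub>M\<^esub>) \<and> finite {x. f x \<noteq> \<zero>\<^bsub>M\<^esub>}}"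
  by (simp add: copower_def)

lemma copower_simps [simp]:
  "zero (copower X M) = (\<lambda>_. \<zero>\<^bsub>M\<^esub>)"
  "add (copower X M) = (\<lambda>f g x. f x \<oplus>\<^bsub>M\<^esub> g x)"
  "smult (copower X M) = (\<lambda>r f x. r \<odot>\<^bsub>M\<^esub> f x)"
  by (simp_all add: copower_def)

lemma copower_component:
  "left_module R M \<Longrightarrow> f \<in> carrier (copower X M) \<Longrightarrow> f x \<in> carrier M"
proof -
  assume "left_module R M" "f \<in> carrier (copower X M)"
  then interpret left_module R M by simp
  show "f x \<in> carrier M" using \<open>f \<in> carrier (copower X M)\<close> by (cases "x \<in> X") (auto simp: copower_carrier)
qed

lemma copower_left_module:
  assumes "left_module R M" shows "left_module R (copower X M)"
proof -
  interpret left_module R M by fact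
  have c: "f x \<in> carrier M" if "f \<in> carrier (copower X M)" for f x
    using copower_component[OF assms that] .
  show ?thesis
  proof (rule left_moduleI)
    fix f g assume f: "f \<in> carrier (copower X M)" and g: "g \<in> carrier (copower X M)"
    have "{x. f x \<oplus>\<^bsub>M\<^esub> g x \<noteq> \<zero>\<^bsub>M\<^esub>} \<subseteq> {x. f x \<noteq> \<zero>\<^bsub>M\<^esub>} \<union> {x. g x \<noteq> \<zero>\<^bsub>M\<^esub>}"
      by auto
    then have "finite {x. f x \<oplus>\<^bsub>M\<^esub> g x \<noteq> \<zero>\<^bsub>M\<^esub>}"
      using f g by (auto simp: copower_carrier intro: finite_subset)
    then show "f \<oplus>\<^bsub>copower X M\<^esub> g \<in> carrier (copower X M)" using f g by (auto simp: copower_carrier)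
  next
    fix f assume f: "f \<in> carrier (copower X M)"
    have "{x. \<ominus>\<^bsub>M\<^esub> f x \<noteq> \<zero>\<^bsub>M\<^esub>} \<subseteq> {x. f x \<noteq> \<zero>\<^bsub>M\<^esub>}"
      by auto
    then have "finite {x. \<ominus>\<^bsub>M\<^esub> f x \<noteq> \<zero>\<^bsub>M\<^esub>}" using f by (auto simp: copower_carrier intro: finite_subset)
    then show "\<exists>g\<in>carrier (copower X M). g \<oplus>\<^bsub>copower X M\<^esub> f = \<zero>\<^bsub>copower X M\<^esub>"
      using f c[OF f] by (intro bexI[of _ "\<lambda>x. \<ominus>\<^bsub>M\<^esub> f x"]) (auto simp: M.l_neg copower_carrier)
  next
    fix r f assume r: "r \<in> carrier R" and f: "f \<in> carrier (copower X M)"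
    have "{x. r \<odot>\<^bsub>M\<^esub> f x \<noteq> \<zero>\<^bsub>M\<^esub>} \<subseteq> {x. f x \<noteq> \<zero>\<^bsub>M\<^esub>}" using r by auto
    then have "finite {x. r \<odot>\<^bsub>M\<^esub> f x \<noteq> \<zero>\<^bsub>M\<^esub>}" using f by (auto simp: copower_carrier intro: finite_subset)
    then show "r \<odot>\<^bsub>copower X M\<^esub> f \<in> carrier (copower X M)" using f r by (auto simp: copower_carrier)
  next
    show "\<zero>\<^bsub>copower X M\<^esub> \<in> carrier (copower X M)" by (simp add: copower_carrier)
  qed (use c ring_R in \<open>simp_all add: M.a_ac smult_l_distr smult_r_distr smult_assoc1\<close>)
qed

lemma copower_coord_hom: "left_module R M \<Longrightarrow> (\<lambda>f. f x) \<in> mod_hom R (copower X M) M"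
  by (rule mod_homI) (simp_all add: copower_component)

definition coord_inj :: "('r, 'm) module \<Rightarrow> 'x \<Rightarrow> 'm \<Rightarrow> 'x \<Rightarrow> 'm" where
  "coord_inj M x u = (\<lambda>y. if y = x then u else \<zero>\<^bsub>M\<^esub>)"

lemma coord_inj_hom:
  assumes "left_module R M" "x \<in> X" shows "coord_inj M x \<in> mod_hom R M (copower X M)"
proof -
  interpret left_module R M by fact
  have "finite {y. coord_inj M x u y \<noteq> \<zero>\<^bsub>M\<^esub>}" for u
    by (rule finite_subset[of _ "{x}"]) (auto simp: coord_inj_def)
  then show ?thesis
    by (intro mod_homI) (use assms(2) in \<open>auto simp: coord_inj_def copower_carrier\<close>)
qed

lemma finsum_copower:
  assumes "left_module R M" "finite A" "\<And>i. i \<in> A \<Longrightarrow> g i \<in> carrier (copower X M)"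
  shows "(\<Oplus>\<^bsub>copower X M\<^esub> i\<in>A. g i) x = (\<Oplus>\<^bsub>M\<^esub> i\<in>A. g i x)"
  by (rule mod_hom_finsum[OF copower_left_module[OF assms(1)] assms(1) copower_coord_hom[OF assms(1)] assms(2)])
    (use assms(3) in auto)

lemma copower_expand:
  assumes M: "left_module R M" and f: "f \<in> carrier (copower X M)"
    and A: "finite A" "{x. f x \<noteq> \<zero>\<^bsub>M\<^esub>} \<subseteq> A" "A \<subseteq> X"
  shows "f = (\<Oplus>\<^bsub>copower X M\<^esub> x\<in>A. coord_inj M x (f x))"
proof
  fix y
  interpret left_module R M by fact
  have c: "f x \<in> carrier M" for x using copower_component[OF M f] .
  have "(\<Oplus>\<^bsub>copower X M\<^esub> x\<in>A. coord_inj M x (f x)) y = (\<Oplus>\<^bsub>M\<^esub> x\<in>A. coord_inj M x (f x) y)"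
    by (rule finsum_copower[OF M A(1)], rule mod_hom_closed[OF coord_inj_hom[OF M] c]) (use A(3) in blast)
  also have "\<dots> = (\<Oplus>\<^bsub>M\<^esub> x\<in>A. if y = x then f x else \<zero>\<^bsub>M\<^esub>)"
    by (intro M.finsum_cong') (auto simp: coord_inj_def c)
  also have "\<dots> = f y"
  proof (cases "y \<in> A")
    case True
    then show ?thesis using M.finsum_singleton[OF True A(1), of f] c by simp
  next
    case False
    have "(\<Oplus>\<^bsub>M\<^esub> x\<in>A. if y = x then f x else \<zero>\<^bsub>M\<^esub>) = (\<Oplus>\<^bsub>M\<^esub> x\<in>A. \<zero>\<^bsub>M\<^esub>)"
      using False by (intro M.finsum_cong') auto
    moreover have "f y = \<zero>\<^bsub>M\<^esub>" using False A(2) by auto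
    ultimately show ?thesis by simp
  qed
  finally show "f y = (\<Oplus>\<^bsub>copower X M\<^esub> x\<in>A. coord_inj M x (f x)) y" by simp
qed

lemma free_left_module: "ring R \<Longrightarrow> left_module R (free_module R X)"
  by (simp add: free_module_def copower_left_module regular_left_module)

definition unit_vec :: "('r, 'c) ring_scheme \<Rightarrow> 'x \<Rightarrow> 'x \<Rightarrow> 'r" where
  "unit_vec R x = coord_inj (regular_module R) x \<one>\<^bsub>R\<^esub>"

lemma unit_vec_closed: "ring R \<Longrightarrow> x \<in> X \<Longrightarrow> unit_vec R x \<in> carrier (free_module R X)"
  unfolding unit_vec_def free_module_def
  by (rule mod_hom_closed[OF coord_inj_hom[OF regular_left_module]]) (simp_all add: ring.ring_simprules(6))

lemma unit_vec_smult:
  assumes "ring R" "r \<in> carrier R" "x \<in> X"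
  shows "coord_inj (regular_module R) x r = r \<odot>\<^bsub>free_module R X\<^esub> unit_vec R x"
proof -
  interpret ring R by fact
  show ?thesis using assms(2) by (auto simp: free_module_def unit_vec_def coord_inj_def)
qed

lemma free_component: "ring R \<Longrightarrow> f \<in> carrier (free_module R X) \<Longrightarrow> f x \<in> carrier R"
  using copower_component[OF regular_left_module] unfolding free_module_def by fastforce

lemma free_expand:
  assumes R: "ring R" and f: "f \<in> carrier (free_module R X)"
    and A: "finite A" "{x. f x \<noteq> \<zero>\<^bsub>R\<^esub>} \<subseteq> A" "A \<subseteq> X"
  shows "f = (\<Oplus>\<^bsub>free_module R X\<^esub> x\<in>A. f x \<odot>\<^bsub>free_module R X\<^esub> unit_vec R x)"
proof -
  interpret F: left_module R "free_module R X" by (rule free_left_module[OF R])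
  have "f = (\<Oplus>\<^bsub>free_module R X\<^esub> x\<in>A. coord_inj (regular_module R) x (f x))"
    using copower_expand[OF regular_left_module[OF R], of f X A] f A by (simp add: free_module_def)
  also have "\<dots> = (\<Oplus>\<^bsub>free_module R X\<^esub> x\<in>A. f x \<odot>\<^bsub>free_module R X\<^esub> unit_vec R x)"
    using A(3) free_component[OF R f] unit_vec_closed[OF R, where X=X]
    by (intro F.M.finsum_cong') (auto simp: unit_vec_smult[OF R, where X=X] subset_iff intro!: F.smult_closed)
  finally show ?thesis .
qed

lemma free_hom_apply:
  assumes R: "ring R" and M: "left_module R M" and h: "h \<in> mod_hom R (free_module R X) M"
    and f: "f \<in> carrier (free_module R X)" and A: "finite A" "{x. f x \<noteq> \<zero>\<^bsub>R\<^esub>} \<subseteq> A" "A \<subseteq> X"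
  shows "h f = (\<Oplus>\<^bsub>M\<^esub> x\<in>A. f x \<odot>\<^bsub>M\<^esub> h (unit_vec R x))"
proof -
  interpret F: left_module R "free_module R X" by (rule free_left_module[OF R])
  interpret M: left_module R M by fact
  have u: "x \<in> A \<Longrightarrow> unit_vec R x \<in> carrier (free_module R X)" for x
    using A(3) by (intro unit_vec_closed[OF R]) auto
  have "h f = h (\<Oplus>\<^bsub>free_module R X\<^esub> x\<in>A. f x \<odot>\<^bsub>free_module R X\<^esub> unit_vec R x)"
    by (rule arg_cong[OF free_expand[OF R f A]])
  also have "\<dots> = (\<Oplus>\<^bsub>M\<^esub> x\<in>A. h (f x \<odot>\<^bsub>free_module R X\<^esub> unit_vec R x))"
    using u free_component[OF R f] by (intro mod_hom_finsum[OF F.left_module_axioms M h A(1)]) auto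
  also have "\<dots> = (\<Oplus>\<^bsub>M\<^esub> x\<in>A. f x \<odot>\<^bsub>M\<^esub> h (unit_vec R x))"
    using u free_component[OF R f] by (intro M.M.finsum_cong') (auto simp: mod_hom_smult[OF h] mod_hom_closed[OF h])
  finally show ?thesis .
qed

lemma free_supp: "f \<in> carrier (free_module R X) \<Longrightarrow> finite {x. f x \<noteq> \<zero>\<^bsub>R\<^esub>} \<and> {x. f x \<noteq> \<zero>\<^bsub>R\<^esub>} \<subseteq> X"
  unfolding free_module_def by (auto simp: copower_carrier)

lemma free_hom_eq:
  assumes R: "ring R" and M: "left_module R M"
    and h: "h \<in> mod_hom R (free_module R X) M" and k: "k \<in> mod_hom R (free_module R X) M"
    and eq: "\<And>x. x \<in> X \<Longrightarrow> h (unit_vec R x) = k (unit_vec R x)"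
    and f: "f \<in> carrier (free_module R X)"
  shows "h f = k f"
proof -
  interpret M: left_module R M by fact
  let ?A = "{x. f x \<noteq> \<zero>\<^bsub>R\<^esub>}"
  have A: "finite ?A" "?A \<subseteq> ?A" "?A \<subseteq> X" using free_supp[OF f] by auto
  show ?thesis
    unfolding free_hom_apply[OF R M h f A] free_hom_apply[OF R M k f A]
    using A(3) eq free_component[OF R f] mod_hom_closed[OF k unit_vec_closed[OF R, where X=X]]
    by (intro M.M.finsum_cong') (auto simp: subset_iff intro!: M.smult_closed)
qed

text \<open>The homomorphism from a free module with prescribed values \<open>v\<close> on the basis.\<close>

definition free_ext :: "('r, 'c) ring_scheme \<Rightarrow> ('r, 'm) module \<Rightarrow> ('x \<Rightarrow> 'm) \<Rightarrow> ('x \<Rightarrow> 'r) \<Rightarrow> 'm" where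
  "free_ext R M v f = (\<Oplus>\<^bsub>M\<^esub> x\<in>{x. f x \<noteq> \<zero>\<^bsub>R\<^esub>}. f x \<odot>\<^bsub>M\<^esub> v x)"

lemma free_ext_superset:
  assumes M: "left_module R M" and v: "\<And>x. x \<in> X \<Longrightarrow> v x \<in> carrier M"
    and f: "f \<in> carrier (free_module R X)" and A: "finite A" "{x. f x \<noteq> \<zero>\<^bsub>R\<^esub>} \<subseteq> A" "A \<subseteq> X"
  shows "free_ext R M v f = (\<Oplus>\<^bsub>M\<^esub> x\<in>A. f x \<odot>\<^bsub>M\<^esub> v x)"
proof -
  interpret M: left_module R M by fact
  show ?thesis unfolding free_ext_def
    using A v free_component[OF M.ring_R f]
    by (intro M.M.add.finprod_mono_neutral_cong_left) auto
qed

lemma free_ext_hom: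
  assumes M: "left_module R M" and v: "\<And>x. x \<in> X \<Longrightarrow> v x \<in> carrier M"
  shows "free_ext R M v \<in> mod_hom R (free_module R X) M"
proof -
  interpret M: left_module R M by fact
  let ?F = "free_module R X"
  interpret F: left_module R ?F by (rule free_left_module[OF M.ring_R])
  note ext = free_ext_superset[where v=v and X=X, OF M v]
  note c = free_component[OF M.ring_R]
  show ?thesis
  proof (rule mod_homI)
    fix f assume f: "f \<in> carrier ?F"
    then have "{x. f x \<noteq> \<zero>\<^bsub>R\<^esub>} \<subseteq> X" using free_supp by auto
    then show "free_ext R M v f \<in> carrier M"
      unfolding free_ext_def using c[OF f] v by (intro M.M.finsum_closed) auto
  next
    fix f g assume f: "f \<in> carrier ?F" and g: "g \<in> carrier ?F"
    let ?A = "{x. f x \<noteq> \<zero>\<^bsub>R\<^esub>} \<union> {x. g x \<noteq> \<zero>\<^bsub>R\<^esub>}"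
    have A: "finite ?A" "?A \<subseteq> X" using free_supp[OF f] free_supp[OF g] by auto
    have fg: "f \<oplus>\<^bsub>?F\<^esub> g \<in> carrier ?F" using f g by simp
    have fgx: "(f \<oplus>\<^bsub>?F\<^esub> g) x = f x \<oplus>\<^bsub>R\<^esub> g x" for x by (simp add: free_module_def)
    have "{x. (f \<oplus>\<^bsub>?F\<^esub> g) x \<noteq> \<zero>\<^bsub>R\<^esub>} \<subseteq> ?A"
    proof (rule subsetI, rule ccontr)
      fix x assume x: "x \<in> {x. (f \<oplus>\<^bsub>?F\<^esub> g) x \<noteq> \<zero>\<^bsub>R\<^esub>}" and "x \<notin> ?A"
      then have "f x = \<zero>\<^bsub>R\<^esub>" "g x = \<zero>\<^bsub>R\<^esub>" by blast+
      with x show False by (simp add: fgx)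
    qed
    then have "free_ext R M v (f \<oplus>\<^bsub>?F\<^esub> g) = (\<Oplus>\<^bsub>M\<^esub> x\<in>?A. (f x \<oplus>\<^bsub>R\<^esub> g x) \<odot>\<^bsub>M\<^esub> v x)"
      using ext[OF _ fg A(1) _ A(2)] by (simp add: fgx)
    also have "\<dots> = (\<Oplus>\<^bsub>M\<^esub> x\<in>?A. (f x \<odot>\<^bsub>M\<^esub> v x) \<oplus>\<^bsub>M\<^esub> (g x \<odot>\<^bsub>M\<^esub> v x))"
      using A(2) v c[OF f] c[OF g] by (intro M.M.finsum_cong') (auto simp: M.smult_l_distr)
    also have "\<dots> = (\<Oplus>\<^bsub>M\<^esub> x\<in>?A. f x \<odot>\<^bsub>M\<^esub> v x) \<oplus>\<^bsub>M\<^esub> (\<Oplus>\<^bsub>M\<^esub> x\<in>?A. g x \<odot>\<^bsub>M\<^esub> v x)"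
      using A(2) v c[OF f] c[OF g] by (intro M.M.finsum_addf) auto
    also have "\<dots> = free_ext R M v f \<oplus>\<^bsub>M\<^esub> free_ext R M v g"
      using ext[OF _ f A(1) _ A(2)] ext[OF _ g A(1) _ A(2)] by auto
    finally show "free_ext R M v (f \<oplus>\<^bsub>?F\<^esub> g) = free_ext R M v f \<oplus>\<^bsub>M\<^esub> free_ext R M v g" .
  next
    fix r f assume r: "r \<in> carrier R" and f: "f \<in> carrier ?F"
    let ?A = "{x. f x \<noteq> \<zero>\<^bsub>R\<^esub>}"
    have A: "finite ?A" "?A \<subseteq> X" using free_supp[OF f] by auto
    have rf: "r \<odot>\<^bsub>?F\<^esub> f \<in> carrier ?F" using f r by simp
    have rfx: "(r \<odot>\<^bsub>?F\<^esub> f) x = r \<otimes>\<^bsub>R\<^esub> f x" for x by (simp add: free_module_def)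
    have "{x. (r \<odot>\<^bsub>?F\<^esub> f) x \<noteq> \<zero>\<^bsub>R\<^esub>} \<subseteq> ?A"
    proof (rule subsetI, rule ccontr)
      fix x assume x: "x \<in> {x. (r \<odot>\<^bsub>?F\<^esub> f) x \<noteq> \<zero>\<^bsub>R\<^esub>}" and "x \<notin> ?A"
      then have "f x = \<zero>\<^bsub>R\<^esub>" by blast
      with x r show False by (simp add: rfx)
    qed
    then have "free_ext R M v (r \<odot>\<^bsub>?F\<^esub> f) = (\<Oplus>\<^bsub>M\<^esub> x\<in>?A. (r \<otimes>\<^bsub>R\<^esub> f x) \<odot>\<^bsub>M\<^esub> v x)"
      using ext[OF _ rf A(1) _ A(2)] by (simp add: rfx)
    also have "\<dots> = (\<Oplus>\<^bsub>M\<^esub> x\<in>?A. r \<odot>\<^bsub>M\<^esub> (f x \<odot>\<^bsub>M\<^esub> v x))"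
      using A(2) v c[OF f] r by (intro M.M.finsum_cong') (auto simp: M.smult_assoc1)
    also have "\<dots> = r \<odot>\<^bsub>M\<^esub> free_ext R M v f"
      unfolding free_ext_def using A v c[OF f] r by (intro M.smult_finsum[symmetric]) auto
    finally show "free_ext R M v (r \<odot>\<^bsub>?F\<^esub> f) = r \<odot>\<^bsub>M\<^esub> free_ext R M v f" .
  qed
qed

lemma free_ext_unit_vec:
  assumes M: "left_module R M" and v: "\<And>x. x \<in> X \<Longrightarrow> v x \<in> carrier M" and x: "x \<in> X"
  shows "free_ext R M v (unit_vec R x) = v x"
proof -
  interpret M: left_module R M by fact
  have "free_ext R M v (unit_vec R x) = (\<Oplus>\<^bsub>M\<^esub> y\<in>{x}. unit_vec R x y \<odot>\<^bsub>M\<^esub> v y)"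
    by (rule free_ext_superset[where v=v and X=X, OF M v unit_vec_closed[OF M.ring_R x]])
      (use x in \<open>auto simp: unit_vec_def coord_inj_def\<close>)
  then show ?thesis using v[OF x] by (simp add: unit_vec_def coord_inj_def)
qed

text \<open>Projectivity of free modules, in the form needed for lifting chain maps: it is enough that the values on the
  basis lie in the image of \<open>g\<close>.\<close>

lemma free_lift:
  assumes M: "left_module R M" and N: "left_module R N"
    and f: "f \<in> mod_hom R (free_module R X) N" and g: "g \<in> mod_hom R M N"
    and sub: "\<And>x. x \<in> X \<Longrightarrow> f (unit_vec R x) \<in> g ` carrier M"
  obtains h where "h \<in> mod_hom R (free_module R X) M"
    "\<And>y. y \<in> carrier (free_module R X) \<Longrightarrow> g (h y) = f y"
proof -
  interpret M: left_module R M by fact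
  have "\<exists>v. \<forall>x\<in>X. v x \<in> carrier M \<and> g (v x) = f (unit_vec R x)"
    using sub by (intro bchoice) (metis imageE)
  then obtain v where v: "\<And>x. x \<in> X \<Longrightarrow> v x \<in> carrier M" "\<And>x. x \<in> X \<Longrightarrow> g (v x) = f (unit_vec R x)"
    by blast
  have h: "free_ext R M v \<in> mod_hom R (free_module R X) M" by (rule free_ext_hom[where v=v, OF M v(1)])
  have "g (free_ext R M v y) = f y" if "y \<in> carrier (free_module R X)" for y
    by (rule free_hom_eq[OF M.ring_R N mod_hom_comp[OF h g] f _ that])
      (simp add: free_ext_unit_vec[where v=v and X=X, OF M v(1)] v(2))
  with h show ?thesis using that by blast
qed

section \<open>Finite generation\<close>

text \<open>Finite generation of a submodule, measured by the submodules of the surrounding module. Within \<open>M\<close> it is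
  easier to use than \<open>fg_module\<close> of the restricted module.\<close>

definition fin_gen :: "('r, 'c) ring_scheme \<Rightarrow> ('r, 'm) module \<Rightarrow> 'm set \<Rightarrow> bool" where
  "fin_gen R M H \<longleftrightarrow> (\<exists>S. finite S \<and> S \<subseteq> H \<and> (\<forall>K. submodule K R M \<and> S \<subseteq> K \<longrightarrow> H \<subseteq> K))"

lemma fin_genE:
  assumes "fin_gen R M H"
  obtains S where "finite S" "S \<subseteq> H" "\<And>K. submodule K R M \<Longrightarrow> S \<subseteq> K \<Longrightarrow> H \<subseteq> K"
  using assms unfolding fin_gen_def by metis

lemma fg_module_iff: "fg_module R M \<longleftrightarrow> left_module R M \<and> fin_gen R M (carrier M)"
proof -
  have sub: "submodule H R M \<Longrightarrow> H \<subseteq> carrier M" for H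
    by (simp add: submodule_def subgroup_def)
  have "(\<forall>H. submodule H R M \<and> S \<subseteq> H \<longrightarrow> H = carrier M) \<longleftrightarrow>
      (\<forall>H. submodule H R M \<and> S \<subseteq> H \<longrightarrow> carrier M \<subseteq> H)" for S
    using sub by (metis subset_antisym subset_refl)
  then show ?thesis unfolding fg_module_def fin_gen_def by simp
qed

lemma submodule_inter_sub:
  assumes "left_module R M" "submodule K R M" "submodule H R M"
  shows "submodule (K \<inter> H) R (M\<lparr>carrier := H\<rparr>)"
proof -
  interpret M: left_module R M by fact
  interpret H: left_module R "M\<lparr>carrier := H\<rparr>" by (rule M.submodule_left_module[OF assms(3)])
  show ?thesis using assms(2,3) by (auto simp: M.submodule_iff H.submodule_iff)
qed

lemma fg_submodule_fin_gen:
  assumes "left_module R M" "submodule H R M" "fg_module R (M\<lparr>carrier := H\<rparr>)"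
  shows "fin_gen R M H"
proof -
  obtain S where S: "finite S" "S \<subseteq> H"
    "\<And>K. submodule K R (M\<lparr>carrier := H\<rparr>) \<Longrightarrow> S \<subseteq> K \<Longrightarrow> K = H"
    using assms(3) unfolding fg_module_def by auto
  have "H \<subseteq> K" if "submodule K R M" "S \<subseteq> K" for K
    using S(3)[OF submodule_inter_sub[OF assms(1) that(1) assms(2)]] that S(2) by auto
  then show ?thesis unfolding fin_gen_def using S by blast
qed

lemma fin_gen_free_cover:
  assumes M: "left_module R M" and H: "submodule H R M" and fg: "fin_gen R M H"
    and inf: "infinite (UNIV :: 'x set)"
  obtains X :: "'x set" and e where "finite X" "e \<in> mod_hom R (free_module R X) M"
    "e ` carrier (free_module R X) = H"
proof -
  interpret M: left_module R M by fact
  obtain S where S: "finite S" "S \<subseteq> H" "\<And>K. submodule K R M \<Longrightarrow> S \<subseteq> K \<Longrightarrow> H \<subseteq> K"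
    by (rule fin_genE[OF fg]) blast
  obtain X :: "'x set" where X: "finite X" "card X = card S"
    using infinite_arbitrarily_large[OF inf] by blast
  then obtain v where v: "bij_betw v X S" using S(1) finite_same_card_bij by metis
  let ?H = "M\<lparr>carrier := H\<rparr>"
  have H': "left_module R ?H" by (rule M.submodule_left_module[OF H])
  have Hsub: "H \<subseteq> carrier M" using H by (simp add: M.submodule_iff)
  have vH: "v x \<in> carrier ?H" if "x \<in> X" for x using v S(2) that by (auto simp: bij_betw_def)
  let ?e = "free_ext R ?H v"
  have e: "?e \<in> mod_hom R (free_module R X) ?H" by (rule free_ext_hom[where v=v, OF H' vH])
  then have e': "?e \<in> mod_hom R (free_module R X) M" by (rule mod_hom_extend_cod[OF _ Hsub])
  have "S \<subseteq> ?e ` carrier (free_module R X)"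
  proof
    fix s assume "s \<in> S"
    then obtain x where x: "x \<in> X" "v x = s" using v by (auto simp: bij_betw_def)
    then have "?e (unit_vec R x) = s" using free_ext_unit_vec[where X=X and v=v, OF H' vH] by simp
    then show "s \<in> ?e ` carrier (free_module R X)" using unit_vec_closed[OF M.ring_R x(1)] by (metis imageI)
  qed
  then have "H \<subseteq> ?e ` carrier (free_module R X)"
    by (intro S(3) image_submodule[OF free_left_module[OF M.ring_R] M e'])
  then have "?e ` carrier (free_module R X) = H" using mod_hom_closed[OF e] by auto
  then show ?thesis using that X(1) e' by blast
qed

lemma fin_gen_image:
  assumes M: "left_module R M" and N: "left_module R N" and f: "f \<in> mod_hom R M N"
    and fg: "fin_gen R M (carrier M)" and sur: "f ` carrier M = carrier N"
  shows "fin_gen R N (carrier N)"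
proof -
  interpret M: left_module R M by fact
  interpret N: left_module R N by fact
  obtain S where S: "finite S" "S \<subseteq> carrier M" "\<And>K. submodule K R M \<Longrightarrow> S \<subseteq> K \<Longrightarrow> carrier M \<subseteq> K"
    by (rule fin_genE[OF fg]) blast
  have "carrier N \<subseteq> K" if K: "submodule K R N" "f ` S \<subseteq> K" for K
  proof -
    have "submodule {x\<in>carrier M. f x \<in> K} R M"
      using K(1) mod_hom_zero[OF M N f]
      by (auto simp: M.submodule_iff N.submodule_iff mod_hom_add[OF f] mod_hom_smult[OF f])
    then have "carrier M \<subseteq> {x\<in>carrier M. f x \<in> K}" using S(2) K(2) by (intro S(3)) auto
    then show ?thesis using sur by (auto simp flip: sur)
  qed
  then show ?thesis unfolding fin_gen_def
    using S(1,2) mod_hom_closed[OF f] by (intro exI[of _ "f ` S"]) blast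
qed

lemma cyclic_fin_gen:
  assumes M: "left_module R M" and x: "x \<in> carrier M"
  shows "submodule ((\<lambda>r. r \<odot>\<^bsub>M\<^esub> x) ` carrier R) R M"
    and "fg_module R (M\<lparr>carrier := (\<lambda>r. r \<odot>\<^bsub>M\<^esub> x) ` carrier R\<rparr>)"
proof -
  interpret M: left_module R M by fact
  let ?H = "(\<lambda>r. r \<odot>\<^bsub>M\<^esub> x) ` carrier R"
  show H: "submodule ?H R M"
    using image_submodule[OF regular_left_module[OF M.ring_R] M smult_hom[OF M x]] by simp
  interpret H: left_module R "M\<lparr>carrier := ?H\<rparr>" by (rule M.submodule_left_module[OF H])
  have "x \<in> ?H" by (metis M.R.one_closed M.smult_one image_eqI x)
  then show "fg_module R (M\<lparr>carrier := ?H\<rparr>)"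
    unfolding fg_module_def using H.left_module_axioms
    by (intro conjI exI[of _ "{x}"]) (auto simp: H.submodule_iff)
qed

text \<open>By induction on the rank: the values of the last coordinate on \<open>K\<close> form a finitely generated ideal, and lifts
  of its generators generate \<open>K\<close> together with generators of the kernel of this coordinate.\<close>

lemma noetherian_fin_gen:
  assumes noeth: "left_noetherian R" and "finite X" and "submodule K R (free_module R X)"
  shows "fin_gen R (free_module R X) K"
  using assms(2,3)
proof (induct X arbitrary: K)
  have R: "ring R" using noeth by (simp add: left_noetherian_def)
  case empty
  then have "K \<subseteq> carrier (free_module R {})"
    by (simp add: left_module.submodule_iff[OF free_left_module[OF R]])
  then have "K \<subseteq> {\<zero>\<^bsub>free_module R {}\<^esub>}"
    by (auto simp: free_module_def copower_carrier)
  then have "K \<subseteq> L" if "submodule L R (free_module R {})" for L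
    using that by (auto simp: left_module.submodule_iff[OF free_left_module[OF R]])
  then show ?case unfolding fin_gen_def by (intro exI[of _ "{}"]) auto
next
  have R: "ring R" using noeth by (simp add: left_noetherian_def)
  case (insert x X)
  let ?F = "free_module R (insert x X)" and ?G = "free_module R X" and ?r = "regular_module R"
  interpret F: left_module R ?F by (rule free_left_module[OF R])
  interpret G: left_module R ?G by (rule free_left_module[OF R])
  interpret r: left_module R ?r by (rule regular_left_module[OF R])
  have ops: "zero ?F = zero ?G" "add ?F = add ?G" "smult ?F = smult ?G"
    by (simp_all add: free_module_def)
  have car: "carrier ?G = {f \<in> carrier ?F. f x = \<zero>\<^bsub>R\<^esub>}"
    using insert(2) by (auto simp: free_module_def copower_carrier)
  have ev: "(\<lambda>f. f x) \<in> mod_hom R ?F ?r"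
    using copower_coord_hom[OF r.left_module_axioms, of x "insert x X"] by (simp add: free_module_def)
  have coset: "submodule ((\<lambda>f. f x) ` H) R ?r" if "submodule H R ?F" for H
  proof -
    have "H \<subseteq> carrier ?F" using that by (simp add: F.submodule_iff)
    then show ?thesis
      using image_submodule[OF F.submodule_left_module[OF that] r.left_module_axioms mod_hom_restrict_dom[OF ev]]
      by simp
  qed
  let ?I = "(\<lambda>f. f x) ` K" and ?K = "K \<inter> carrier ?G"
  note sub = insert(4)
  have "fin_gen R ?r ?I"
    using noeth coset[OF sub] fg_submodule_fin_gen[OF r.left_module_axioms] by (auto simp: left_noetherian_def)
  then obtain S where S: "finite S" "S \<subseteq> ?I" "\<And>L. submodule L R ?r \<Longrightarrow> S \<subseteq> L \<Longrightarrow> ?I \<subseteq> L"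
    by (rule fin_genE) blast
  obtain S' where S': "finite S'" "S' \<subseteq> K" "S = (\<lambda>f. f x) ` S'"
    using finite_subset_image[OF S(1,2)] by blast
  have inter: "submodule (H \<inter> carrier ?G) R ?G" if "submodule H R ?F" for H
    using that by (auto simp: F.submodule_iff G.submodule_iff ops)
  obtain T where T: "finite T" "T \<subseteq> ?K" "\<And>L. submodule L R ?G \<Longrightarrow> T \<subseteq> L \<Longrightarrow> ?K \<subseteq> L"
    using insert(3)[OF inter[OF sub]] by (elim fin_genE) blast
  have "K \<subseteq> H" if H: "submodule H R ?F" "S' \<union> T \<subseteq> H" for H
  proof
    fix f assume f: "f \<in> K"
    let ?L = "H \<inter> K"
    have L: "submodule ?L R ?F" using H sub by (auto simp: F.submodule_iff)
    have "f x \<in> (\<lambda>f. f x) ` ?L"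
      using S(3)[OF coset[OF L]] S' H f by auto
    then obtain h where h: "h \<in> H" "h \<in> K" "h x = f x" by auto
    have c: "f \<in> carrier ?F" "h \<in> carrier ?F" using f h sub by (auto simp: F.submodule_iff)
    have d: "f \<ominus>\<^bsub>?F\<^esub> h \<in> ?K"
    proof -
      have "(f \<ominus>\<^bsub>?F\<^esub> h) x = f x \<ominus>\<^bsub>?r\<^esub> h x"
        using mod_hom_diff[OF F.left_module_axioms r.left_module_axioms ev c] by simp
      also have "\<dots> = \<zero>\<^bsub>R\<^esub>" using h free_component[OF R c(1)] r.diff_self by simp
      finally show ?thesis
        using f h(2) c sub by (auto simp: car F.submodule_iff a_minus_def F.neg_conv_smult)
    qed
    have "?K \<subseteq> H" using T(3)[OF inter[OF H(1)]] T(2) H(2) by auto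
    then have "f \<ominus>\<^bsub>?F\<^esub> h \<in> H" using d by auto
    then have "(f \<ominus>\<^bsub>?F\<^esub> h) \<oplus>\<^bsub>?F\<^esub> h \<in> H" using h H(1) by (simp add: F.submodule_iff)
    then show "f \<in> H" using c by simp
  qed
  then show ?case unfolding fin_gen_def
    using S' T by (intro exI[of _ "S' \<union> T"]) auto
qed

lemma fin_gen_submodule_module:
  assumes M: "left_module R M" and H: "submodule H R M" and fg: "fin_gen R M H"
  shows "fg_module R (M\<lparr>carrier := H\<rparr>)"
proof -
  interpret M: left_module R M by fact
  interpret H: left_module R "M\<lparr>carrier := H\<rparr>" by (rule M.submodule_left_module[OF H])
  obtain G where G: "finite G" "G \<subseteq> H" "\<And>K. submodule K R M \<Longrightarrow> G \<subseteq> K \<Longrightarrow> H \<subseteq> K"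
    by (rule fin_genE[OF fg]) blast
  have "H \<subseteq> carrier M" using H by (simp add: M.submodule_iff)
  then have "H \<subseteq> K" if "submodule K R (M\<lparr>carrier := H\<rparr>)" "G \<subseteq> K" for K
    using that by (intro G(3)) (auto simp: M.submodule_iff H.submodule_iff)
  then have "fin_gen R (M\<lparr>carrier := H\<rparr>) H" unfolding fin_gen_def using G(1,2) by (intro exI[of _ G]) auto
  then show ?thesis by (simp add: fg_module_iff H.left_module_axioms)
qed

lemma noetherian_fg_submodule:
  assumes noeth: "left_noetherian R" and fg: "fg_module R M" and H: "submodule H R M"
  shows "fg_module R (M\<lparr>carrier := H\<rparr>)"
proof -
  have M: "left_module R M" using fg by (simp add: fg_module_def)
  then interpret M: left_module R M .
  obtain X :: "nat set" and e where X: "finite X" and e: "e \<in> mod_hom R (free_module R X) M"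
    "e ` carrier (free_module R X) = carrier M"
    using fin_gen_free_cover[OF M M.submodule_carrier] fg infinite_UNIV_nat unfolding fg_module_iff by metis
  let ?F = "free_module R X"
  let ?K = "{y \<in> carrier ?F. e y \<in> H}"
  interpret F: left_module R ?F by (rule free_left_module[OF M.ring_R])
  have K: "submodule ?K R ?F"
    using H mod_hom_zero[OF F.left_module_axioms M e(1)] unfolding M.submodule_iff F.submodule_iff
    by (auto simp: mod_hom_add[OF e(1)] mod_hom_smult[OF e(1)])
  have fgK: "fg_module R (?F\<lparr>carrier := ?K\<rparr>)"
    by (rule fin_gen_submodule_module[OF F.left_module_axioms K noetherian_fin_gen[OF noeth X K]])
  have H': "left_module R (M\<lparr>carrier := H\<rparr>)" by (rule M.submodule_left_module[OF H])
  have "e \<in> mod_hom R (?F\<lparr>carrier := ?K\<rparr>) (M\<lparr>carrier := H\<rparr>)"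
    by (rule mod_hom_restrict_cod[OF mod_hom_restrict_dom[OF e(1)]]) auto
  moreover have "e ` carrier (?F\<lparr>carrier := ?K\<rparr>) = carrier (M\<lparr>carrier := H\<rparr>)"
    using e(2) H by (auto simp: M.submodule_iff image_iff)
  ultimately have "fin_gen R (M\<lparr>carrier := H\<rparr>) (carrier (M\<lparr>carrier := H\<rparr>))"
    using fgK H' fg_module_iff by (intro fin_gen_image[of R "?F\<lparr>carrier := ?K\<rparr>" _ e]) auto
  then show ?thesis using H' fg_module_iff by blast
qed

lemma fg_module_image:
  assumes fg: "fg_module R M" and N: "left_module R N" and f: "f \<in> mod_hom R M N"
    and sur: "f ` carrier M = carrier N"
  shows "fg_module R N"
  using fin_gen_image[OF _ N f _ sur] fg N by (auto simp: fg_module_iff)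

text \<open>The Gorenstein condition speaks of modules in one type only. A finitely generated module has a copy there, as
  a quotient of a free module with basis in \<open>nat\<close>.\<close>

lemma fg_module_copy:
  fixes R :: "('r, 'c) ring_scheme"
  assumes fg: "fg_module R N"
  obtains N' :: "('r, (nat \<Rightarrow> 'r) set) module" and g where "fg_module R N'" "g \<in> mod_hom R N' N"
    "g ` carrier N' = carrier N" "\<And>x. x \<in> carrier N' \<Longrightarrow> g x = \<zero>\<^bsub>N\<^esub> \<Longrightarrow> x = \<zero>\<^bsub>N'\<^esub>"
proof -
  have N: "left_module R N" using fg by (simp add: fg_module_def)
  then interpret N: left_module R N .
  obtain X :: "nat set" and e where X: "finite X" and e: "e \<in> mod_hom R (free_module R X) N"
    "e ` carrier (free_module R X) = carrier N"
    using fin_gen_free_cover[OF N N.submodule_carrier] fg infinite_UNIV_nat unfolding fg_module_iff by metis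
  let ?F = "free_module R X"
  have F: "left_module R ?F" by (rule free_left_module[OF N.ring_R])
  let ?K = "{y \<in> carrier ?F. e y = \<zero>\<^bsub>N\<^esub>}"
  have K: "submodule ?K R ?F" by (rule kernel_submodule[OF F N e(1)])
  let ?N = "quotient_module ?F ?K" and ?q = "\<lambda>y. ?K +>\<^bsub>?F\<^esub> y"
  note Q = quotient_left_module[OF F K] quotient_hom[OF F K] quotient_surj[OF F K] quotient_ker[OF F K]
  obtain g where g: "g \<in> mod_hom R ?N N" "\<And>y. y \<in> carrier ?F \<Longrightarrow> g (?q y) = e y"
  proof (rule factor_through_surjection[OF F Q(1) N Q(2,3) e(1)])
    fix y assume y: "y \<in> carrier ?F" "?q y = \<zero>\<^bsub>?N\<^esub>"
    then have "y \<in> ?K" by (simp only: Q(4))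
    then show "e y = \<zero>\<^bsub>N\<^esub>" by simp
  qed blast
  have "fg_module R ?F"
  proof -
    have S: "unit_vec R ` X \<subseteq> carrier ?F" using unit_vec_closed[OF N.ring_R] by auto
    have "carrier ?F \<subseteq> H" if H: "submodule H R ?F" "unit_vec R ` X \<subseteq> H" for H
    proof
      interpret F: left_module R ?F by (rule F)
      have H': "left_module R (?F\<lparr>carrier := H\<rparr>)" by (rule F.submodule_left_module[OF H(1)])
      have Hs: "H \<subseteq> carrier ?F" using H(1) by (simp only: F.submodule_iff)
      fix y assume y: "y \<in> carrier ?F"
      have v: "unit_vec R x \<in> carrier (?F\<lparr>carrier := H\<rparr>)" if "x \<in> X" for x using H(2) that by auto
      let ?e = "free_ext R (?F\<lparr>carrier := H\<rparr>) (unit_vec R)"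
      have h: "?e \<in> mod_hom R ?F (?F\<lparr>carrier := H\<rparr>)" by (rule free_ext_hom[OF H' v])
      have "id \<in> mod_hom R ?F ?F" by (rule mod_homI) auto
      then have "?e y = id y"
        by (rule free_hom_eq[OF N.ring_R F mod_hom_extend_cod[OF h Hs] _ _ y])
          (simp add: free_ext_unit_vec[where v="unit_vec R" and X=X, OF H' v])
      then show "y \<in> H" using mod_hom_closed[OF h y] by simp
    qed
    then have "fin_gen R ?F (carrier ?F)" unfolding fin_gen_def using X S by (intro exI[of _ "unit_vec R ` X"]) auto
    then show ?thesis using F fg_module_iff by blast
  qed
  then have "fg_module R ?N" by (rule fg_module_image[OF _ Q(1-3)])
  moreover have "g ` carrier ?N = carrier N"
    using g(2) e(2) unfolding Q(3)[symmetric] by (auto simp: image_image)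
  moreover have "x = \<zero>\<^bsub>?N\<^esub>" if x: "x \<in> carrier ?N" "g x = \<zero>\<^bsub>N\<^esub>" for x
  proof -
    obtain y where y: "y \<in> carrier ?F" "x = ?q y" using x(1) unfolding Q(3)[symmetric] by blast
    then have "y \<in> ?K" using g(2) x(2) by simp
    then show ?thesis using Q(4)[OF y(1)] y(2) by simp
  qed
  ultimately show ?thesis using that[OF _ g(1)] by blast
qed

section \<open>Free resolutions\<close>

text \<open>Over a noetherian ring every syzygy of a finitely generated module is again finitely generated. So the bases
  can be finite, and fit into any infinite type; in particular \<open>chosen_resolution\<close> really is a resolution.\<close>

lemma free_resolution_exists:
  fixes R :: "('r, 'c) ring_scheme" and A :: "('r, 'a) module"
  assumes noeth: "left_noetherian R" and fg: "fg_module R A" and inf: "infinite (UNIV :: 'x set)"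
  obtains X :: "nat \<Rightarrow> 'x set" and d e where "free_resolution R A X d e" "\<And>i. finite (X i)"
proof -
  have R: "ring R" using noeth by (simp add: left_noetherian_def)
  have A: "left_module R A" using fg by (simp add: fg_module_def)
  note F = free_left_module[OF R]
  obtain X0 :: "'x set" and e where X0: "finite X0" and e: "e \<in> mod_hom R (free_module R X0) A"
    "e ` carrier (free_module R X0) = carrier A"
    using fin_gen_free_cover[OF A left_module.submodule_carrier[OF A] _ inf] fg fg_module_iff by metis
  let ?K0 = "{y \<in> carrier (free_module R X0). e y = \<zero>\<^bsub>A\<^esub>}"
  define P where "P n s = (case s of (X :: 'x set, K, d :: ('x \<Rightarrow> 'r) \<Rightarrow> ('x \<Rightarrow> 'r)) \<Rightarrow>
      finite X \<and> submodule K R (free_module R X) \<and> (n = 0 \<longrightarrow> X = X0 \<and> K = ?K0))" for n :: nat and s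
  define Q where "Q n s s' = (case s of (X, K, _) \<Rightarrow> case s' of (X', K', d) \<Rightarrow>
      d \<in> mod_hom R (free_module R X') (free_module R X) \<and> d ` carrier (free_module R X') = K \<and>
      K' = {y \<in> carrier (free_module R X'). d y = \<zero>\<^bsub>free_module R X\<^esub>})"
    for n :: nat and s s' :: "'x set \<times> ('x \<Rightarrow> 'r) set \<times> (('x \<Rightarrow> 'r) \<Rightarrow> ('x \<Rightarrow> 'r))"
  have "\<exists>f. \<forall>n. P n (f n) \<and> Q n (f n) (f (Suc n))"
  proof (rule dependent_nat_choice)
    show "\<exists>x. P 0 x"
      using kernel_submodule[OF F A e(1)] X0 by (auto simp: P_def)
  next
    fix s n assume "P n s"
    then obtain X K d where s: "s = (X, K, d)" and X: "finite X" and K: "submodule K R (free_module R X)"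
      by (auto simp: P_def split: prod.splits)
    obtain X' :: "'x set" and d' where d': "finite X'" "d' \<in> mod_hom R (free_module R X') (free_module R X)"
      "d' ` carrier (free_module R X') = K"
      using fin_gen_free_cover[OF F K noetherian_fin_gen[OF noeth X K] inf] .
    let ?K' = "{y \<in> carrier (free_module R X'). d' y = \<zero>\<^bsub>free_module R X\<^esub>}"
    have "P (Suc n) (X', ?K', d') \<and> Q n s (X', ?K', d')"
      using d' kernel_submodule[OF F F d'(2)] by (simp add: P_def Q_def s)
    then show "\<exists>s'. P (Suc n) s' \<and> Q n s s'" by blast
  qed
  then obtain f where P: "\<And>n. P n (f n)" and Q: "\<And>n. Q n (f n) (f (Suc n))" by blast
  define X where "X n = fst (f n)" for n
  define K where "K n = fst (snd (f n))" for n
  define d where "d n = snd (snd (f (Suc n)))" for n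
  have f: "f n = (X n, K n, snd (snd (f n)))" for n by (simp add: X_def K_def)
  have fin: "finite (X n)" for n using P[of n] by (subst (asm) f) (simp add: P_def)
  have zero: "X 0 = X0" "K 0 = ?K0" using P[of 0] by (subst (asm) f, simp add: P_def)+
  have step: "d n \<in> mod_hom R (free_module R (X (Suc n))) (free_module R (X n))"
    "d n ` carrier (free_module R (X (Suc n))) = K n"
    "K (Suc n) = {y \<in> carrier (free_module R (X (Suc n))). d n y = \<zero>\<^bsub>free_module R (X n)\<^esub>}" for n
    using Q[of n] by (subst (asm) f, subst (asm) (2) f, simp add: Q_def d_def)+
  have "free_resolution R A X d e"
    unfolding free_resolution_def exact_at_def a_kernel_def'
    using step(1) step(2)[of 0] step(2)[of "Suc n" for n] step(3) zero e by auto
  then show ?thesis using fin that by blast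
qed

lemma chosen_resolution_is_resolution:
  fixes R :: "('r, 'c) ring_scheme" and A :: "('r, 'a) module"
  assumes "left_noetherian R" "fg_module R A" "chosen_resolution R A = (X, d)"
  obtains e where "free_resolution R A X d e"
proof -
  obtain X' :: "nat \<Rightarrow> ('a + 'r) list set" and d' e' where "free_resolution R A X' d' e'"
    using free_resolution_exists[OF assms(1,2)] infinite_UNIV_listI by metis
  then have "\<exists>s. case s of (X :: nat \<Rightarrow> ('a + 'r) list set, d) \<Rightarrow> \<exists>e. free_resolution R A X d e" by blast
  from someI_ex[OF this] have "case chosen_resolution R A of (X, d) \<Rightarrow> \<exists>e. free_resolution R A X d e"
    unfolding chosen_resolution_def .
  then show ?thesis using assms(3) that by auto
qed

text \<open>Cocycles and coboundaries as functions that matter only on the carrier. Their extensional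
  representatives are the elements of \<open>cocycles\<close> and \<open>coboundaries\<close>; working without extensionality allows
  plain compositions of homomorphisms.\<close>

definition is_cocycle :: "('r, 'c) ring_scheme \<Rightarrow> (nat \<Rightarrow> 'x set) \<Rightarrow> (nat \<Rightarrow> ('x \<Rightarrow> 'r) \<Rightarrow> ('x \<Rightarrow> 'r))
    \<Rightarrow> ('r, 'm) module \<Rightarrow> nat \<Rightarrow> (('x \<Rightarrow> 'r) \<Rightarrow> 'm) \<Rightarrow> bool" where
  "is_cocycle R X d M i f \<longleftrightarrow> f \<in> mod_hom R (free_module R (X i)) M \<and>
     (\<forall>y\<in>carrier (free_module R (X (Suc i))). f (d i y) = \<zero>\<^bsub>M\<^esub>)"

definition is_coboundary :: "('r, 'c) ring_scheme \<Rightarrow> (nat \<Rightarrow> 'x set) \<Rightarrow> (nat \<Rightarrow> ('x \<Rightarrow> 'r) \<Rightarrow> ('x \<Rightarrow> 'r))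
    \<Rightarrow> ('r, 'm) module \<Rightarrow> nat \<Rightarrow> (('x \<Rightarrow> 'r) \<Rightarrow> 'm) \<Rightarrow> bool" where
  "is_coboundary R X d M i f \<longleftrightarrow> (case i of
       0 \<Rightarrow> \<forall>y\<in>carrier (free_module R (X 0)). f y = \<zero>\<^bsub>M\<^esub>
     | Suc j \<Rightarrow> \<exists>g\<in>mod_hom R (free_module R (X j)) M. \<forall>y\<in>carrier (free_module R (X i)). f y = g (d j y))"

lemma resolutionD:
  assumes "free_resolution R A X d e"
  shows "e \<in> mod_hom R (free_module R (X 0)) A"
    and "e ` carrier (free_module R (X 0)) = carrier A"
    and "d i \<in> mod_hom R (free_module R (X (Suc i))) (free_module R (X i))"
    and "d 0 ` carrier (free_module R (X (Suc 0))) = {y \<in> carrier (free_module R (X 0)). e y = \<zero>\<^bsub>A\<^esub>}"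
    and "d (Suc i) ` carrier (free_module R (X (Suc (Suc i)))) =
           {y \<in> carrier (free_module R (X (Suc i))). d i y = \<zero>\<^bsub>free_module R (X i)\<^esub>}"
  using assms unfolding free_resolution_def exact_at_def a_kernel_def' by auto

lemma free_resolution_iso:
  assumes res: "free_resolution R N' X D p" and N': "left_module R N'" and N: "left_module R N"
    and g: "g \<in> mod_hom R N' N"
    and sur: "g ` carrier N' = carrier N" and inj: "\<And>x. x \<in> carrier N' \<Longrightarrow> g x = \<zero>\<^bsub>N\<^esub> \<Longrightarrow> x = \<zero>\<^bsub>N'\<^esub>"
  shows "free_resolution R N X D (\<lambda>y. g (p y))"
proof -
  note r = resolutionD[OF res]
  have "{y \<in> carrier (free_module R (X 0)). g (p y) = \<zero>\<^bsub>N\<^esub>} = {y \<in> carrier (free_module R (X 0)). p y = \<zero>\<^bsub>N'\<^esub>}"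
    using inj mod_hom_closed[OF r(1)] mod_hom_zero[OF N' N g] by auto
  moreover have "(\<lambda>y. g (p y)) ` carrier (free_module R (X 0)) = carrier N"
    unfolding sur[symmetric] r(2)[symmetric] by (simp add: image_image)
  ultimately show ?thesis
    using res mod_hom_comp[OF r(1) g] unfolding free_resolution_def exact_at_def a_kernel_def' by auto
qed

lemma Hom_group_simps [simp]:
  "carrier (Hom_group R M N) = mod_hom R M N \<inter> extensional (carrier M)"
  "zero (Hom_group R M N) = (\<lambda>x\<in>carrier M. \<zero>\<^bsub>N\<^esub>)"
  "add (Hom_group R M N) = (\<lambda>f g. \<lambda>x\<in>carrier M. f x \<oplus>\<^bsub>N\<^esub> g x)"
  by (simp_all add: Hom_group_def)

lemma mod_hom_restrict:
  "left_module R M \<Longrightarrow> f \<in> mod_hom R M N \<Longrightarrow> restrict f (carrier M) \<in> mod_hom R M N"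
  by (rule mod_hom_cong) auto

lemma cocycle_restrict:
  assumes "ring R" "\<And>i. d i \<in> mod_hom R (free_module R (X (Suc i))) (free_module R (X i))"
    and "is_cocycle R X d M i f"
  shows "restrict f (carrier (free_module R (X i))) \<in> cocycles R X d M i"
  using assms(3) mod_hom_closed[OF assms(2)] mod_hom_restrict[OF free_left_module[OF assms(1)]]
  unfolding is_cocycle_def cocycles_def a_kernel_def'
  by (auto simp: pullback_def compose_def intro!: restrict_ext)

lemma coboundaries_iff:
  assumes R: "ring R" and d: "\<And>i. d i \<in> mod_hom R (free_module R (X (Suc i))) (free_module R (X i))"
    and "f \<in> extensional (carrier (free_module R (X i)))"
  shows "f \<in> coboundaries R X d M i \<longleftrightarrow> is_coboundary R X d M i f"
proof (cases i)
  case 0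
  then show ?thesis using assms(3)
    by (auto simp: coboundaries_def is_coboundary_def extensional_def fun_eq_iff restrict_def)
next
  case (Suc j)
  show ?thesis
  proof
    assume "f \<in> coboundaries R X d M i"
    then show "is_coboundary R X d M i f"
      by (auto simp: coboundaries_def is_coboundary_def Suc pullback_def compose_def)
  next
    assume "is_coboundary R X d M i f"
    then obtain g where g: "g \<in> mod_hom R (free_module R (X j)) M"
      "\<And>y. y \<in> carrier (free_module R (X i)) \<Longrightarrow> f y = g (d j y)"
      by (auto simp: is_coboundary_def Suc)
    have "f = pullback (free_module R (X i)) (d j) (restrict g (carrier (free_module R (X j))))"
      using g(2) assms(3) mod_hom_closed[OF d[of j]]
      by (auto simp: pullback_def compose_def extensional_def fun_eq_iff Suc)
    then show "f \<in> coboundaries R X d M i"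
      using mod_hom_restrict[OF free_left_module[OF R] g(1)]
      by (auto simp: coboundaries_def Suc)
  qed
qed

lemma zero_cohomologyD:
  assumes R: "ring R" and d: "\<And>i. d i \<in> mod_hom R (free_module R (X (Suc i))) (free_module R (X i))"
    and M: "left_module R M"
    and zero: "zero_module (cohomology R X d M i)" and f: "is_cocycle R X d M i f"
  shows "is_coboundary R X d M i f"
proof -
  interpret M: left_module R M by fact
  let ?F = "free_module R (X i)" and ?Z = "cocycle_group R X d M i" and ?B = "coboundaries R X d M i"
  let ?f = "restrict f (carrier ?F)"
  have Z: "carrier ?Z = cocycles R X d M i" by (simp add: cocycle_group_def)
  have add: "add ?Z = add (Hom_group R ?F M)" by (simp add: cocycle_group_def)
  have f': "?f \<in> cocycles R X d M i" by (rule cocycle_restrict[OF R d f])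
  have "?B +>\<^bsub>?Z\<^esub> ?f \<in> carrier (cohomology R X d M i)"
    using f' by (auto simp: cohomology_def Let_def A_RCOSETS_def' Z)
  then have B: "?B +>\<^bsub>?Z\<^esub> ?f = ?B"
    using zero by (auto simp: zero_module_def cohomology_def Let_def)
  have "is_coboundary R X d M i (\<lambda>x\<in>carrier ?F. \<zero>\<^bsub>M\<^esub>)"
    using mod_hom_const_zero[OF M] by (auto simp: is_coboundary_def split: nat.split intro!: bexI[of _ "\<lambda>_. \<zero>\<^bsub>M\<^esub>"])
  then have z: "(\<lambda>x\<in>carrier ?F. \<zero>\<^bsub>M\<^esub>) \<in> ?B" by (subst coboundaries_iff[where X=X and d=d, OF R d]) auto
  have "f y \<in> carrier M" if "y \<in> carrier ?F" for y
    using f that by (auto simp: is_cocycle_def mod_hom_closed)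
  then have "?f = (\<lambda>x\<in>carrier ?F. \<zero>\<^bsub>M\<^esub>) \<oplus>\<^bsub>?Z\<^esub> ?f" by (auto simp: add fun_eq_iff)
  then have "?f \<in> ?B" using z B unfolding a_r_coset_def' by blast
  then have "is_coboundary R X d M i ?f"
    using coboundaries_iff[where X=X and d=d and f="?f", OF R d restrict_extensional] by blast
  then show ?thesis by (auto simp: is_coboundary_def split: nat.splits)
qed

section \<open>Injective modules\<close>

text \<open>The extension property for ideals only, where an extension to \<open>R\<close> is multiplication by some \<open>y\<close>. In contrast to
  \<open>injective_module\<close> it mentions no type of test modules.\<close>

definition baer :: "('r, 'c) ring_scheme \<Rightarrow> ('r, 'm) module \<Rightarrow> bool" where
  "baer R I \<longleftrightarrow> left_module R I \<and>
     (\<forall>L h. submodule L R (regular_module R) \<and> h \<in> mod_hom R ((regular_module R)\<lparr>carrier := L\<rparr>) I \<longrightarrow>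
        (\<exists>y\<in>carrier I. \<forall>r\<in>L. h r = r \<odot>\<^bsub>I\<^esub> y))"

lemma baer_left_module: "baer R I \<Longrightarrow> left_module R I"
  by (simp add: baer_def)

text \<open>Baer's theorem. Graphs of partial extensions satisfy the conditions in \<open>graphs\<close>, where functionality is reduced
  to the fibre over zero, so that unions of chains are immediate. If a maximal graph \<open>G\<close> missed \<open>z\<close>, the values at \<open>r z\<close> would
  define a homomorphism on the ideal of all \<open>r\<close> with \<open>r z\<close> in the domain; by assumption it is \<open>r \<mapsto> r y0\<close>, and adding
  \<open>(z, y0)\<close> to \<open>G\<close> gives a larger graph.\<close>

lemma baer_extend:
  assumes I: "baer R I" and M: "left_module R M" and H: "submodule H R M"
    and h: "h \<in> mod_hom R (M\<lparr>carrier := H\<rparr>) I"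
  obtains g where "g \<in> mod_hom R M I" "\<And>x. x \<in> H \<Longrightarrow> g x = h x"
proof -
  interpret M: left_module R M by fact
  interpret I: left_module R I using I by (rule baer_left_module)
  interpret r: left_module R "regular_module R" by (rule regular_left_module[OF M.ring_R])
  have Hsub: "H \<subseteq> carrier M" using H by (simp add: M.submodule_iff)
  have h0: "h \<zero>\<^bsub>M\<^esub> = \<zero>\<^bsub>I\<^esub>"
    using mod_hom_zero[OF M.submodule_left_module[OF H] I.left_module_axioms h] by simp
  define graphs where "graphs = {G. G \<subseteq> carrier M \<times> carrier I \<and> (\<forall>x\<in>H. (x, h x) \<in> G) \<and>
     (\<forall>x y x' y'. (x, y) \<in> G \<longrightarrow> (x', y') \<in> G \<longrightarrow> (x \<oplus>\<^bsub>M\<^esub> x', y \<oplus>\<^bsub>I\<^esub> y') \<in> G) \<and>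
     (\<forall>r\<in>carrier R. \<forall>x y. (x, y) \<in> G \<longrightarrow> (r \<odot>\<^bsub>M\<^esub> x, r \<odot>\<^bsub>I\<^esub> y) \<in> G) \<and>
     (\<forall>y. (\<zero>\<^bsub>M\<^esub>, y) \<in> G \<longrightarrow> y = \<zero>\<^bsub>I\<^esub>)}"
  have "(\<lambda>x. (x, h x)) ` H \<in> graphs"
    using H Hsub mod_hom_closed[OF h] mod_hom_add[OF h] mod_hom_smult[OF h] h0
    by (auto simp: graphs_def M.submodule_iff)
  then have ne: "graphs \<noteq> {}" by blast
  have "\<Union>C \<in> graphs" if C: "C \<noteq> {}" "subset.chain graphs C" for C
  proof -
    have ch: "C \<subseteq> graphs" "\<And>A B. A \<in> C \<Longrightarrow> B \<in> C \<Longrightarrow> A \<subseteq> B \<or> B \<subseteq> A"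
      using C(2) by (auto simp: subset.chain_def)
    have "(x \<oplus>\<^bsub>M\<^esub> x', y \<oplus>\<^bsub>I\<^esub> y') \<in> \<Union>C" if "(x, y) \<in> \<Union>C" "(x', y') \<in> \<Union>C" for x y x' y'
    proof -
      obtain A B where "A \<in> C" "(x, y) \<in> A" "B \<in> C" "(x', y') \<in> B" using \<open>(x, y) \<in> \<Union>C\<close> \<open>(x', y') \<in> \<Union>C\<close> by blast
      then obtain D where "D \<in> C" "(x, y) \<in> D" "(x', y') \<in> D" using ch(2)[of A B] by blast
      moreover from \<open>D \<in> C\<close> have "D \<in> graphs" using ch(1) by blast
      ultimately show ?thesis unfolding graphs_def by blast
    qed
    then have "\<forall>x y x' y'. (x, y) \<in> \<Union>C \<longrightarrow> (x', y') \<in> \<Union>C \<longrightarrow> (x \<oplus>\<^bsub>M\<^esub> x', y \<oplus>\<^bsub>I\<^esub> y') \<in> \<Union>C"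
      by simp
    moreover have "\<Union>C \<subseteq> carrier M \<times> carrier I"
      by (rule Union_least) (use ch(1) in \<open>auto simp: graphs_def\<close>)
    moreover have "\<forall>x\<in>H. (x, h x) \<in> \<Union>C"
    proof
      fix x assume "x \<in> H"
      obtain G where "G \<in> C" using C(1) by blast
      then have "(x, h x) \<in> G" using ch(1) \<open>x \<in> H\<close> by (auto simp: graphs_def)
      then show "(x, h x) \<in> \<Union>C" using \<open>G \<in> C\<close> by blast
    qed
    moreover have "\<forall>r\<in>carrier R. \<forall>x y. (x, y) \<in> \<Union>C \<longrightarrow> (r \<odot>\<^bsub>M\<^esub> x, r \<odot>\<^bsub>I\<^esub> y) \<in> \<Union>C"
    proof (intro ballI allI impI)
      fix r x y assume "r \<in> carrier R" "(x, y) \<in> \<Union>C"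
      then obtain G where "G \<in> C" "(x, y) \<in> G" by blast
      then have "(r \<odot>\<^bsub>M\<^esub> x, r \<odot>\<^bsub>I\<^esub> y) \<in> G" using ch(1) \<open>r \<in> carrier R\<close> by (auto simp: graphs_def)
      then show "(r \<odot>\<^bsub>M\<^esub> x, r \<odot>\<^bsub>I\<^esub> y) \<in> \<Union>C" using \<open>G \<in> C\<close> by blast
    qed
    moreover have "\<forall>y. (\<zero>\<^bsub>M\<^esub>, y) \<in> \<Union>C \<longrightarrow> y = \<zero>\<^bsub>I\<^esub>"
      using ch(1) by (auto simp: graphs_def)
    ultimately show ?thesis unfolding graphs_def mem_Collect_eq by (intro conjI)
  qed
  from subset_Zorn_nonempty[OF ne this] obtain G where G: "G \<in> graphs"
    and maxG: "\<And>G'. G' \<in> graphs \<Longrightarrow> G \<subseteq> G' \<Longrightarrow> G' = G" by blast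
  have Gc: "(x, y) \<in> G \<Longrightarrow> x \<in> carrier M \<and> y \<in> carrier I"
    and GH: "x \<in> H \<Longrightarrow> (x, h x) \<in> G"
    and Ga: "(x, y) \<in> G \<Longrightarrow> (x', y') \<in> G \<Longrightarrow> (x \<oplus>\<^bsub>M\<^esub> x', y \<oplus>\<^bsub>I\<^esub> y') \<in> G"
    and Gs: "r \<in> carrier R \<Longrightarrow> (x, y) \<in> G \<Longrightarrow> (r \<odot>\<^bsub>M\<^esub> x, r \<odot>\<^bsub>I\<^esub> y) \<in> G"
    and G0: "(\<zero>\<^bsub>M\<^esub>, y) \<in> G \<Longrightarrow> y = \<zero>\<^bsub>I\<^esub>" for x y x' y' r
    using G unfolding graphs_def by auto
  have Gf: "y = y'" if a: "(x, y) \<in> G" "(x, y') \<in> G" for x y y'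
  proof -
    have "(\<ominus>\<^bsub>M\<^esub> x, \<ominus>\<^bsub>I\<^esub> y') \<in> G"
      using Gs[OF _ a(2), of "\<ominus>\<^bsub>R\<^esub> \<one>\<^bsub>R\<^esub>"] Gc[OF a(2)] by (simp add: M.neg_conv_smult I.neg_conv_smult)
    from Ga[OF a(1) this] have "y \<ominus>\<^bsub>I\<^esub> y' = \<zero>\<^bsub>I\<^esub>"
      using Gc[OF a(1)] by (intro G0) (simp add: M.M.r_neg a_minus_def)
    then show ?thesis using Gc a by simp
  qed
  have GZ: "(\<zero>\<^bsub>M\<^esub>, \<zero>\<^bsub>I\<^esub>) \<in> G" using GH[of "\<zero>\<^bsub>M\<^esub>"] H h0 by (simp add: M.submodule_iff)
  have total: "\<exists>y. (z, y) \<in> G" if z: "z \<in> carrier M" for z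
  proof -
    define L where "L = {r \<in> carrier R. \<exists>y. (r \<odot>\<^bsub>M\<^esub> z, y) \<in> G}"
    define k where "k r = (SOME y. (r \<odot>\<^bsub>M\<^esub> z, y) \<in> G)" for r
    have k: "(r \<odot>\<^bsub>M\<^esub> z, k r) \<in> G" if "r \<in> L" for r
      using that unfolding L_def k_def by (auto intro: someI)
    have La: "r \<oplus>\<^bsub>R\<^esub> s \<in> L \<and> k (r \<oplus>\<^bsub>R\<^esub> s) = k r \<oplus>\<^bsub>I\<^esub> k s" if "r \<in> L" "s \<in> L" for r s
    proof -
      have "((r \<oplus>\<^bsub>R\<^esub> s) \<odot>\<^bsub>M\<^esub> z, k r \<oplus>\<^bsub>I\<^esub> k s) \<in> G"
        using Ga[OF k[OF that(1)] k[OF that(2)]] that z by (simp add: L_def M.smult_l_distr)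
      moreover from this have "r \<oplus>\<^bsub>R\<^esub> s \<in> L" using that by (auto simp: L_def)
      ultimately show ?thesis using k Gf by blast
    qed
    have Ls: "r \<otimes>\<^bsub>R\<^esub> s \<in> L \<and> k (r \<otimes>\<^bsub>R\<^esub> s) = r \<odot>\<^bsub>I\<^esub> k s" if "r \<in> carrier R" "s \<in> L" for r s
    proof -
      have "((r \<otimes>\<^bsub>R\<^esub> s) \<odot>\<^bsub>M\<^esub> z, r \<odot>\<^bsub>I\<^esub> k s) \<in> G"
        using Gs[OF that(1) k[OF that(2)]] that z by (simp add: L_def M.smult_assoc1)
      moreover from this have "r \<otimes>\<^bsub>R\<^esub> s \<in> L" using that by (auto simp: L_def)
      ultimately show ?thesis using k Gf by blast
    qed
    have L: "submodule L R (regular_module R)"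
      using La Ls GZ z by (auto simp: r.submodule_iff L_def)
    have "k \<in> mod_hom R ((regular_module R)\<lparr>carrier := L\<rparr>) I"
      using La Ls Gc[OF k] by (intro mod_homI) auto
    then obtain y0 where y0: "y0 \<in> carrier I" "\<And>r. r \<in> L \<Longrightarrow> k r = r \<odot>\<^bsub>I\<^esub> y0"
      using I L unfolding baer_def by blast
    define G' where "G' = {(x \<oplus>\<^bsub>M\<^esub> r \<odot>\<^bsub>M\<^esub> z, y \<oplus>\<^bsub>I\<^esub> r \<odot>\<^bsub>I\<^esub> y0) |x y r. (x, y) \<in> G \<and> r \<in> carrier R}"
    have G'I: "(x \<oplus>\<^bsub>M\<^esub> r \<odot>\<^bsub>M\<^esub> z, y \<oplus>\<^bsub>I\<^esub> r \<odot>\<^bsub>I\<^esub> y0) \<in> G'" if "(x, y) \<in> G" "r \<in> carrier R" for x y r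
      using that by (auto simp: G'_def)
    have GG': "G \<subseteq> G'"
    proof
      fix p assume "p \<in> G"
      then show "p \<in> G'" using G'I[of "fst p" "snd p" "\<zero>\<^bsub>R\<^esub>"] Gc[of "fst p" "snd p"] z y0 by simp
    qed
    have "G' \<in> graphs"
      unfolding graphs_def
    proof (intro CollectI conjI allI impI ballI)
      show "G' \<subseteq> carrier M \<times> carrier I" using Gc z y0(1) by (auto simp: G'_def)
      show "(x, h x) \<in> G'" if "x \<in> H" for x using GH[OF that] GG' by blast
    next
      fix x y x' y' assume "(x, y) \<in> G'" "(x', y') \<in> G'"
      then obtain a b r a' b' r' where *: "(a, b) \<in> G" "r \<in> carrier R" "(a', b') \<in> G" "r' \<in> carrier R"
        "x = a \<oplus>\<^bsub>M\<^esub> r \<odot>\<^bsub>M\<^esub> z" "y = b \<oplus>\<^bsub>I\<^esub> r \<odot>\<^bsub>I\<^esub> y0"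
        "x' = a' \<oplus>\<^bsub>M\<^esub> r' \<odot>\<^bsub>M\<^esub> z" "y' = b' \<oplus>\<^bsub>I\<^esub> r' \<odot>\<^bsub>I\<^esub> y0" by (auto simp: G'_def)
      have "(a \<oplus>\<^bsub>M\<^esub> a' \<oplus>\<^bsub>M\<^esub> (r \<oplus>\<^bsub>R\<^esub> r') \<odot>\<^bsub>M\<^esub> z, b \<oplus>\<^bsub>I\<^esub> b' \<oplus>\<^bsub>I\<^esub> (r \<oplus>\<^bsub>R\<^esub> r') \<odot>\<^bsub>I\<^esub> y0) \<in> G'"
        by (rule G'I) (use * Ga in auto)
      moreover have "a \<oplus>\<^bsub>M\<^esub> a' \<oplus>\<^bsub>M\<^esub> (r \<oplus>\<^bsub>R\<^esub> r') \<odot>\<^bsub>M\<^esub> z = x \<oplus>\<^bsub>M\<^esub> x'"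
        "b \<oplus>\<^bsub>I\<^esub> b' \<oplus>\<^bsub>I\<^esub> (r \<oplus>\<^bsub>R\<^esub> r') \<odot>\<^bsub>I\<^esub> y0 = y \<oplus>\<^bsub>I\<^esub> y'"
        using * Gc z y0(1) by (simp_all add: M.smult_l_distr I.smult_l_distr M.M.a_ac I.M.a_ac)
      ultimately show "(x \<oplus>\<^bsub>M\<^esub> x', y \<oplus>\<^bsub>I\<^esub> y') \<in> G'" by simp
    next
      fix s x y assume s: "s \<in> carrier R" and "(x, y) \<in> G'"
      then obtain a b r where *: "(a, b) \<in> G" "r \<in> carrier R"
        "x = a \<oplus>\<^bsub>M\<^esub> r \<odot>\<^bsub>M\<^esub> z" "y = b \<oplus>\<^bsub>I\<^esub> r \<odot>\<^bsub>I\<^esub> y0" by (auto simp: G'_def)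
      have "(s \<odot>\<^bsub>M\<^esub> a \<oplus>\<^bsub>M\<^esub> (s \<otimes>\<^bsub>R\<^esub> r) \<odot>\<^bsub>M\<^esub> z, s \<odot>\<^bsub>I\<^esub> b \<oplus>\<^bsub>I\<^esub> (s \<otimes>\<^bsub>R\<^esub> r) \<odot>\<^bsub>I\<^esub> y0) \<in> G'"
        by (rule G'I) (use * Gs s in auto)
      moreover have "s \<odot>\<^bsub>M\<^esub> a \<oplus>\<^bsub>M\<^esub> (s \<otimes>\<^bsub>R\<^esub> r) \<odot>\<^bsub>M\<^esub> z = s \<odot>\<^bsub>M\<^esub> x"
        "s \<odot>\<^bsub>I\<^esub> b \<oplus>\<^bsub>I\<^esub> (s \<otimes>\<^bsub>R\<^esub> r) \<odot>\<^bsub>I\<^esub> y0 = s \<odot>\<^bsub>I\<^esub> y"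
        using * Gc z y0(1) s by (simp_all add: M.smult_r_distr I.smult_r_distr M.smult_assoc1 I.smult_assoc1)
      ultimately show "(s \<odot>\<^bsub>M\<^esub> x, s \<odot>\<^bsub>I\<^esub> y) \<in> G'" by simp
    next
      fix y assume "(\<zero>\<^bsub>M\<^esub>, y) \<in> G'"
      then obtain a b r where *: "(a, b) \<in> G" "r \<in> carrier R"
        "\<zero>\<^bsub>M\<^esub> = a \<oplus>\<^bsub>M\<^esub> r \<odot>\<^bsub>M\<^esub> z" "y = b \<oplus>\<^bsub>I\<^esub> r \<odot>\<^bsub>I\<^esub> y0" by (auto simp: G'_def)
      have ab: "a \<in> carrier M" "b \<in> carrier I" using Gc *(1) by auto
      have "\<ominus>\<^bsub>M\<^esub> a = r \<odot>\<^bsub>M\<^esub> z"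
        using *(3) ab M.M.minus_equality[of "r \<odot>\<^bsub>M\<^esub> z" a] M.smult_closed[OF *(2) z] M.M.a_comm[of a "r \<odot>\<^bsub>M\<^esub> z"] by simp
      moreover have "(\<ominus>\<^bsub>M\<^esub> a, \<ominus>\<^bsub>I\<^esub> b) \<in> G"
        using Gs[OF _ *(1), of "\<ominus>\<^bsub>R\<^esub> \<one>\<^bsub>R\<^esub>"] ab by (simp add: M.neg_conv_smult I.neg_conv_smult)
      ultimately have "r \<in> L" using *(2) by (auto simp: L_def)
      then have "(r \<odot>\<^bsub>M\<^esub> z, r \<odot>\<^bsub>I\<^esub> y0) \<in> G" using k y0(2) by metis
      from Ga[OF *(1) this] show "y = \<zero>\<^bsub>I\<^esub>" using *(3,4) by (auto intro: G0)
    qed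
    then have "G' = G" using maxG GG' by blast
    moreover have "(z, y0) \<in> G'" using G'I[OF GZ, of "\<one>\<^bsub>R\<^esub>"] z y0(1) by simp
    ultimately show ?thesis by blast
  qed
  define g where "g x = (SOME y. (x, y) \<in> G)" for x
  have g: "(x, g x) \<in> G" if "x \<in> carrier M" for x
    using someI_ex[OF total[OF that]] unfolding g_def .
  have "g \<in> mod_hom R M I"
    by (rule mod_homI) (use g Gc Ga Gs Gf M.M.a_closed M.smult_closed in metis)+
  moreover have "g x = h x" if "x \<in> H" for x
    using g GH Gf that Hsub by blast
  ultimately show ?thesis using that by blast
qed

text \<open>Exactness of \<open>Hom(-, I)\<close>.\<close>

lemma baer_extend_along:
  assumes I: "baer R I" and A: "left_module R A" and B: "left_module R B"
    and f: "f \<in> mod_hom R A B" and h: "h \<in> mod_hom R A I"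
    and ker: "\<And>x. x \<in> carrier A \<Longrightarrow> f x = \<zero>\<^bsub>B\<^esub> \<Longrightarrow> h x = \<zero>\<^bsub>I\<^esub>"
  obtains g where "g \<in> mod_hom R B I" "\<And>x. x \<in> carrier A \<Longrightarrow> g (f x) = h x"
proof -
  interpret B: left_module R B by fact
  let ?H = "f ` carrier A"
  have H: "submodule ?H R B" by (rule image_submodule[OF A B f])
  have f': "f \<in> mod_hom R A (B\<lparr>carrier := ?H\<rparr>)" using f by (rule mod_hom_restrict_cod) blast
  obtain k where k: "k \<in> mod_hom R (B\<lparr>carrier := ?H\<rparr>) I" "\<And>x. x \<in> carrier A \<Longrightarrow> k (f x) = h x"
    by (rule factor_through_surjection[OF A B.submodule_left_module[OF H] baer_left_module[OF I] f' _ h])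
      (use ker in auto)
  obtain g where "g \<in> mod_hom R B I" "\<And>x. x \<in> ?H \<Longrightarrow> g x = k x"
    by (rule baer_extend[OF I B H k(1)]) blast
  then show ?thesis using that k(2) by auto
qed

lemma baer_injective_module: "baer R I \<Longrightarrow> injective_module R I"
  unfolding injective_module_def by (metis baer_extend baer_left_module)

text \<open>The ring has a copy among the test modules, so their extension property yields Baer's criterion.\<close>

lemma injective_module_baer:
  fixes R :: "('r, 'c) ring_scheme" and I :: "('r, 'm) module"
  assumes inj: "injective_module R I" shows "baer R I"
  unfolding baer_def
proof (intro conjI allI impI; (elim conjE)?)
  show I: "left_module R I" using inj by (simp add: injective_module_def)
  interpret I: left_module R I by fact
  interpret r: left_module R "regular_module R" by (rule regular_left_module[OF I.ring_R])
  fix L h assume L: "submodule L R (regular_module R)"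
    and h: "h \<in> mod_hom R ((regular_module R)\<lparr>carrier := L\<rparr>) I"
  define c :: "'r \<Rightarrow> ('r, 'm) large" where "c r = (\<lambda>s. (undefined, if s = r then 1 else 0))" for r
  have "c r = c s \<Longrightarrow> r = s" for r s
    by (drule fun_cong[of _ _ r]) (simp add: c_def split: if_splits)
  then have ic: "inv_into UNIV c (c r) = r" for r by (simp add: inv_f_f inj_def)
  define M :: "('r, ('r, 'm) large) module" where
    "M = \<lparr>carrier = c ` carrier R, mult = undefined, one = undefined, zero = c \<zero>\<^bsub>R\<^esub>,
      add = (\<lambda>x y. c (inv_into UNIV c x \<oplus>\<^bsub>R\<^esub> inv_into UNIV c y)), smult = (\<lambda>r x. c (r \<otimes>\<^bsub>R\<^esub> inv_into UNIV c x))\<rparr>"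
  have M: "left_module R M"
    by (rule left_module_image[OF r.left_module_axioms, of _ c]) (simp_all add: M_def ic)
  interpret M: left_module R M by fact
  have Lsub: "L \<subseteq> carrier R" using L by (simp add: r.submodule_iff)
  have H: "submodule (c ` L) R M"
    using L unfolding M.submodule_iff r.submodule_iff by (auto simp: M_def ic)
  have h': "(\<lambda>x. h (inv_into UNIV c x)) \<in> mod_hom R (M\<lparr>carrier := c ` L\<rparr>) I"
    using mod_hom_closed[OF h] mod_hom_add[OF h] mod_hom_smult[OF h]
    by (intro mod_homI) (auto simp: M_def ic)
  obtain g where g: "g \<in> mod_hom R M I" "\<And>x. x \<in> c ` L \<Longrightarrow> g x = h (inv_into UNIV c x)"
    using inj M H h' unfolding injective_module_def by metis
  have "c \<one>\<^bsub>R\<^esub> \<in> carrier M" by (simp add: M_def)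
  moreover have "h r = r \<odot>\<^bsub>I\<^esub> g (c \<one>\<^bsub>R\<^esub>)" if "r \<in> L" for r
  proof -
    have "r \<in> carrier R" using that Lsub by auto
    then have "r \<odot>\<^bsub>M\<^esub> c \<one>\<^bsub>R\<^esub> = c r" by (simp add: M_def ic)
    moreover have "h r = g (c r)" using g(2)[of "c r"] that by (simp add: ic)
    ultimately show ?thesis
      using mod_hom_smult[OF g(1) \<open>r \<in> carrier R\<close> \<open>c \<one>\<^bsub>R\<^esub> \<in> carrier M\<close>] by simp
  qed
  ultimately show "\<exists>y\<in>carrier I. \<forall>r\<in>L. h r = r \<odot>\<^bsub>I\<^esub> y"
    using mod_hom_closed[OF g(1)] by blast
qed

section \<open>Ext through an injective resolution\<close>

text \<open>Exactness of \<open>Hom(A, J)\<close> at \<open>J k\<close>. For an injective resolution \<open>J\<close> of \<open>U\<close> this says \<open>Ext k (A, U) = 0\<close>.\<close>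

definition ext_zero :: "('r, 'c) ring_scheme \<Rightarrow> (nat \<Rightarrow> ('r, 'i) module) \<Rightarrow> (nat \<Rightarrow> 'i \<Rightarrow> 'i) \<Rightarrow> nat
    \<Rightarrow> ('r, 'a) module \<Rightarrow> bool" where
  "ext_zero R J d k A \<longleftrightarrow> (\<forall>f\<in>mod_hom R A (J k). (\<forall>x\<in>carrier A. d k (f x) = \<zero>\<^bsub>J (Suc k)\<^esub>) \<longrightarrow>
     (case k of 0 \<Rightarrow> \<forall>x\<in>carrier A. f x = \<zero>\<^bsub>J 0\<^esub>
      | Suc j \<Rightarrow> \<exists>g\<in>mod_hom R A (J j). \<forall>x\<in>carrier A. f x = d j (g x)))"

locale inj_res =
  fixes R :: "('r, 'c) ring_scheme" and U :: "('r, 'u) module" and J :: "nat \<Rightarrow> ('r, 'i) module"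
    and e :: "'u \<Rightarrow> 'i" and d :: "nat \<Rightarrow> 'i \<Rightarrow> 'i"
  assumes U: "left_module R U" and baer_J: "baer R (J q)"
    and e: "e \<in> mod_hom R U (J 0)" and inj_e: "inj_on e (carrier U)"
    and d: "d q \<in> mod_hom R (J q) (J (Suc q))"
    and exact_e: "e ` carrier U = {x \<in> carrier (J 0). d 0 x = \<zero>\<^bsub>J (Suc 0)\<^esub>}"
    and exact_d: "d q ` carrier (J q) = {x \<in> carrier (J (Suc q)). d (Suc q) x = \<zero>\<^bsub>J (Suc (Suc q))\<^esub>}"
begin

lemma J: "left_module R (J q)" by (rule baer_left_module[OF baer_J])

lemma d_e: "u \<in> carrier U \<Longrightarrow> d 0 (e u) = \<zero>\<^bsub>J (Suc 0)\<^esub>" using exact_e by auto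
lemma d_d: "x \<in> carrier (J q) \<Longrightarrow> d (Suc q) (d q x) = \<zero>\<^bsub>J (Suc (Suc q))\<^esub>" using exact_d[of q] by auto

lemma kernel_d: "x \<in> carrier (J (Suc q)) \<Longrightarrow> d (Suc q) x = \<zero>\<^bsub>J (Suc (Suc q))\<^esub> \<Longrightarrow> \<exists>y\<in>carrier (J q). x = d q y"
  using exact_d[of q] by blast

lemma e_eq_zero: "u \<in> carrier U \<Longrightarrow> e u = \<zero>\<^bsub>J 0\<^esub> \<Longrightarrow> u = \<zero>\<^bsub>U\<^esub>"
proof -
  assume u: "u \<in> carrier U" "e u = \<zero>\<^bsub>J 0\<^esub>"
  interpret U: left_module R U by (rule U)
  show ?thesis using inj_onD[OF inj_e, of u "\<zero>\<^bsub>U\<^esub>"] u mod_hom_zero[OF U J e] by simp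
qed

lemma lift_to_U:
  assumes "f \<in> mod_hom R A (J 0)" "\<And>x. x \<in> carrier A \<Longrightarrow> d 0 (f x) = \<zero>\<^bsub>J (Suc 0)\<^esub>" "left_module R A"
  obtains t where "t \<in> mod_hom R A U" "\<And>x. x \<in> carrier A \<Longrightarrow> f x = e (t x)"
proof -
  interpret A: left_module R A by fact
  interpret U: left_module R U by (rule U)
  define t where "t x = inv_into (carrier U) e (f x)" for x
  have *: "f x \<in> e ` carrier U" if "x \<in> carrier A" for x
    using assms(2)[OF that] mod_hom_closed[OF assms(1) that] exact_e by simp
  have t: "t x \<in> carrier U" "e (t x) = f x" if "x \<in> carrier A" for x
    using *[OF that] unfolding t_def by (auto intro: inv_into_into f_inv_into_f)
  have "t \<in> mod_hom R A U"
  proof (rule mod_homI)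
    fix x y assume xy: "x \<in> carrier A" "y \<in> carrier A"
    show "t (x \<oplus>\<^bsub>A\<^esub> y) = t x \<oplus>\<^bsub>U\<^esub> t y"
      by (rule inj_onD[OF inj_e]) (use xy t in \<open>simp_all add: mod_hom_add[OF e] mod_hom_add[OF assms(1)]\<close>)
  next
    fix r x assume xy: "r \<in> carrier R" "x \<in> carrier A"
    show "t (r \<odot>\<^bsub>A\<^esub> x) = r \<odot>\<^bsub>U\<^esub> t x"
      by (rule inj_onD[OF inj_e]) (use xy t in \<open>simp_all add: mod_hom_smult[OF e] mod_hom_smult[OF assms(1)]\<close>)
  qed (simp add: t)
  then show ?thesis using that t by metis
qed

lemma ext_zero_SucD:
  assumes "ext_zero R J d (Suc k) A" "f \<in> mod_hom R A (J (Suc k))"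
    and "\<And>x. x \<in> carrier A \<Longrightarrow> d (Suc k) (f x) = \<zero>\<^bsub>J (Suc (Suc k))\<^esub>"
  obtains g where "g \<in> mod_hom R A (J k)" "\<And>x. x \<in> carrier A \<Longrightarrow> f x = d k (g x)"
  using assms unfolding ext_zero_def by auto

lemma ext_zero_SucI:
  assumes "\<And>f. f \<in> mod_hom R A (J (Suc k)) \<Longrightarrow>
     (\<And>x. x \<in> carrier A \<Longrightarrow> d (Suc k) (f x) = \<zero>\<^bsub>J (Suc (Suc k))\<^esub>) \<Longrightarrow>
     \<exists>g\<in>mod_hom R A (J k). \<forall>x\<in>carrier A. f x = d k (g x)"
  shows "ext_zero R J d (Suc k) A"
  using assms unfolding ext_zero_def by auto

lemma ext_zero_iso:
  assumes A: "left_module R A" and B: "left_module R B" and g: "g \<in> mod_hom R A B"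
    and sur: "g ` carrier A = carrier B" and inj: "\<And>x. x \<in> carrier A \<Longrightarrow> g x = \<zero>\<^bsub>B\<^esub> \<Longrightarrow> x = \<zero>\<^bsub>A\<^esub>"
    and z: "ext_zero R J d k A"
  shows "ext_zero R J d k B"
  unfolding ext_zero_def
proof (intro ballI impI)
  fix f assume f: "f \<in> mod_hom R B (J k)" "\<forall>x\<in>carrier B. d k (f x) = \<zero>\<^bsub>J (Suc k)\<^esub>"
  let ?f = "\<lambda>x. f (g x)"
  have f': "?f \<in> mod_hom R A (J k)" by (rule mod_hom_comp[OF g f(1)])
  have f'': "\<forall>x\<in>carrier A. d k (?f x) = \<zero>\<^bsub>J (Suc k)\<^esub>" using f(2) mod_hom_closed[OF g] by auto
  show "case k of 0 \<Rightarrow> \<forall>x\<in>carrier B. f x = \<zero>\<^bsub>J 0\<^esub>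
      | Suc j \<Rightarrow> \<exists>g\<in>mod_hom R B (J j). \<forall>x\<in>carrier B. f x = d j (g x)"
  proof (cases k)
    case 0
    then have "\<forall>x\<in>carrier A. ?f x = \<zero>\<^bsub>J 0\<^esub>" using z f' f'' unfolding ext_zero_def by auto
    then show ?thesis using 0 by (auto simp flip: sur)
  next
    case (Suc j)
    then obtain h where h: "h \<in> mod_hom R A (J j)" "\<forall>x\<in>carrier A. ?f x = d j (h x)"
      using z f' f'' unfolding ext_zero_def by auto
    obtain h' where "h' \<in> mod_hom R B (J j)" "\<And>x. x \<in> carrier A \<Longrightarrow> h' (g x) = h x"
      by (rule factor_through_surjection[OF A B J g sur h(1)]) (use inj mod_hom_zero[OF A J h(1)] in blast)+
    then show ?thesis using h(2) Suc by (auto simp flip: sur intro!: bexI[of _ h'])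
  qed
qed

lemma ext_zero_beyond:
  assumes "zero_module (J (Suc k))" shows "ext_zero R J d (Suc k) A"
proof (rule ext_zero_SucI)
  fix f assume "f \<in> mod_hom R A (J (Suc k))"
  then show "\<exists>g\<in>mod_hom R A (J k). \<forall>x\<in>carrier A. f x = d k (g x)"
    using mod_hom_const_zero[OF J, of k A] mod_hom_zero[OF J J d] mod_hom_closed[of f R A "J (Suc k)"] assms
    by (intro bexI[of _ "\<lambda>_. \<zero>\<^bsub>J k\<^esub>"]) (auto simp: zero_module_def)
qed

end

text \<open>Pieces of the long exact sequence of \<open>Ext\<close> for a surjection \<open>g\<close> with kernel \<open>K\<close>.
  As every \<open>J q\<close> is injective, \<open>Hom(-, J q)\<close> is exact, and all are diagram chases.\<close>

locale inj_res_surjection = inj_res R U J e d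
  for R :: "('r, 'c) ring_scheme" and U :: "('r, 'u) module" and J :: "nat \<Rightarrow> ('r, 'i) module" and e d +
  fixes A :: "('r, 'a) module" and B :: "('r, 'b) module" and g
  assumes A: "left_module R A" and B: "left_module R B" and g: "g \<in> mod_hom R A B"
    and g_sur: "g ` carrier A = carrier B"
begin

definition ker where "ker = {x \<in> carrier A. g x = \<zero>\<^bsub>B\<^esub>}"
abbreviation K where "K \<equiv> A\<lparr>carrier := ker\<rparr>"

lemma ker_submodule: "submodule ker R A"
  unfolding ker_def by (rule kernel_submodule[OF A B g])

lemma K: "left_module R K"
  by (rule left_module.submodule_left_module[OF A ker_submodule])

lemma ker_sub: "ker \<subseteq> carrier A" by (auto simp: ker_def)

lemma factor:
  assumes "P = J q" "f \<in> mod_hom R A P" "\<And>x. x \<in> ker \<Longrightarrow> f x = \<zero>\<^bsub>P\<^esub>"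
  obtains h where "h \<in> mod_hom R B P" "\<And>x. x \<in> carrier A \<Longrightarrow> h (g x) = f x"
  by (rule factor_through_surjection[OF A B _ g g_sur assms(2)]) (use assms J in \<open>auto simp: ker_def\<close>)

text \<open>Exactness of \<open>Hom(A, U) \<rightarrow> Hom(K, U) \<rightarrow> Ext 1 (B, U) \<rightarrow> Ext 1 (A, U)\<close>.\<close>

lemma ext_zero_quotient_1:
  assumes z: "ext_zero R J d (Suc 0) A"
    and ext: "\<And>t. t \<in> mod_hom R K U \<Longrightarrow> \<exists>t'\<in>mod_hom R A U. \<forall>x\<in>ker. t' x = t x"
  shows "ext_zero R J d (Suc 0) B"
proof (rule ext_zero_SucI)
  fix f assume f: "f \<in> mod_hom R B (J (Suc 0))" "\<And>x. x \<in> carrier B \<Longrightarrow> d (Suc 0) (f x) = \<zero>\<^bsub>J (Suc (Suc 0))\<^esub>"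
  obtain h where h: "h \<in> mod_hom R A (J 0)" "\<And>x. x \<in> carrier A \<Longrightarrow> f (g x) = d 0 (h x)"
    by (rule ext_zero_SucD[OF z mod_hom_comp[OF g f(1)]]) (use f(2) mod_hom_closed[OF g] in auto)
  have "d 0 (h x) = \<zero>\<^bsub>J (Suc 0)\<^esub>" if "x \<in> ker" for x
    using h(2)[of x] that mod_hom_zero[OF B J f(1)] by (auto simp: ker_def)
  then obtain t where t: "t \<in> mod_hom R K U" "\<And>x. x \<in> ker \<Longrightarrow> h x = e (t x)"
    using lift_to_U[OF mod_hom_restrict_dom[OF h(1) ker_sub] _ K] by auto
  obtain t' where t': "t' \<in> mod_hom R A U" "\<And>x. x \<in> ker \<Longrightarrow> t' x = t x" using ext[OF t(1)] by auto
  have et': "(\<lambda>x. e (t' x)) \<in> mod_hom R A (J 0)" by (rule mod_hom_comp[OF t'(1) e])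
  interpret J0: left_module R "J 0" by (rule J)
  interpret J1: left_module R "J (Suc 0)" by (rule J)
  obtain k where k: "k \<in> mod_hom R B (J 0)" "\<And>x. x \<in> carrier A \<Longrightarrow> k (g x) = h x \<ominus>\<^bsub>J 0\<^esub> e (t' x)"
    by (rule factor[OF refl mod_hom_minus[OF J h(1) et']])
      (use t(2) t'(2) mod_hom_closed[OF e mod_hom_closed[OF t(1)]] in auto)
  have "f (g x) = d 0 (k (g x))" if x: "x \<in> carrier A" for x
    using x by (simp add: k(2) mod_hom_diff[OF J J d] mod_hom_closed[OF h(1)] mod_hom_closed[OF et']
        mod_hom_closed[OF d] d_e mod_hom_closed[OF t'(1)] h(2))
  then show "\<exists>k\<in>mod_hom R B (J 0). \<forall>x\<in>carrier B. f x = d 0 (k x)"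
    using k(1) by (auto simp flip: g_sur)
qed

lemma ext_zero_quotient:
  assumes z: "ext_zero R J d (Suc k) A" and zK: "ext_zero R J d k K"
  shows "ext_zero R J d (Suc k) B"
proof (rule ext_zero_SucI)
  fix f assume f: "f \<in> mod_hom R B (J (Suc k))" "\<And>x. x \<in> carrier B \<Longrightarrow> d (Suc k) (f x) = \<zero>\<^bsub>J (Suc (Suc k))\<^esub>"
  interpret Jk: left_module R "J k" by (rule J)
  interpret Jk1: left_module R "J (Suc k)" by (rule J)
  obtain h where h: "h \<in> mod_hom R A (J k)" "\<And>x. x \<in> carrier A \<Longrightarrow> f (g x) = d k (h x)"
    by (rule ext_zero_SucD[OF z mod_hom_comp[OF g f(1)]]) (use f(2) mod_hom_closed[OF g] in auto)
  have dh: "d k (h x) = \<zero>\<^bsub>J (Suc k)\<^esub>" if "x \<in> ker" for x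
    using h(2)[of x] that mod_hom_zero[OF B J f(1)] by (auto simp: ker_def)
  have hK: "h \<in> mod_hom R K (J k)" by (rule mod_hom_restrict_dom[OF h(1) ker_sub])
  obtain w where w: "w \<in> mod_hom R A (J k)" "\<And>x. x \<in> ker \<Longrightarrow> w x = h x"
    "\<And>x. x \<in> carrier A \<Longrightarrow> d k (w x) = \<zero>\<^bsub>J (Suc k)\<^esub>"
  proof (cases k)
    case 0
    have "h x = \<zero>\<^bsub>J k\<^esub>" if "x \<in> ker" for x
      using zK hK dh that 0 unfolding ext_zero_def by auto
    then show ?thesis using that[OF mod_hom_const_zero[OF J]] mod_hom_zero[OF J J d] by auto
  next
    case (Suc j)
    obtain u where u: "u \<in> mod_hom R K (J j)" "\<And>x. x \<in> ker \<Longrightarrow> h x = d j (u x)"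
      using ext_zero_SucD[of j K h] zK hK dh Suc by auto
    obtain u' where u': "u' \<in> mod_hom R A (J j)" "\<And>x. x \<in> ker \<Longrightarrow> u' x = u x"
      by (rule baer_extend[OF baer_J A ker_submodule u(1)]) blast
    show ?thesis
      by (rule that[of "\<lambda>x. d j (u' x)"])
        (use mod_hom_comp[OF u'(1) d] u'(2) u(2) Suc d_d mod_hom_closed[OF u'(1)] in auto)
  qed
  obtain v where v: "v \<in> mod_hom R B (J k)" "\<And>x. x \<in> carrier A \<Longrightarrow> v (g x) = h x \<ominus>\<^bsub>J k\<^esub> w x"
    by (rule factor[OF refl mod_hom_minus[OF J h(1) w(1)]])
      (use w(2) ker_sub mod_hom_closed[OF h(1)] in auto)
  have "f (g x) = d k (v (g x))" if x: "x \<in> carrier A" for x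
    using x by (simp add: v(2) mod_hom_diff[OF J J d] mod_hom_closed[OF h(1)] mod_hom_closed[OF w(1)]
        mod_hom_closed[OF d] w(3) h(2))
  then show "\<exists>k'\<in>mod_hom R B (J k). \<forall>x\<in>carrier B. f x = d k (k' x)"
    using v(1) by (auto simp flip: g_sur)
qed

lemma ext_zero_kernel:
  assumes z: "ext_zero R J d (Suc k) A" and zB: "ext_zero R J d (Suc (Suc k)) B"
  shows "ext_zero R J d (Suc k) K"
proof (rule ext_zero_SucI)
  fix f assume f: "f \<in> mod_hom R K (J (Suc k))" "\<And>x. x \<in> carrier K \<Longrightarrow> d (Suc k) (f x) = \<zero>\<^bsub>J (Suc (Suc k))\<^esub>"
  interpret J1: left_module R "J (Suc k)" by (rule J)
  interpret J2: left_module R "J (Suc (Suc k))" by (rule J)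
  obtain f' where f': "f' \<in> mod_hom R A (J (Suc k))" "\<And>x. x \<in> ker \<Longrightarrow> f' x = f x"
    by (rule baer_extend[OF baer_J A ker_submodule f(1)]) blast
  obtain v where v: "v \<in> mod_hom R B (J (Suc (Suc k)))" "\<And>x. x \<in> carrier A \<Longrightarrow> v (g x) = d (Suc k) (f' x)"
    by (rule factor[OF refl mod_hom_comp[OF f'(1) d]]) (use f' f(2) in auto)
  obtain w where w: "w \<in> mod_hom R B (J (Suc k))" "\<And>x. x \<in> carrier B \<Longrightarrow> v x = d (Suc k) (w x)"
    by (rule ext_zero_SucD[OF zB v(1)]) (use v(2) d_d mod_hom_closed[OF f'(1)] in \<open>auto simp flip: g_sur\<close>)
  have wg: "(\<lambda>x. w (g x)) \<in> mod_hom R A (J (Suc k))" by (rule mod_hom_comp[OF g w(1)])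
  obtain u where u: "u \<in> mod_hom R A (J k)" "\<And>x. x \<in> carrier A \<Longrightarrow> f' x \<ominus>\<^bsub>J (Suc k)\<^esub> w (g x) = d k (u x)"
  proof (rule ext_zero_SucD[OF z mod_hom_minus[OF J f'(1) wg]])
    fix x assume x: "x \<in> carrier A"
    then show "d (Suc k) (f' x \<ominus>\<^bsub>J (Suc k)\<^esub> w (g x)) = \<zero>\<^bsub>J (Suc (Suc k))\<^esub>"
      using v(2)[OF x] w(2)[OF mod_hom_closed[OF g x]]
      by (simp add: mod_hom_diff[OF J J d] mod_hom_closed[OF f'(1)] mod_hom_closed[OF wg] mod_hom_closed[OF d])
  qed blast
  have "f x = d k (u x)" if "x \<in> ker" for x
  proof -
    have "w (g x) = \<zero>\<^bsub>J (Suc k)\<^esub>" using that mod_hom_zero[OF B J w(1)] by (simp add: ker_def)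
    then show ?thesis using u(2)[of x] f'(2)[OF that] that ker_sub mod_hom_closed[OF f'(1), of x] by auto
  qed
  then show "\<exists>g\<in>mod_hom R K (J k). \<forall>x\<in>carrier K. f x = d k (g x)"
    using mod_hom_restrict_dom[OF u(1) ker_sub] by auto
qed

lemma extend_from_kernel:
  assumes z: "ext_zero R J d (Suc 0) B" and t: "t \<in> mod_hom R K U"
  obtains t' where "t' \<in> mod_hom R A U" "\<And>x. x \<in> ker \<Longrightarrow> t' x = t x"
proof -
  interpret J0: left_module R "J 0" by (rule J)
  interpret J1: left_module R "J (Suc 0)" by (rule J)
  obtain h where h: "h \<in> mod_hom R A (J 0)" "\<And>x. x \<in> ker \<Longrightarrow> h x = e (t x)"
    by (rule baer_extend[OF baer_J A ker_submodule mod_hom_comp[OF t e]]) blast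
  obtain v where v: "v \<in> mod_hom R B (J (Suc 0))" "\<And>x. x \<in> carrier A \<Longrightarrow> v (g x) = d 0 (h x)"
    by (rule factor[OF refl mod_hom_comp[OF h(1) d]]) (use h(2) d_e mod_hom_closed[OF t] in auto)
  obtain w where w: "w \<in> mod_hom R B (J 0)" "\<And>x. x \<in> carrier B \<Longrightarrow> v x = d 0 (w x)"
    by (rule ext_zero_SucD[OF z v(1)]) (use v(2) d_d mod_hom_closed[OF h(1)] in \<open>auto simp flip: g_sur\<close>)
  note c = mod_hom_closed[OF h(1)] mod_hom_closed[OF w(1)] mod_hom_closed[OF g] mod_hom_closed[OF d]
  have hw: "(\<lambda>x. h x \<ominus>\<^bsub>J 0\<^esub> w (g x)) \<in> mod_hom R A (J 0)"
    by (rule mod_hom_minus[OF J h(1) mod_hom_comp[OF g w(1)]])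
  obtain t' where t': "t' \<in> mod_hom R A U" "\<And>x. x \<in> carrier A \<Longrightarrow> h x \<ominus>\<^bsub>J 0\<^esub> w (g x) = e (t' x)"
  proof (rule lift_to_U[OF hw _ A])
    fix x assume x: "x \<in> carrier A"
    then show "d 0 (h x \<ominus>\<^bsub>J 0\<^esub> w (g x)) = \<zero>\<^bsub>J (Suc 0)\<^esub>"
      using v(2)[OF x] w(2)[of "g x"] by (simp add: mod_hom_diff[OF J J d] c)
  qed blast
  have "t' x = t x" if "x \<in> ker" for x
  proof (rule inj_onD[OF inj_e])
    have "w (g x) = \<zero>\<^bsub>J 0\<^esub>" "x \<in> carrier A" using that mod_hom_zero[OF B J w(1)] by (auto simp: ker_def)
    then show "e (t' x) = e (t x)" using t'(2)[of x] h(2)[OF that] c(1)[of x] by simp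
    show "t' x \<in> carrier U" using \<open>x \<in> carrier A\<close> mod_hom_closed[OF t'(1)] by simp
    show "t x \<in> carrier U" using that mod_hom_closed[OF t] by simp
  qed
  with t'(1) show ?thesis by (rule that)
qed

end

context inj_res begin

text \<open>A second ring acting on \<open>U\<close> acts on \<open>Hom(A, J)\<close> only up to homotopy, by lifting each of its
  elements separately. That is enough to act on \<open>Ext\<close>. Each lift exists as \<open>J (q + 1)\<close> is injective.\<close>

lemma lift_endomorphism:
  assumes t: "t \<in> mod_hom R U U"
  obtains T where "\<And>q. T q \<in> mod_hom R (J q) (J q)" "\<And>u. u \<in> carrier U \<Longrightarrow> T 0 (e u) = e (t u)"
    "\<And>q x. x \<in> carrier (J q) \<Longrightarrow> d q (T q x) = T (Suc q) (d q x)"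
proof -
  define P where "P q T \<longleftrightarrow> T \<in> mod_hom R (J q) (J q) \<and>
      (\<forall>x\<in>carrier (J q). d q x = \<zero>\<^bsub>J (Suc q)\<^esub> \<longrightarrow> d q (T x) = \<zero>\<^bsub>J (Suc q)\<^esub>) \<and>
      (q = 0 \<longrightarrow> (\<forall>u\<in>carrier U. T (e u) = e (t u)))" for q T
  define Q where "Q q T T' \<longleftrightarrow> (\<forall>x\<in>carrier (J q). d q (T x) = T' (d q x))" for q T T'
  have "\<exists>f. \<forall>n. P n (f n) \<and> Q n (f n) (f (Suc n))"
  proof (rule dependent_nat_choice)
    obtain T where T: "T \<in> mod_hom R (J 0) (J 0)" "\<And>u. u \<in> carrier U \<Longrightarrow> T (e u) = e (t u)"
      by (rule baer_extend_along[OF baer_J U J e mod_hom_comp[OF t e]])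
        (use e_eq_zero mod_hom_zero[OF U J e] mod_hom_zero[OF U U t] in metis)+
    have "d 0 (T x) = \<zero>\<^bsub>J (Suc 0)\<^esub>" if "x \<in> carrier (J 0)" "d 0 x = \<zero>\<^bsub>J (Suc 0)\<^esub>" for x
    proof -
      have "x \<in> e ` carrier U" using that by (simp add: exact_e)
      then obtain u where "u \<in> carrier U" "x = e u" by auto
      then show ?thesis using T(2) d_e mod_hom_closed[OF t] by simp
    qed
    then show "\<exists>T. P 0 T" using T by (auto simp: P_def)
  next
    fix T q assume P: "P q T"
    then have T: "T \<in> mod_hom R (J q) (J q)" by (simp add: P_def)
    obtain T' where T': "T' \<in> mod_hom R (J (Suc q)) (J (Suc q))"
      "\<And>x. x \<in> carrier (J q) \<Longrightarrow> T' (d q x) = d q (T x)"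
      by (rule baer_extend_along[OF baer_J J J d mod_hom_comp[OF T d]]) (use P in \<open>auto simp: P_def\<close>)
    have "d (Suc q) (T' x) = \<zero>\<^bsub>J (Suc (Suc q))\<^esub>" if "x \<in> carrier (J (Suc q))" "d (Suc q) x = \<zero>\<^bsub>J (Suc (Suc q))\<^esub>" for x
      using kernel_d[OF that] T'(2) d_d mod_hom_closed[OF T] by auto
    then show "\<exists>T'. P (Suc q) T' \<and> Q q T T'" using T' by (auto simp: P_def Q_def)
  qed
  then obtain T where "\<And>q. P q (T q)" "\<And>q. Q q (T q) (T (Suc q))" by blast
  then show ?thesis by (intro that[of T]) (auto simp: P_def Q_def)
qed

end

lemma inj_res_of_injective_resolution:
  assumes "left_module R U" "injective_resolution R U J e d" shows "inj_res R U J e d"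
  using assms unfolding injective_resolution_def exact_at_def a_kernel_def' inj_res_def
  by (simp add: injective_module_baer)

text \<open>The kernel of the last map of the resolution is injective by Baer's criterion: extend \<open>h\<close> on an ideal \<open>L\<close> to \<open>R \<rightarrow> J n\<close>; the composite with the last
  map factors through \<open>R / L\<close>, hence lifts to \<open>R / L \<rightarrow> J n\<close>, and subtracting this lift corrects the extension. So the resolution
  can end with this kernel, one step earlier.\<close>

lemma inj_dim_le_truncate:
  fixes R :: "('r, 'c) ring_scheme" and U :: "('r, 'u) module"
    and J :: "nat \<Rightarrow> ('r, ('r, 'u) large) module"
  assumes res: "inj_res R U J e d" and zero: "\<And>i. i > Suc n \<Longrightarrow> zero_module (J i)"
    and ext: "\<And>L. submodule L R (regular_module R) \<Longrightarrow> ext_zero R J d (Suc n) (quotient_module (regular_module R) L)"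
  shows "inj_dim_le R U n"
proof -
  interpret inj_res R U J e d by fact
  interpret Jn: left_module R "J n" by (rule J)
  interpret J1: left_module R "J (Suc n)" by (rule J)
  let ?r = "regular_module R"
  have r: "left_module R ?r" by (rule regular_left_module[OF Jn.ring_R])
  let ?C = "{x \<in> carrier (J n). d n x = \<zero>\<^bsub>J (Suc n)\<^esub>}"
  let ?I = "(J n)\<lparr>carrier := ?C\<rparr>"
  have C: "submodule ?C R (J n)" by (rule kernel_submodule[OF J J d])
  have "baer R ?I"
    unfolding baer_def
  proof (intro conjI allI impI; (elim conjE)?)
    show "left_module R ?I" by (rule Jn.submodule_left_module[OF C])
    fix L h assume L: "submodule L R ?r" and h: "h \<in> mod_hom R (?r\<lparr>carrier := L\<rparr>) ?I"
    have Lsub: "L \<subseteq> carrier R" using L by (simp add: left_module.submodule_iff[OF r])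
    let ?Q = "quotient_module ?r L" and ?p = "\<lambda>x. L +>\<^bsub>?r\<^esub> x"
    note Q = quotient_left_module[OF r L] quotient_hom[OF r L] quotient_surj[OF r L] quotient_ker[OF r L]
    have "h \<in> mod_hom R (?r\<lparr>carrier := L\<rparr>) (J n)" by (rule mod_hom_extend_cod[OF h]) auto
    then obtain y where y: "y \<in> carrier (J n)" "\<And>r. r \<in> L \<Longrightarrow> h r = r \<odot>\<^bsub>J n\<^esub> y"
      using baer_J[of n] L unfolding baer_def by blast
    have y': "(\<lambda>r. r \<odot>\<^bsub>J n\<^esub> y) \<in> mod_hom R ?r (J n)" by (rule smult_hom[OF J y(1)])
    obtain k where k: "k \<in> mod_hom R ?Q (J (Suc n))" "\<And>r. r \<in> carrier ?r \<Longrightarrow> k (?p r) = d n (r \<odot>\<^bsub>J n\<^esub> y)"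
    proof (rule factor_through_surjection[OF r Q(1) J Q(2,3) mod_hom_comp[OF y' d]])
      fix x assume "x \<in> carrier ?r" "?p x = \<zero>\<^bsub>?Q\<^esub>"
      then have "x \<in> L" using Q(4) by blast
      then show "d n (x \<odot>\<^bsub>J n\<^esub> y) = \<zero>\<^bsub>J (Suc n)\<^esub>" using y(2) mod_hom_closed[OF h] by auto
    qed blast
    obtain w where w: "w \<in> mod_hom R ?Q (J n)" "\<And>x. x \<in> carrier ?Q \<Longrightarrow> k x = d n (w x)"
    proof (rule ext_zero_SucD[OF ext[OF L] k(1)])
      fix x assume "x \<in> carrier ?Q"
      then show "d (Suc n) (k x) = \<zero>\<^bsub>J (Suc (Suc n))\<^esub>"
        using k(2) d_d mod_hom_closed[OF y'] by (auto simp flip: Q(3))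
    qed blast
    let ?u = "w (?p \<one>\<^bsub>R\<^esub>)"
    have p1: "?p \<one>\<^bsub>R\<^esub> \<in> carrier ?Q" using mod_hom_closed[OF Q(2), of "\<one>\<^bsub>R\<^esub>"] Jn.R.one_closed by simp
    have u: "?u \<in> carrier (J n)" using mod_hom_closed[OF w(1) p1] .
    have "d n (y \<ominus>\<^bsub>J n\<^esub> ?u) = \<zero>\<^bsub>J (Suc n)\<^esub>"
      using k(2)[of "\<one>\<^bsub>R\<^esub>"] w(2)[OF p1] y(1) u
      by (simp add: mod_hom_diff[OF J J d] mod_hom_closed[OF d])
    then have c: "y \<ominus>\<^bsub>J n\<^esub> ?u \<in> carrier ?I" using y(1) u by simp
    have "h r = r \<odot>\<^bsub>J n\<^esub> (y \<ominus>\<^bsub>J n\<^esub> ?u)" if "r \<in> L" for r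
    proof -
      have rR: "r \<in> carrier R" using that Lsub by auto
      have "?p r = r \<odot>\<^bsub>?Q\<^esub> ?p \<one>\<^bsub>R\<^esub>"
        using mod_hom_smult[OF Q(2) rR, of "\<one>\<^bsub>R\<^esub>"] rR by simp
      then have "r \<odot>\<^bsub>J n\<^esub> ?u = w (?p r)" using mod_hom_smult[OF w(1) rR p1] by simp
      also have "\<dots> = \<zero>\<^bsub>J n\<^esub>" using Q(4)[of r] rR that mod_hom_zero[OF Q(1) J w(1)] by simp
      finally show ?thesis using y u rR that by (simp add: Jn.smult_diff)
    qed
    then show "\<exists>z\<in>carrier ?I. \<forall>r\<in>L. h r = r \<odot>\<^bsub>?I\<^esub> z" using c by auto
  qed
  then have C_inj: "injective_module R ?I" by (rule baer_injective_module)
  \<comment> \<open>Beyond \<open>n\<close> the shift by one makes the terms zero modules, so that all maps into them can be zero.\<close>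
  define J' where "J' i = (if i < n then J i else if i = n then ?I else J (Suc i))" for i
  define d' where "d' i = (if i < n then d i else (\<lambda>_. \<zero>\<^bsub>J' (Suc i)\<^esub>))" for i
  have J'_inj: "injective_module R (J' i)" for i
    using C_inj baer_injective_module[OF baer_J] by (simp add: J'_def)
  have J'_le: "carrier (J' i) = (if i = n then ?C else carrier (J i))" "zero (J' i) = zero (J i)" if "i \<le> n" for i
    using that by (auto simp: J'_def)
  have J'_zero: "carrier (J' i) = {\<zero>\<^bsub>J' i\<^esub>}" if "i > n" for i
    using that zero[of "Suc i"] by (auto simp: J'_def zero_module_def)
  have J': "left_module R (J' i)" for i using J'_inj by (simp add: injective_module_def)
  have "injective_resolution R U J' e d'"
    unfolding injective_resolution_def exact_at_def a_kernel_def'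
  proof (intro conjI allI)
    show "injective_module R (J' i)" for i by (rule J'_inj)
    show "e \<in> mod_hom R U (J' 0)"
      using e d_e mod_hom_closed[OF e] by (auto simp: J'_def intro!: mod_hom_restrict_cod)
    show "inj_on e (carrier U)" by (rule inj_e)
    show "d' i \<in> mod_hom R (J' i) (J' (Suc i))" for i
    proof (cases "i < n")
      case True
      have "d i \<in> mod_hom R (J i) (J' (Suc i))"
      proof (cases "Suc i = n")
        case True
        then show ?thesis using d[of i] mod_hom_closed[OF d[of i]] d_d[of _ i]
          by (auto simp: J'_def intro!: mod_hom_restrict_cod)
      qed (use True d[of i] in \<open>simp add: J'_def\<close>)
      then show ?thesis using True by (simp add: d'_def J'_def)
    qed (simp add: d'_def mod_hom_const_zero[OF J'])
    show "e ` carrier U = {x \<in> carrier (J' 0). d' 0 x = \<zero>\<^bsub>J' 1\<^esub>}"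
      using exact_e J'_le(2)[of 1] by (cases "n = 0") (auto simp: d'_def J'_def)
    show "d' i ` carrier (J' i) = {x \<in> carrier (J' (Suc i)). d' (Suc i) x = \<zero>\<^bsub>J' (Suc (Suc i))\<^esub>}" for i
    proof -
      consider "Suc i < n" | "Suc i = n" | "i \<ge> n" by linarith
      then show ?thesis
      proof cases
        case 1
        then show ?thesis using exact_d[of i] J'_le(2)[of "Suc (Suc i)"] by (simp add: d'_def J'_le)
      next
        case 2
        then show ?thesis using exact_d[of i] J'_le by (auto simp: d'_def)
      next
        case 3
        have "carrier (J' i) \<noteq> {}" using abelian_monoid.zero_closed[OF abelian_group.axioms(1)[OF left_module.group_M[OF J'[of i]]]] by blast
        then show ?thesis using 3 J'_zero[of "Suc i"] by (auto simp: d'_def)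
      qed
    qed
  qed
  moreover have "zero_module (J' i)" if "i > n" for i using J'_zero[OF that] by (simp add: zero_module_def)
  ultimately show ?thesis unfolding inj_dim_le_def by blast
qed

section \<open>Balancing free and injective resolutions\<close>

text \<open>\<open>Ext\<close> can be computed from a free resolution \<open>F\<close> of \<open>A\<close> or from an injective resolution \<open>J\<close> of \<open>U\<close>. In the double complex
  \<open>Hom(F k, J q)\<close> all rows and columns are exact except at the edges, and a cocycle moves along the antidiagonal
  from one edge to the other, one step at a time.\<close>

locale balanced_resolutions = inj_res R U J e d
  for R :: "('r, 'c) ring_scheme" and U :: "('r, 'u) module" and J :: "nat \<Rightarrow> ('r, 'i) module" and e d +
  fixes A :: "('r, 'a) module" and X :: "nat \<Rightarrow> 'x set" and D and p
  assumes A: "left_module R A" and res: "free_resolution R A X D p"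
begin

abbreviation F where "F k \<equiv> free_module R (X k)"

lemma ring_R: "ring R"
  using left_module.ring_R[OF A] .

lemma F: "left_module R (F k)" by (rule free_left_module[OF ring_R])

lemmas p = resolutionD(1)[OF res] and p_sur = resolutionD(2)[OF res] and D = resolutionD(3)[OF res]

lemma p_D: "y \<in> carrier (F (Suc 0)) \<Longrightarrow> p (D 0 y) = \<zero>\<^bsub>A\<^esub>"
  using resolutionD(4)[OF res] by auto

lemma D_D: "y \<in> carrier (F (Suc (Suc k))) \<Longrightarrow> D k (D (Suc k) y) = \<zero>\<^bsub>F k\<^esub>"
  using resolutionD(5)[OF res, of k] by auto

lemma kernel_p: 
  assumes "y \<in> carrier (F 0)" "p y = \<zero>\<^bsub>A\<^esub>" obtains z where "z \<in> carrier (F (Suc 0))" "y = D 0 z"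
proof -
  have "y \<in> D 0 ` carrier (F (Suc 0))" using assms unfolding resolutionD(4)[OF res] by simp
  then show ?thesis using that by auto
qed

lemma kernel_D:
  assumes "y \<in> carrier (F (Suc k))" "D k y = \<zero>\<^bsub>F k\<^esub>" obtains z where "z \<in> carrier (F (Suc (Suc k)))" "y = D (Suc k) z"
proof -
  have "y \<in> D (Suc k) ` carrier (F (Suc (Suc k)))" using assms unfolding resolutionD(5)[OF res] by simp
  then show ?thesis using that by auto
qed

text \<open>An element of \<open>Hom(F k, J q)\<close> killed by both differentials can be trivial in two ways: as the image of an element
  under one differential that the other one kills. In \<open>hor_trivial k q\<close> the element has horizontal degree \<open>k + 1\<close>, in
  \<open>ver_trivial k q\<close> vertical degree \<open>q + 1\<close>; the two notions agree away from the edges (\<open>hor_iff_ver_trivial\<close>).\<close>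

definition bicocycle :: "nat \<Rightarrow> nat \<Rightarrow> (('x \<Rightarrow> 'r) \<Rightarrow> 'i) \<Rightarrow> bool" where
  "bicocycle k q f \<longleftrightarrow> f \<in> mod_hom R (F k) (J q) \<and> (\<forall>y\<in>carrier (F k). d q (f y) = \<zero>\<^bsub>J (Suc q)\<^esub>) \<and>
     (\<forall>y\<in>carrier (F (Suc k)). f (D k y) = \<zero>\<^bsub>J q\<^esub>)"

definition hor_trivial :: "nat \<Rightarrow> nat \<Rightarrow> (('x \<Rightarrow> 'r) \<Rightarrow> 'i) \<Rightarrow> bool" where
  "hor_trivial k q f \<longleftrightarrow> (\<exists>g\<in>mod_hom R (F k) (J q). (\<forall>y\<in>carrier (F k). d q (g y) = \<zero>\<^bsub>J (Suc q)\<^esub>) \<and>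
     (\<forall>y\<in>carrier (F (Suc k)). f y = g (D k y)))"

definition ver_trivial :: "nat \<Rightarrow> nat \<Rightarrow> (('x \<Rightarrow> 'r) \<Rightarrow> 'i) \<Rightarrow> bool" where
  "ver_trivial k q f \<longleftrightarrow> (\<exists>g\<in>mod_hom R (F k) (J q). (\<forall>y\<in>carrier (F (Suc k)). g (D k y) = \<zero>\<^bsub>J q\<^esub>) \<and>
     (\<forall>y\<in>carrier (F k). f y = d q (g y)))"

text \<open>One step along the antidiagonal, from \<open>(k + 1, q)\<close> to \<open>(k, q + 1)\<close>: both elements come from the same \<open>h\<close>. It is always possible
  in either direction, and respects triviality.\<close>

definition linked :: "nat \<Rightarrow> nat \<Rightarrow> (('x \<Rightarrow> 'r) \<Rightarrow> 'i) \<Rightarrow> (('x \<Rightarrow> 'r) \<Rightarrow> 'i) \<Rightarrow> bool" where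
  "linked k q f f' \<longleftrightarrow> bicocycle (Suc k) q f \<and> bicocycle k (Suc q) f' \<and>
     (\<exists>h\<in>mod_hom R (F k) (J q). (\<forall>y\<in>carrier (F (Suc k)). f y = h (D k y)) \<and>
        (\<forall>y\<in>carrier (F k). f' y = d q (h y)))"

lemma extend_along_D:
  assumes "f \<in> mod_hom R (F (Suc k)) (J q)" "\<And>y. y \<in> carrier (F (Suc (Suc k))) \<Longrightarrow> f (D (Suc k) y) = \<zero>\<^bsub>J q\<^esub>"
  obtains h where "h \<in> mod_hom R (F k) (J q)" "\<And>y. y \<in> carrier (F (Suc k)) \<Longrightarrow> f y = h (D k y)"
proof -
  obtain h where "h \<in> mod_hom R (F k) (J q)" "\<And>y. y \<in> carrier (F (Suc k)) \<Longrightarrow> h (D k y) = f y"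
  proof (rule baer_extend_along[OF baer_J F F D assms(1)])
    fix x assume "x \<in> carrier (F (Suc k))" "D k x = \<zero>\<^bsub>F k\<^esub>"
    then obtain z where "z \<in> carrier (F (Suc (Suc k)))" "x = D (Suc k) z" by (rule kernel_D)
    then show "f x = \<zero>\<^bsub>J q\<^esub>" using assms(2) by simp
  qed blast
  then show ?thesis using that by metis
qed

lemma lift_along_d:
  assumes "f \<in> mod_hom R (F k) (J (Suc q))" "\<And>y. y \<in> carrier (F k) \<Longrightarrow> d (Suc q) (f y) = \<zero>\<^bsub>J (Suc (Suc q))\<^esub>"
  obtains h where "h \<in> mod_hom R (F k) (J q)" "\<And>y. y \<in> carrier (F k) \<Longrightarrow> f y = d q (h y)"
proof -
  have "f (unit_vec R x) \<in> d q ` carrier (J q)" if "x \<in> X k" for x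
    using assms unit_vec_closed[OF ring_R that] mod_hom_closed[OF assms(1)] unfolding exact_d by auto
  then obtain h where "h \<in> mod_hom R (F k) (J q)" "\<And>y. y \<in> carrier (F k) \<Longrightarrow> d q (h y) = f y"
    using free_lift[OF J J assms(1) d] by metis
  then show ?thesis using that by metis
qed

lemma linked_right:
  assumes "bicocycle (Suc k) q f" obtains f' where "linked k q f f'"
proof -
  have f: "f \<in> mod_hom R (F (Suc k)) (J q)" using assms by (simp add: bicocycle_def)
  obtain h where h: "h \<in> mod_hom R (F k) (J q)" "\<And>y. y \<in> carrier (F (Suc k)) \<Longrightarrow> f y = h (D k y)"
    by (rule extend_along_D[OF f]) (use assms in \<open>auto simp: bicocycle_def\<close>)
  have "bicocycle k (Suc q) (\<lambda>y. d q (h y))"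
    using assms mod_hom_comp[OF h(1) d] d_d mod_hom_closed[OF h(1)] h(2)[symmetric]
    by (auto simp: bicocycle_def)
  then have "linked k q f (\<lambda>y. d q (h y))" using assms h by (auto simp: linked_def)
  then show ?thesis by (rule that)
qed

lemma linked_left:
  assumes "bicocycle k (Suc q) f'" obtains f where "linked k q f f'"
proof -
  have f': "f' \<in> mod_hom R (F k) (J (Suc q))" using assms by (simp add: bicocycle_def)
  obtain h where h: "h \<in> mod_hom R (F k) (J q)" "\<And>y. y \<in> carrier (F k) \<Longrightarrow> f' y = d q (h y)"
    by (rule lift_along_d[OF f']) (use assms in \<open>auto simp: bicocycle_def\<close>)
  have "bicocycle (Suc k) q (\<lambda>y. h (D k y))"
    using assms mod_hom_comp[OF D h(1)] mod_hom_closed[OF D] h(2)[symmetric] mod_hom_zero[OF F J h(1)]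
    by (auto simp: bicocycle_def D_D)
  then have "linked k q (\<lambda>y. h (D k y)) f'" using assms h by (auto simp: linked_def)
  then show ?thesis by (rule that)
qed

lemma linked_trivial:
  assumes "linked k q f f'" shows "hor_trivial k q f \<longleftrightarrow> ver_trivial k q f'"
proof -
  interpret Jq: left_module R "J q" by (rule J)
  interpret Jq1: left_module R "J (Suc q)" by (rule J)
  obtain h where h: "h \<in> mod_hom R (F k) (J q)" "\<And>y. y \<in> carrier (F (Suc k)) \<Longrightarrow> f y = h (D k y)"
    "\<And>y. y \<in> carrier (F k) \<Longrightarrow> f' y = d q (h y)"
    using assms by (auto simp: linked_def)
  note hc = mod_hom_closed[OF h(1)] and Dc = mod_hom_closed[OF D] and dc = mod_hom_closed[OF d]
  show ?thesis
  proof
    assume "hor_trivial k q f"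
    then obtain g where g: "g \<in> mod_hom R (F k) (J q)" "\<And>y. y \<in> carrier (F k) \<Longrightarrow> d q (g y) = \<zero>\<^bsub>J (Suc q)\<^esub>"
      "\<And>y. y \<in> carrier (F (Suc k)) \<Longrightarrow> f y = g (D k y)" by (auto simp: hor_trivial_def)
    note gc = mod_hom_closed[OF g(1)]
    have "h (D k y) \<ominus>\<^bsub>J q\<^esub> g (D k y) = \<zero>\<^bsub>J q\<^esub>" if "y \<in> carrier (F (Suc k))" for y
      using h(2) g(3) that hc Dc gc by simp
    moreover have "f' y = d q (h y \<ominus>\<^bsub>J q\<^esub> g y)" if "y \<in> carrier (F k)" for y
      using that by (simp add: mod_hom_diff[OF J J d] hc gc g(2) h(3) dc)
    ultimately show "ver_trivial k q f'"
      unfolding ver_trivial_def using mod_hom_minus[OF J h(1) g(1)] by (intro bexI) auto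
  next
    assume "ver_trivial k q f'"
    then obtain g where g: "g \<in> mod_hom R (F k) (J q)" "\<And>y. y \<in> carrier (F (Suc k)) \<Longrightarrow> g (D k y) = \<zero>\<^bsub>J q\<^esub>"
      "\<And>y. y \<in> carrier (F k) \<Longrightarrow> f' y = d q (g y)" by (auto simp: ver_trivial_def)
    note gc = mod_hom_closed[OF g(1)]
    have "d q (h y \<ominus>\<^bsub>J q\<^esub> g y) = \<zero>\<^bsub>J (Suc q)\<^esub>" if "y \<in> carrier (F k)" for y
      using that h(3)[OF that] g(3)[OF that] by (simp add: mod_hom_diff[OF J J d] hc gc dc)
    moreover have "f y = h (D k y) \<ominus>\<^bsub>J q\<^esub> g (D k y)" if "y \<in> carrier (F (Suc k))" for y
      using that by (simp add: h(2) g(2) hc Dc)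
    ultimately show "hor_trivial k q f"
      unfolding hor_trivial_def using mod_hom_minus[OF J h(1) g(1)] by (intro bexI) auto
  qed
qed

lemma hor_iff_ver_trivial: "hor_trivial k (Suc q) f \<longleftrightarrow> ver_trivial (Suc k) q f"
proof
  assume "hor_trivial k (Suc q) f"
  then obtain g where g: "g \<in> mod_hom R (F k) (J (Suc q))"
    "\<And>y. y \<in> carrier (F k) \<Longrightarrow> d (Suc q) (g y) = \<zero>\<^bsub>J (Suc (Suc q))\<^esub>"
    "\<And>y. y \<in> carrier (F (Suc k)) \<Longrightarrow> f y = g (D k y)" by (auto simp: hor_trivial_def)
  obtain h where h: "h \<in> mod_hom R (F k) (J q)" "\<And>y. y \<in> carrier (F k) \<Longrightarrow> g y = d q (h y)"
    by (rule lift_along_d[OF g(1,2)]; blast)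
  show "ver_trivial (Suc k) q f" unfolding ver_trivial_def
    using mod_hom_comp[OF D h(1)] g(3) h(2) mod_hom_closed[OF D] mod_hom_zero[OF F J h(1)]
    by (intro bexI[of _ "\<lambda>y. h (D k y)"]) (auto simp: D_D)
next
  assume "ver_trivial (Suc k) q f"
  then obtain g where g: "g \<in> mod_hom R (F (Suc k)) (J q)"
    "\<And>y. y \<in> carrier (F (Suc (Suc k))) \<Longrightarrow> g (D (Suc k) y) = \<zero>\<^bsub>J q\<^esub>"
    "\<And>y. y \<in> carrier (F (Suc k)) \<Longrightarrow> f y = d q (g y)" by (auto simp: ver_trivial_def)
  obtain h where h: "h \<in> mod_hom R (F k) (J q)" "\<And>y. y \<in> carrier (F (Suc k)) \<Longrightarrow> g y = h (D k y)"
    by (rule extend_along_D[OF g(1,2)]; blast)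
  show "hor_trivial k (Suc q) f" unfolding hor_trivial_def
    using mod_hom_comp[OF h(1) d] g(3) h(2) mod_hom_closed[OF h(1)]
    by (intro bexI[of _ "\<lambda>y. d q (h y)"]) (auto simp: d_d)
qed

fun descends :: "nat \<Rightarrow> nat \<Rightarrow> (('x \<Rightarrow> 'r) \<Rightarrow> 'i) \<Rightarrow> (('x \<Rightarrow> 'r) \<Rightarrow> 'i) \<Rightarrow> bool" where
  "descends 0 q f g \<longleftrightarrow> f = g \<and> bicocycle 0 q f"
| "descends (Suc k) q f g \<longleftrightarrow> (\<exists>f'. linked k q f f' \<and> descends k (Suc q) f' g)"

lemma descends_right: "bicocycle k q f \<Longrightarrow> \<exists>g. descends k q f g"
proof (induct k arbitrary: q f)
  case (Suc k)
  then show ?case by (meson linked_right linked_def descends.simps(2))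
qed auto

lemma descends_left: "bicocycle 0 (k + q) g \<Longrightarrow> \<exists>f. descends k q f g \<and> bicocycle k q f"
proof (induct k arbitrary: q)
  case (Suc k)
  obtain f' where "descends k (Suc q) f' g" "bicocycle k (Suc q) f'"
    using Suc(1)[of "Suc q"] Suc(2) by (metis add_Suc_shift)
  then show ?case by (meson linked_left linked_def descends.simps(2))
qed simp

lemma descends_end: "descends k q f g \<Longrightarrow> bicocycle 0 (k + q) g"
  by (induct k arbitrary: q f) fastforce+

lemma descends_trivial: "descends (Suc k) q f g \<Longrightarrow> hor_trivial k q f \<longleftrightarrow> ver_trivial 0 (k + q) g"
proof (induct k arbitrary: q f)
  case 0
  then show ?case using linked_trivial by auto
next
  case (Suc k)
  then obtain f' where "linked (Suc k) q f f'" "descends (Suc k) (Suc q) f' g" by (meson descends.simps(2))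
  then show ?case using Suc(1)[of "Suc q" f'] linked_trivial hor_iff_ver_trivial by auto
qed

text \<open>The cocycle \<open>f\<close> on the free resolution and the cocycle \<open>g\<close> on the injective one
  represent the same class of \<open>Ext i\<close>.\<close>

definition corresponds :: "nat \<Rightarrow> (('x \<Rightarrow> 'r) \<Rightarrow> 'u) \<Rightarrow> ('a \<Rightarrow> 'i) \<Rightarrow> bool" where
  "corresponds i f g \<longleftrightarrow> is_cocycle R X D U i f \<and> g \<in> mod_hom R A (J i) \<and>
     (\<exists>f' g'. descends i 0 f' g' \<and> (\<forall>y\<in>carrier (F i). f' y = e (f y)) \<and> (\<forall>y\<in>carrier (F 0). g' y = g (p y)))"

lemma is_cocycle_bicocycle: "is_cocycle R X D U i f \<Longrightarrow> bicocycle i 0 (\<lambda>y. e (f y))"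
  using mod_hom_comp[OF _ e] d_e mod_hom_zero[OF U J e]
  by (auto simp: is_cocycle_def bicocycle_def mod_hom_closed)

lemma corresponds_right:
  assumes "is_cocycle R X D U i f" obtains g where "corresponds i f g"
proof -
  obtain g' where g': "descends i 0 (\<lambda>y. e (f y)) g'"
    using descends_right[OF is_cocycle_bicocycle[OF assms]] by blast
  then have b: "bicocycle 0 i g'" using descends_end by fastforce
  then have "g' \<in> mod_hom R (F 0) (J i)" by (simp add: bicocycle_def)
  then obtain g where g: "g \<in> mod_hom R A (J i)" "\<And>y. y \<in> carrier (F 0) \<Longrightarrow> g (p y) = g' y"
  proof (rule factor_through_surjection[OF F A J p p_sur])
    fix x assume "x \<in> carrier (F 0)" "p x = \<zero>\<^bsub>A\<^esub>"
    then obtain z where "z \<in> carrier (F (Suc 0))" "x = D 0 z" by (rule kernel_p)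
    then show "g' x = \<zero>\<^bsub>J i\<^esub>" using b by (simp add: bicocycle_def)
  qed blast
  then have "corresponds i f g" unfolding corresponds_def using assms g' by fastforce
  then show ?thesis by (rule that)
qed

lemma corresponds_left:
  assumes g: "g \<in> mod_hom R A (J i)" "\<And>x. x \<in> carrier A \<Longrightarrow> d i (g x) = \<zero>\<^bsub>J (Suc i)\<^esub>"
  obtains f where "corresponds i f g"
proof -
  have "bicocycle 0 i (\<lambda>y. g (p y))"
    using mod_hom_comp[OF p g(1)] g(2) mod_hom_closed[OF p] mod_hom_zero[OF A J g(1)]
    by (auto simp: bicocycle_def p_D)
  then obtain f' where f': "descends i 0 f' (\<lambda>y. g (p y))" "bicocycle i 0 f'"
    using descends_left[of i 0] by auto
  obtain f where f: "f \<in> mod_hom R (F i) U" "\<And>y. y \<in> carrier (F i) \<Longrightarrow> f' y = e (f y)"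
    by (rule lift_to_U[of f' "F i"]) (use f'(2) F in \<open>auto simp: bicocycle_def\<close>)
  have "f (D i y) = \<zero>\<^bsub>U\<^esub>" if "y \<in> carrier (F (Suc i))" for y
    using f'(2) f that mod_hom_closed[OF D that] by (intro e_eq_zero) (auto simp: bicocycle_def mod_hom_closed)
  then have "corresponds i f g" unfolding corresponds_def is_cocycle_def using f f'(1) g(1) by blast
  then show ?thesis by (rule that)
qed

lemma corresponds_cocycle: 
  assumes "corresponds i f g" 
  shows "is_cocycle R X D U i f" and "g \<in> mod_hom R A (J i)"
    and "x \<in> carrier A \<Longrightarrow> d i (g x) = \<zero>\<^bsub>J (Suc i)\<^esub>"
proof -
  show "is_cocycle R X D U i f" "g \<in> mod_hom R A (J i)" using assms by (auto simp: corresponds_def)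
  obtain f' g' where "descends i 0 f' g'" "\<forall>y\<in>carrier (F 0). g' y = g (p y)"
    using assms by (auto simp: corresponds_def)
  then show "x \<in> carrier A \<Longrightarrow> d i (g x) = \<zero>\<^bsub>J (Suc i)\<^esub>"
    using descends_end[of i 0 f' g'] by (auto simp: bicocycle_def simp flip: p_sur)
qed

lemma corresponds_coboundary:
  assumes "corresponds i f g"
  shows "is_coboundary R X D U i f \<longleftrightarrow>
    (case i of 0 \<Rightarrow> \<forall>x\<in>carrier A. g x = \<zero>\<^bsub>J 0\<^esub>
      | Suc j \<Rightarrow> \<exists>h\<in>mod_hom R A (J j). \<forall>x\<in>carrier A. g x = d j (h x))"
proof -
  obtain f' g' where des: "descends i 0 f' g'" and f': "\<And>y. y \<in> carrier (F i) \<Longrightarrow> f' y = e (f y)"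
    and g': "\<And>y. y \<in> carrier (F 0) \<Longrightarrow> g' y = g (p y)"
    using assms by (auto simp: corresponds_def)
  have f: "f \<in> mod_hom R (F i) U" using assms by (simp add: corresponds_def is_cocycle_def)
  show ?thesis
  proof (cases i)
    case 0
    then have "f' = g'" using des by simp
    then have "e (f y) = g (p y)" if "y \<in> carrier (F 0)" for y using f'[of y] g'[of y] that 0 by simp
    then show ?thesis
      using e_eq_zero mod_hom_closed[OF f] mod_hom_zero[OF U J e] 0
      by (fastforce simp: is_coboundary_def simp flip: p_sur)
  next
    case (Suc j)
    have "is_coboundary R X D U i f \<longleftrightarrow> hor_trivial j 0 f'"
    proof
      assume "is_coboundary R X D U i f"
      then obtain h where "h \<in> mod_hom R (F j) U" "\<And>y. y \<in> carrier (F (Suc j)) \<Longrightarrow> f y = h (D j y)"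
        by (auto simp: is_coboundary_def Suc)
      then show "hor_trivial j 0 f'"
        unfolding hor_trivial_def using mod_hom_comp[OF _ e] f' d_e mod_hom_closed
        by (intro bexI[of _ "\<lambda>y. e (h y)"]) (fastforce simp: Suc)+
    next
      assume "hor_trivial j 0 f'"
      then obtain h where h: "h \<in> mod_hom R (F j) (J 0)" "\<And>y. y \<in> carrier (F j) \<Longrightarrow> d 0 (h y) = \<zero>\<^bsub>J (Suc 0)\<^esub>"
        "\<And>y. y \<in> carrier (F (Suc j)) \<Longrightarrow> f' y = h (D j y)" by (auto simp: hor_trivial_def)
      obtain k where k: "k \<in> mod_hom R (F j) U" "\<And>y. y \<in> carrier (F j) \<Longrightarrow> h y = e (k y)"
        by (rule lift_to_U[OF h(1,2) F]; blast)
      have "f y = k (D j y)" if y: "y \<in> carrier (F (Suc j))" for y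
        by (rule inj_onD[OF inj_e])
          (use y f'[of y] h(3)[OF y] k(2)[OF mod_hom_closed[OF D y]] mod_hom_closed[OF f, of y]
            mod_hom_closed[OF k(1) mod_hom_closed[OF D y]] Suc in simp_all)
      then show "is_coboundary R X D U i f" using k(1) by (auto simp: is_coboundary_def Suc)
    qed
    also have "\<dots> \<longleftrightarrow> ver_trivial 0 j g'"
      using descends_trivial[of j 0 f' g'] des Suc by simp
    also have "\<dots> \<longleftrightarrow> (\<exists>h\<in>mod_hom R A (J j). \<forall>x\<in>carrier A. g x = d j (h x))"
    proof
      assume "ver_trivial 0 j g'"
      then obtain h where h: "h \<in> mod_hom R (F 0) (J j)" "\<And>y. y \<in> carrier (F (Suc 0)) \<Longrightarrow> h (D 0 y) = \<zero>\<^bsub>J j\<^esub>"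
        "\<And>y. y \<in> carrier (F 0) \<Longrightarrow> g' y = d j (h y)" by (auto simp: ver_trivial_def)
      obtain k where k: "k \<in> mod_hom R A (J j)" "\<And>y. y \<in> carrier (F 0) \<Longrightarrow> k (p y) = h y"
      proof (rule factor_through_surjection[OF F A J p p_sur h(1)])
        fix x assume "x \<in> carrier (F 0)" "p x = \<zero>\<^bsub>A\<^esub>"
        then obtain z where "z \<in> carrier (F (Suc 0))" "x = D 0 z" by (rule kernel_p)
        then show "h x = \<zero>\<^bsub>J j\<^esub>" using h(2) by simp
      qed blast
      then show "\<exists>h\<in>mod_hom R A (J j). \<forall>x\<in>carrier A. g x = d j (h x)"
        using g' h(3) by (intro bexI[of _ k]) (auto simp flip: p_sur)
    next
      assume "\<exists>h\<in>mod_hom R A (J j). \<forall>x\<in>carrier A. g x = d j (h x)"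
      then obtain h where h: "h \<in> mod_hom R A (J j)" "\<And>x. x \<in> carrier A \<Longrightarrow> g x = d j (h x)" by blast
      show "ver_trivial 0 j g'" unfolding ver_trivial_def
        using mod_hom_comp[OF p h(1)] g' h(2) mod_hom_closed[OF p] mod_hom_zero[OF A J h(1)]
        by (intro bexI[of _ "\<lambda>y. h (p y)"]) (auto simp: p_D)
    qed
    finally show ?thesis by (simp add: Suc)
  qed
qed

lemma ext_zero_iff:
  "ext_zero R J d i A \<longleftrightarrow> (\<forall>f. is_cocycle R X D U i f \<longrightarrow> is_coboundary R X D U i f)"
proof
  assume z: "ext_zero R J d i A"
  show "\<forall>f. is_cocycle R X D U i f \<longrightarrow> is_coboundary R X D U i f"
  proof (intro allI impI)
    fix f assume "is_cocycle R X D U i f"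
    then obtain g where g: "corresponds i f g" by (rule corresponds_right)
    then show "is_coboundary R X D U i f"
      using z corresponds_cocycle[OF g] unfolding corresponds_coboundary[OF g] ext_zero_def by blast
  qed
next
  assume z: "\<forall>f. is_cocycle R X D U i f \<longrightarrow> is_coboundary R X D U i f"
  show "ext_zero R J d i A"
    unfolding ext_zero_def
  proof (intro ballI impI)
    fix g assume "g \<in> mod_hom R A (J i)" "\<forall>x\<in>carrier A. d i (g x) = \<zero>\<^bsub>J (Suc i)\<^esub>"
    then obtain f where f: "corresponds i f g" using corresponds_left[of g i] by blast
    then show "case i of 0 \<Rightarrow> \<forall>x\<in>carrier A. g x = \<zero>\<^bsub>J 0\<^esub>
      | Suc j \<Rightarrow> \<exists>h\<in>mod_hom R A (J j). \<forall>x\<in>carrier A. g x = d j (h x)"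
      using z corresponds_cocycle(1)[OF f] corresponds_coboundary[OF f] by blast
  qed
qed

context
  fixes t T
  assumes t: "t \<in> mod_hom R U U" and T: "\<And>q. T q \<in> mod_hom R (J q) (J q)"
    and T_e: "\<And>u. u \<in> carrier U \<Longrightarrow> T 0 (e u) = e (t u)"
    and T_d: "\<And>q x. x \<in> carrier (J q) \<Longrightarrow> d q (T q x) = T (Suc q) (d q x)"
begin

lemma bicocycle_endo: "bicocycle k q f \<Longrightarrow> bicocycle k q (\<lambda>y. T q (f y))"
  using mod_hom_comp[OF _ T] mod_hom_zero[OF J J T] T_d mod_hom_closed
  by (fastforce simp: bicocycle_def)

lemma linked_endo:
  assumes "linked k q f f'" shows "linked k q (\<lambda>y. T q (f y)) (\<lambda>y. T (Suc q) (f' y))"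
proof -
  obtain h where h: "h \<in> mod_hom R (F k) (J q)" "\<And>y. y \<in> carrier (F (Suc k)) \<Longrightarrow> f y = h (D k y)"
    "\<And>y. y \<in> carrier (F k) \<Longrightarrow> f' y = d q (h y)"
    using assms by (auto simp: linked_def)
  show ?thesis
    using assms bicocycle_endo mod_hom_comp[OF h(1) T] h(2,3) T_d mod_hom_closed[OF h(1)]
    unfolding linked_def by (intro conjI bexI[of _ "\<lambda>y. T q (h y)"]) auto
qed

lemma descends_endo: "descends k q f g \<Longrightarrow> descends k q (\<lambda>y. T q (f y)) (\<lambda>y. T (k + q) (g y))"
proof (induct k arbitrary: q f)
  case (Suc k)
  then obtain f' where "linked k q f f'" "descends k (Suc q) f' g" by auto
  then show ?case using linked_endo[of k q f f'] Suc(1)[of "Suc q" f'] by auto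
qed (auto intro: bicocycle_endo)

lemma corresponds_endo:
  assumes "corresponds i f g" shows "corresponds i (\<lambda>y. t (f y)) (\<lambda>x. T i (g x))"
proof -
  obtain f' g' where des: "descends i 0 f' g'" and f': "\<And>y. y \<in> carrier (F i) \<Longrightarrow> f' y = e (f y)"
    and g': "\<And>y. y \<in> carrier (F 0) \<Longrightarrow> g' y = g (p y)"
    using assms by (auto simp: corresponds_def)
  have f: "is_cocycle R X D U i f" and g: "g \<in> mod_hom R A (J i)"
    using assms by (auto simp: corresponds_def)
  have "is_cocycle R X D U i (\<lambda>y. t (f y))"
    using f mod_hom_comp[OF _ t] mod_hom_zero[OF U U t] by (auto simp: is_cocycle_def)
  moreover have "descends i 0 (\<lambda>y. T 0 (f' y)) (\<lambda>y. T i (g' y))" using descends_endo[OF des] by simp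
  moreover have "T 0 (f' y) = e (t (f y))" if "y \<in> carrier (F i)" for y
    using f'[OF that] f that T_e by (auto simp: is_cocycle_def mod_hom_closed)
  ultimately show ?thesis
    unfolding corresponds_def using mod_hom_comp[OF g T] g'
    by (intro conjI exI[of _ "\<lambda>y. T 0 (f' y)"] exI[of _ "\<lambda>y. T i (g' y)"]) auto
qed

end

end

section \<open>Duality with respect to a bimodule\<close>

text \<open>\<open>Hom_R(A, U)\<close> as an \<open>S\<close>-module, where \<open>V\<close> is \<open>U\<close> with the action of \<open>S\<close>.\<close>

definition dual_module :: "('r, 'c) ring_scheme \<Rightarrow> ('r, 'a) module \<Rightarrow> ('r, 'u) module \<Rightarrow> ('s, 'u) module
    \<Rightarrow> ('s, 'a \<Rightarrow> 'u) module" where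
  "dual_module R A U V = \<lparr>carrier = mod_hom R A U \<inter> extensional (carrier A), mult = undefined,
     one = undefined, zero = (\<lambda>x\<in>carrier A. \<zero>\<^bsub>U\<^esub>), add = (\<lambda>f g. \<lambda>x\<in>carrier A. f x \<oplus>\<^bsub>U\<^esub> g x),
     smult = (\<lambda>s f. \<lambda>x\<in>carrier A. s \<odot>\<^bsub>V\<^esub> f x)\<rparr>"

lemma dual_module_simps [simp]:
  "zero (dual_module R A U V) = (\<lambda>x\<in>carrier A. \<zero>\<^bsub>U\<^esub>)"
  "add (dual_module R A U V) = (\<lambda>f g. \<lambda>x\<in>carrier A. f x \<oplus>\<^bsub>U\<^esub> g x)"
  "smult (dual_module R A U V) = (\<lambda>s f. \<lambda>x\<in>carrier A. s \<odot>\<^bsub>V\<^esub> f x)"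
  by (simp_all add: dual_module_def)

lemma dual_carrier: "carrier (dual_module R A U V) = mod_hom R A U \<inter> extensional (carrier A)"
  by (simp add: dual_module_def)

lemma dual_hom: "h \<in> carrier (dual_module R A U V) \<Longrightarrow> h \<in> mod_hom R A U"
  by (simp add: dual_carrier)

lemma dual_eqI:
  "\<lbrakk>h \<in> carrier (dual_module R A U V); k \<in> carrier (dual_module R A U V); \<And>x. x \<in> carrier A \<Longrightarrow> h x = k x\<rbrakk> \<Longrightarrow> h = k"
  by (auto simp: dual_carrier intro: extensionalityI)

locale bimodule =
  fixes R :: "('r, 'c) ring_scheme" and S :: "('s, 'b) ring_scheme"
    and U :: "('r, 'u) module" and V :: "('s, 'u) module"
  assumes mod_U: "left_module R U" and mod_V: "left_module S V"
    and carrier_V: "carrier V = carrier U" and add_V: "add V = add U" and zero_V: "zero V = zero U"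
    and commute: "\<lbrakk>r \<in> carrier R; s \<in> carrier S; u \<in> carrier U\<rbrakk> \<Longrightarrow> r \<odot>\<^bsub>U\<^esub> (s \<odot>\<^bsub>V\<^esub> u) = s \<odot>\<^bsub>V\<^esub> (r \<odot>\<^bsub>U\<^esub> u)"
begin

lemma swap: "bimodule S R V U"
  by (intro bimodule.intro mod_U mod_V carrier_V[symmetric] add_V[symmetric] zero_V[symmetric])
    (simp add: commute carrier_V)

lemma ring_R: "ring R" and ring_S: "ring S"
  using mod_U mod_V by (auto intro: left_module.ring_R)

lemma act_hom: "s \<in> carrier S \<Longrightarrow> (\<lambda>u. s \<odot>\<^bsub>V\<^esub> u) \<in> mod_hom R U U"
proof -
  assume s: "s \<in> carrier S"
  interpret V: left_module S V by (rule mod_V)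
  show ?thesis
    by (rule mod_homI) (use s V.smult_closed[OF s] V.smult_r_distr[OF s] in
      \<open>simp_all add: carrier_V add_V commute\<close>)
qed

abbreviation dual where "dual A \<equiv> dual_module R A U V"

lemma dual_restrict: "left_module R A \<Longrightarrow> f \<in> mod_hom R A U \<Longrightarrow> restrict f (carrier A) \<in> carrier (dual A)"
  by (simp add: dual_carrier mod_hom_restrict)

lemma dual_left_module:
  assumes A: "left_module R A" shows "left_module S (dual A)"
proof -
  interpret A: left_module R A by fact
  interpret U: left_module R U by (rule mod_U)
  interpret V: left_module S V by (rule mod_V)
  note c = mod_hom_closed[OF dual_hom]
  show ?thesis
  proof (rule left_moduleI)
    show "ring S" by (rule ring_S)
    show "\<zero>\<^bsub>dual A\<^esub> \<in> carrier (dual A)"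
      using dual_restrict[OF A mod_hom_const_zero[OF mod_U]] by simp
    fix f assume f: "f \<in> carrier (dual A)"
    show "\<zero>\<^bsub>dual A\<^esub> \<oplus>\<^bsub>dual A\<^esub> f = f" "\<one>\<^bsub>S\<^esub> \<odot>\<^bsub>dual A\<^esub> f = f"
      using c[OF f] f V.smult_one by (auto simp: dual_carrier carrier_V extensional_def fun_eq_iff)
    have "(\<lambda>x. \<ominus>\<^bsub>U\<^esub> f x) \<in> mod_hom R A U"
      by (rule mod_homI) (simp_all add: c[OF f] mod_hom_add[OF dual_hom[OF f]]
          mod_hom_smult[OF dual_hom[OF f]] U.smult_minus_right U.M.minus_add)
    then have "(\<lambda>x\<in>carrier A. \<ominus>\<^bsub>U\<^esub> f x) \<in> carrier (dual A)"
      by (rule dual_restrict[OF A])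
    then show "\<exists>g\<in>carrier (dual A). g \<oplus>\<^bsub>dual A\<^esub> f = \<zero>\<^bsub>dual A\<^esub>"
      using c[OF f] by (intro bexI[of _ "\<lambda>x\<in>carrier A. \<ominus>\<^bsub>U\<^esub> f x"]) (auto simp: fun_eq_iff U.M.l_neg)
    fix g assume g: "g \<in> carrier (dual A)"
    show "f \<oplus>\<^bsub>dual A\<^esub> g \<in> carrier (dual A)"
      using dual_restrict[OF A mod_hom_plus[OF mod_U dual_hom[OF f] dual_hom[OF g]]] by simp
    show "f \<oplus>\<^bsub>dual A\<^esub> g = g \<oplus>\<^bsub>dual A\<^esub> f"
      using c[OF f] c[OF g] by (auto simp: fun_eq_iff U.M.a_comm)
    fix s assume s: "s \<in> carrier S"
    show "s \<odot>\<^bsub>dual A\<^esub> f \<in> carrier (dual A)"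
      using dual_restrict[OF A mod_hom_comp[OF dual_hom[OF f] act_hom[OF s]]] by simp
    show "s \<odot>\<^bsub>dual A\<^esub> (f \<oplus>\<^bsub>dual A\<^esub> g) = s \<odot>\<^bsub>dual A\<^esub> f \<oplus>\<^bsub>dual A\<^esub> s \<odot>\<^bsub>dual A\<^esub> g"
      using c[OF f] c[OF g] V.smult_r_distr[OF s] by (auto simp: fun_eq_iff carrier_V add_V)
    fix t assume t: "t \<in> carrier S"
    show "(s \<oplus>\<^bsub>S\<^esub> t) \<odot>\<^bsub>dual A\<^esub> f = s \<odot>\<^bsub>dual A\<^esub> f \<oplus>\<^bsub>dual A\<^esub> t \<odot>\<^bsub>dual A\<^esub> f"
      using c[OF f] V.smult_l_distr[OF s t] by (auto simp: fun_eq_iff carrier_V add_V)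
    show "(s \<otimes>\<^bsub>S\<^esub> t) \<odot>\<^bsub>dual A\<^esub> f = s \<odot>\<^bsub>dual A\<^esub> (t \<odot>\<^bsub>dual A\<^esub> f)"
      using c[OF f] V.smult_assoc1[OF s t] by (auto simp: fun_eq_iff carrier_V)
  next
    fix f g h assume f: "f \<in> carrier (dual A)" and g: "g \<in> carrier (dual A)" and h: "h \<in> carrier (dual A)"
    show "f \<oplus>\<^bsub>dual A\<^esub> g \<oplus>\<^bsub>dual A\<^esub> h = f \<oplus>\<^bsub>dual A\<^esub> (g \<oplus>\<^bsub>dual A\<^esub> h)"
      using c[OF f] c[OF g] c[OF h] by (auto simp: fun_eq_iff U.M.a_assoc)
  qed
qed

lemma eval_hom: "x \<in> carrier A \<Longrightarrow> (\<lambda>h. h x) \<in> mod_hom S (dual A) V"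
  by (rule mod_homI) (auto simp: add_V carrier_V mod_hom_closed[OF dual_hom])

lemma pullback_apply [simp]: "x \<in> carrier A \<Longrightarrow> pullback A f h x = h (f x)"
  by (simp add: pullback_def compose_def)

lemma pullback_hom:
  assumes A: "left_module R A" and f: "f \<in> mod_hom R A B"
  shows "pullback A f \<in> mod_hom S (dual B) (dual A)"
proof (rule mod_homI)
  fix h assume "h \<in> carrier (dual B)"
  then show "pullback A f h \<in> carrier (dual A)"
    using dual_restrict[OF A mod_hom_comp[OF f dual_hom]] by (simp add: pullback_def compose_def)
qed (auto simp: pullback_def compose_def fun_eq_iff mod_hom_closed[OF f])

text \<open>The inclusion of the factor \<open>x\<close> into \<open>Hom(F, U) = U\<^sup>X\<close>, for \<open>F\<close> free with basis \<open>X\<close>.\<close>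

definition coord_dual :: "'x set \<Rightarrow> 'x \<Rightarrow> 'u \<Rightarrow> ('x \<Rightarrow> 'r) \<Rightarrow> 'u" where
  "coord_dual X x u = (\<lambda>y\<in>carrier (free_module R X). y x \<odot>\<^bsub>U\<^esub> u)"

lemma coord_hom: "(\<lambda>y. y x) \<in> mod_hom R (free_module R X) (regular_module R)"
  unfolding free_module_def by (rule copower_coord_hom[OF regular_left_module[OF ring_R]])

lemma coord_dual_hom:
  "coord_dual X x \<in> mod_hom S V (dual (free_module R X))"
proof -
  interpret U: left_module R U by (rule mod_U)
  interpret V: left_module S V by (rule mod_V)
  note c = free_component[OF ring_R]
  show ?thesis
  proof (rule mod_homI)
    fix u assume "u \<in> carrier V"
    then show "coord_dual X x u \<in> carrier (dual (free_module R X))"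
      unfolding coord_dual_def
      by (intro dual_restrict[OF free_left_module[OF ring_R]] mod_hom_comp[OF coord_hom] smult_hom[OF mod_U])
        (simp add: carrier_V)
  qed (auto simp: coord_dual_def fun_eq_iff carrier_V add_V c U.smult_r_distr commute)
qed

lemma coord_dual_unit:
  assumes "u \<in> carrier U" "x \<in> X" "z \<in> X"
  shows "coord_dual X x u (unit_vec R z) = (if z = x then u else \<zero>\<^bsub>U\<^esub>)"
proof -
  interpret U: left_module R U by (rule mod_U)
  show ?thesis using assms unit_vec_closed[OF ring_R assms(3)]
    by (auto simp: coord_dual_def unit_vec_def coord_inj_def)
qed

lemma dual_free_expand:
  assumes X: "finite X" and h: "h \<in> carrier (dual (free_module R X))"
  shows "h = (\<Oplus>\<^bsub>dual (free_module R X)\<^esub> x\<in>X. coord_dual X x (h (unit_vec R x)))"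
proof -
  let ?F = "free_module R X"
  interpret U: left_module R U by (rule mod_U)
  interpret V: left_module S V by (rule mod_V)
  interpret D: left_module S "dual ?F" by (rule dual_left_module[OF free_left_module[OF ring_R]])
  have hu: "h (unit_vec R x) \<in> carrier V" if "x \<in> X" for x
    using mod_hom_closed[OF dual_hom[OF h] unit_vec_closed[OF ring_R that]] by (simp add: carrier_V)
  have cd: "coord_dual X x (h (unit_vec R x)) \<in> carrier (dual ?F)" if "x \<in> X" for x
    using mod_hom_closed[OF coord_dual_hom hu[OF that]] .
  show ?thesis
  proof (rule dual_eqI[OF h])
    show "(\<Oplus>\<^bsub>dual ?F\<^esub> x\<in>X. coord_dual X x (h (unit_vec R x))) \<in> carrier (dual ?F)"
      by (rule D.M.finsum_closed) (use cd in auto)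
    fix y assume y: "y \<in> carrier ?F"
    have "(\<Oplus>\<^bsub>dual ?F\<^esub> x\<in>X. coord_dual X x (h (unit_vec R x))) y =
        (\<Oplus>\<^bsub>V\<^esub> x\<in>X. coord_dual X x (h (unit_vec R x)) y)"
      by (rule mod_hom_finsum[OF D.left_module_axioms mod_V eval_hom[OF y] X]) (use cd in auto)
    also have "\<dots> = (\<Oplus>\<^bsub>U\<^esub> x\<in>X. coord_dual X x (h (unit_vec R x)) y)"
      by (simp add: finsum_def finprod_def carrier_V add_V zero_V)
    also have "\<dots> = (\<Oplus>\<^bsub>U\<^esub> x\<in>X. y x \<odot>\<^bsub>U\<^esub> h (unit_vec R x))"
      using y by (simp add: coord_dual_def)
    also have "\<dots> = h y"
      using free_hom_apply[OF ring_R mod_U dual_hom[OF h] y X] free_supp[OF y] by simp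
    finally show "h y = (\<Oplus>\<^bsub>dual ?F\<^esub> x\<in>X. coord_dual X x (h (unit_vec R x))) y" by simp
  qed
qed

lemma dual_free_hom_apply:
  assumes X: "finite X" and N: "left_module S N" and t: "t \<in> mod_hom S (dual (free_module R X)) N"
    and h: "h \<in> carrier (dual (free_module R X))"
  shows "t h = (\<Oplus>\<^bsub>N\<^esub> x\<in>X. t (coord_dual X x (h (unit_vec R x))))"
proof -
  have "coord_dual X x (h (unit_vec R x)) \<in> carrier (dual (free_module R X))" if "x \<in> X" for x
    using mod_hom_closed[OF coord_dual_hom] mod_hom_closed[OF dual_hom[OF h] unit_vec_closed[OF ring_R that]]
    by (simp add: carrier_V)
  then show ?thesis
    using arg_cong[OF dual_free_expand[OF X h], of t]
      mod_hom_finsum[OF dual_left_module[OF free_left_module[OF ring_R]] N t X, of "\<lambda>x. coord_dual X x (h (unit_vec R x))"]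
    by auto
qed

lemma dual_free_hom_eq:
  assumes X: "finite X" and N: "left_module S N"
    and t: "t \<in> mod_hom S (dual (free_module R X)) N" and t': "t' \<in> mod_hom S (dual (free_module R X)) N"
    and eq: "\<And>x u. x \<in> X \<Longrightarrow> u \<in> carrier U \<Longrightarrow> t (coord_dual X x u) = t' (coord_dual X x u)"
    and h: "h \<in> carrier (dual (free_module R X))"
  shows "t h = t' h"
proof -
  interpret N: left_module S N by fact
  have hu: "h (unit_vec R x) \<in> carrier U" if "x \<in> X" for x
    using mod_hom_closed[OF dual_hom[OF h] unit_vec_closed[OF ring_R that]] .
  show ?thesis
    unfolding dual_free_hom_apply[OF X N t h] dual_free_hom_apply[OF X N t' h]
    using eq hu mod_hom_closed[OF t' mod_hom_closed[OF coord_dual_hom]]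
    by (intro N.M.finsum_cong') (auto simp: carrier_V)
qed

lemma dual_free_extend:
  assumes X: "finite X" and N: "left_module S N" and g: "\<And>x. x \<in> X \<Longrightarrow> g x \<in> mod_hom S V N"
  obtains t where "t \<in> mod_hom S (dual (free_module R X)) N"
    "\<And>x u. x \<in> X \<Longrightarrow> u \<in> carrier U \<Longrightarrow> t (coord_dual X x u) = g x u"
proof -
  let ?F = "free_module R X"
  interpret U: left_module R U by (rule mod_U)
  interpret N: left_module S N by fact
  define t where "t h = (\<Oplus>\<^bsub>N\<^esub> x\<in>X. g x (h (unit_vec R x)))" for h
  note u = unit_vec_closed[OF ring_R, where X=X]
  have c: "h (unit_vec R x) \<in> carrier V" if "h \<in> carrier (dual ?F)" "x \<in> X" for h x
    using mod_hom_closed[OF dual_hom[OF that(1)] u[OF that(2)]] by (simp add: carrier_V)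
  have gc: "g x (h (unit_vec R x)) \<in> carrier N" if "h \<in> carrier (dual ?F)" "x \<in> X" for h x
    by (rule mod_hom_closed[OF g[OF that(2)] c[OF that]])
  have "t \<in> mod_hom S (dual ?F) N"
  proof (rule mod_homI)
    fix h assume h: "h \<in> carrier (dual ?F)"
    show "t h \<in> carrier N" unfolding t_def using gc[OF h] by (intro N.M.finsum_closed) auto
    fix k assume k: "k \<in> carrier (dual ?F)"
    have "t (h \<oplus>\<^bsub>dual ?F\<^esub> k) = (\<Oplus>\<^bsub>N\<^esub> x\<in>X. g x (h (unit_vec R x)) \<oplus>\<^bsub>N\<^esub> g x (k (unit_vec R x)))"
      unfolding t_def using gc[OF h] gc[OF k] c[OF h] c[OF k] mod_hom_add[OF g] u
      by (intro N.M.finsum_cong') (auto simp: add_V)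
    then show "t (h \<oplus>\<^bsub>dual ?F\<^esub> k) = t h \<oplus>\<^bsub>N\<^esub> t k"
      unfolding t_def using gc[OF h] gc[OF k] N.M.finsum_addf[of "\<lambda>x. g x (h (unit_vec R x))" X "\<lambda>x. g x (k (unit_vec R x))"]
      by auto
  next
    fix s h assume s: "s \<in> carrier S" and h: "h \<in> carrier (dual ?F)"
    have "t (s \<odot>\<^bsub>dual ?F\<^esub> h) = (\<Oplus>\<^bsub>N\<^esub> x\<in>X. s \<odot>\<^bsub>N\<^esub> g x (h (unit_vec R x)))"
      unfolding t_def using gc[OF h] c[OF h] mod_hom_smult[OF g s] u s
      by (intro N.M.finsum_cong') auto
    then show "t (s \<odot>\<^bsub>dual ?F\<^esub> h) = s \<odot>\<^bsub>N\<^esub> t h"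
      unfolding t_def using N.smult_finsum[OF X s, of "\<lambda>x. g x (h (unit_vec R x))"] gc[OF h] by auto
  qed
  moreover have "t (coord_dual X x v) = g x v" if x: "x \<in> X" and v: "v \<in> carrier U" for x v
  proof -
    have gv: "g x v \<in> carrier N" using mod_hom_closed[OF g[OF x]] v by (simp add: carrier_V)
    have "t (coord_dual X x v) = (\<Oplus>\<^bsub>N\<^esub> z\<in>X. if x = z then g x v else \<zero>\<^bsub>N\<^esub>)"
      unfolding t_def
      using coord_dual_unit[OF v x] gv mod_hom_zero[OF mod_V N g]
      by (intro N.M.finsum_cong') (auto simp: zero_V)
    also have "\<dots> = g x v" using N.M.finsum_singleton[OF x X, of "\<lambda>z. g x v"] gv by auto
    finally show ?thesis .
  qed
  ultimately show ?thesis by (rule that)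
qed

lemma dual_free_fg:
  assumes X: "finite X" and fg: "fg_module S V"
  shows "fg_module S (dual (free_module R X))"
proof -
  let ?F = "free_module R X"
  interpret V: left_module S V by (rule mod_V)
  interpret D: left_module S "dual ?F" by (rule dual_left_module[OF free_left_module[OF ring_R]])
  obtain G where G: "finite G" "G \<subseteq> carrier V" "\<And>K. submodule K S V \<Longrightarrow> G \<subseteq> K \<Longrightarrow> carrier V \<subseteq> K"
    using fg unfolding fg_module_iff by (elim conjE fin_genE) blast
  let ?G = "(\<lambda>(x, u). coord_dual X x u) ` (X \<times> G)"
  have "carrier (dual ?F) \<subseteq> K" if K: "submodule K S (dual ?F)" "?G \<subseteq> K" for K
  proof
    fix h assume h: "h \<in> carrier (dual ?F)"
    have "coord_dual X x u \<in> K" if x: "x \<in> X" and u: "u \<in> carrier V" for x u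
    proof -
      have "\<zero>\<^bsub>dual ?F\<^esub> \<in> K" using K(1) unfolding D.submodule_iff by blast
      then have "coord_dual X x \<zero>\<^bsub>V\<^esub> \<in> K"
        using mod_hom_zero[OF mod_V D.left_module_axioms coord_dual_hom, of x] by metis
      then have "submodule {u \<in> carrier V. coord_dual X x u \<in> K} S V"
        using K(1) unfolding V.submodule_iff D.submodule_iff
        by (auto simp: mod_hom_add[OF coord_dual_hom] mod_hom_smult[OF coord_dual_hom] simp del: dual_module_simps)
      moreover have "G \<subseteq> {u \<in> carrier V. coord_dual X x u \<in> K}" using K(2) G(2) x by auto
      ultimately show ?thesis using G(3) u by blast
    qed
    then have cK: "coord_dual X x (h (unit_vec R x)) \<in> K" if "x \<in> X" for x
      using mod_hom_closed[OF dual_hom[OF h] unit_vec_closed[OF ring_R that]] that by (simp add: carrier_V)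
    have "(\<Oplus>\<^bsub>dual ?F\<^esub> x\<in>X. coord_dual X x (h (unit_vec R x))) \<in> K"
      by (rule submodule_finsum[OF D.left_module_axioms K(1) X cK])
    then show "h \<in> K" by (simp only: dual_free_expand[OF X h, symmetric])
  qed
  moreover have "?G \<subseteq> carrier (dual ?F)" using G(2) by (auto intro!: mod_hom_closed[OF coord_dual_hom])
  ultimately have "fin_gen S (dual ?F) (carrier (dual ?F))"
    unfolding fin_gen_def using X G(1) by (intro exI[of _ ?G]) auto
  then show ?thesis by (simp add: fg_module_iff D.left_module_axioms)
qed

end

text \<open>For \<open>V\<close> of finite injective dimension, these hypotheses make \<open>Hom_R(-, U)\<close> followed by \<open>Hom_S(-, V)\<close> a biduality, in the
  derived sense, for finitely generated \<open>R\<close>-modules: \<open>R\<close> is the full endomorphism ring of \<open>V\<close>, and \<open>V\<close> is self-orthogonal.\<close>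

locale dualizing = bimodule R S U V + inj_res S V J e d
  for R :: "('r, 'c) ring_scheme" and S :: "('s, 'b) ring_scheme"
    and U :: "('r, 'u) module" and V :: "('s, 'u) module"
    and J :: "nat \<Rightarrow> ('s, 'i) module" and e d +
  assumes endo: "t \<in> mod_hom S V V \<Longrightarrow> \<exists>r\<in>carrier R. \<forall>u\<in>carrier U. t u = r \<odot>\<^bsub>U\<^esub> u"
    and faithful: "\<lbrakk>r \<in> carrier R; \<And>u. u \<in> carrier U \<Longrightarrow> r \<odot>\<^bsub>U\<^esub> u = \<zero>\<^bsub>U\<^esub>\<rbrakk> \<Longrightarrow> r = \<zero>\<^bsub>R\<^esub>"
    and self_orth: "ext_zero S J d (Suc k) V"
begin

text \<open>The dual of \<open>R\<^sup>X\<close> is \<open>V\<^sup>X\<close>, and on each factor an \<open>S\<close>-homomorphism to \<open>V\<close> is multiplication by an element of \<open>R\<close>.\<close>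

lemma eval_surj:
  assumes X: "finite X" and t: "t \<in> mod_hom S (dual (free_module R X)) V"
  obtains y where "y \<in> carrier (free_module R X)" "\<And>h. h \<in> carrier (dual (free_module R X)) \<Longrightarrow> t h = h y"
proof -
  let ?F = "free_module R X"
  interpret R: ring R by (rule ring_R)
  have "\<forall>x. \<exists>r\<in>carrier R. \<forall>u\<in>carrier U. t (coord_dual X x u) = r \<odot>\<^bsub>U\<^esub> u"
    using endo[OF mod_hom_comp[OF coord_dual_hom t]] by blast
  then obtain r where r: "\<And>x. r x \<in> carrier R" "\<And>x u. u \<in> carrier U \<Longrightarrow> t (coord_dual X x u) = r x \<odot>\<^bsub>U\<^esub> u"
    by metis
  define y where "y x = (if x \<in> X then r x else \<zero>\<^bsub>R\<^esub>)" for x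
  have "finite {x. y x \<noteq> \<zero>\<^bsub>R\<^esub>}" by (rule finite_subset[OF _ X]) (auto simp: y_def)
  then have y: "y \<in> carrier ?F" using r(1) by (auto simp: free_module_def copower_carrier y_def)
  have "t h = h y" if h: "h \<in> carrier (dual ?F)" for h
    by (rule dual_free_hom_eq[OF X mod_V t eval_hom[OF y] _ h])
      (use y r(2) in \<open>auto simp: coord_dual_def y_def\<close>)
  then show ?thesis using that y by blast
qed

lemma separates:
  assumes y: "y \<in> carrier (free_module R X)" and z: "\<And>h. h \<in> carrier (dual (free_module R X)) \<Longrightarrow> h y = \<zero>\<^bsub>U\<^esub>"
  shows "y = \<zero>\<^bsub>free_module R X\<^esub>"
proof -
  have "y x = \<zero>\<^bsub>R\<^esub>" for x
  proof (rule faithful[OF free_component[OF ring_R y]])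
    fix u assume "u \<in> carrier U"
    then have "coord_dual X x u \<in> carrier (dual (free_module R X))"
      by (intro mod_hom_closed[OF coord_dual_hom]) (simp add: carrier_V)
    from z[OF this] show "y x \<odot>\<^bsub>U\<^esub> u = \<zero>\<^bsub>U\<^esub>" using y by (simp add: coord_dual_def)
  qed
  then show ?thesis by (simp add: free_module_def fun_eq_iff)
qed

text \<open>The dual of a free module of finite rank is a finite direct sum of copies of \<open>V\<close>.\<close>

lemma ext_zero_dual:
  assumes X: "finite X" shows "ext_zero S J d (Suc k) (dual (free_module R X))"
proof (rule ext_zero_SucI)
  let ?F = "free_module R X"
  fix f assume f: "f \<in> mod_hom S (dual ?F) (J (Suc k))"
    "\<And>h. h \<in> carrier (dual ?F) \<Longrightarrow> d (Suc k) (f h) = \<zero>\<^bsub>J (Suc (Suc k))\<^esub>"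
  have "\<exists>g. g \<in> mod_hom S V (J k) \<and> (\<forall>u\<in>carrier V. f (coord_dual X x u) = d k (g u))" for x
    using ext_zero_SucD[OF self_orth[of k] mod_hom_comp[OF coord_dual_hom f(1)]]
      f(2)[OF mod_hom_closed[OF coord_dual_hom]] by metis
  then obtain g where g: "\<And>x. g x \<in> mod_hom S V (J k)"
    "\<And>x u. u \<in> carrier V \<Longrightarrow> f (coord_dual X x u) = d k (g x u)" by metis
  obtain t where t: "t \<in> mod_hom S (dual ?F) (J k)"
    "\<And>x u. x \<in> X \<Longrightarrow> u \<in> carrier U \<Longrightarrow> t (coord_dual X x u) = g x u"
    by (rule dual_free_extend[where g=g, OF X J]) (use g(1) in blast)+
  have "f h = d k (t h)" if "h \<in> carrier (dual ?F)" for h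
    by (rule dual_free_hom_eq[OF X J f(1) mod_hom_comp[OF t(1) d] _ that])
      (use g(2) t(2) in \<open>auto simp: carrier_V\<close>)
  with t(1) show "\<exists>g\<in>mod_hom S (dual ?F) (J k). \<forall>x\<in>carrier (dual ?F). f x = d k (g x)" by blast
qed

end

text \<open>The coboundaries in degree \<open>j\<close> of a complex that starts in degree \<open>0\<close>.\<close>

definition cob_part :: "(nat \<Rightarrow> ('r, 'm) module) \<Rightarrow> (nat \<Rightarrow> 'm \<Rightarrow> 'm) \<Rightarrow> nat \<Rightarrow> 'm set" where
  "cob_part C c j = (case j of 0 \<Rightarrow> {\<zero>\<^bsub>C 0\<^esub>} | Suc q \<Rightarrow> c q ` carrier (C q))"

context bimodule begin

context
  fixes A :: "('r, 'a) module" and X :: "nat \<Rightarrow> 'x set" and D p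
  assumes res: "free_resolution R A X D p"
begin

abbreviation (input) dualC where "dualC \<equiv> \<lambda>k. dual (free_module R (X k))"
abbreviation (input) dualD where "dualD \<equiv> \<lambda>k. pullback (free_module R (X (Suc k))) (D k)"

lemma cob_part_submodule: "submodule (cob_part dualC dualD k) S (dualC k)"
proof (cases k)
  case 0
  then show ?thesis
    using left_module.submodule_zero[OF dual_left_module[OF free_left_module[OF ring_R]], of "X 0"] by (simp add: cob_part_def)
next
  case (Suc j)
  note F = free_left_module[OF ring_R]
  show ?thesis
    using image_submodule[OF dual_left_module[OF F] dual_left_module[OF F] pullback_hom[OF F resolutionD(3)[OF res]], of j]
    by (simp add: cob_part_def Suc)
qed

lemma cob_part_iff:
  assumes h: "h \<in> carrier (dualC k)"
  shows "h \<in> cob_part dualC dualD k \<longleftrightarrow> is_coboundary R X D U k h"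
proof (cases k)
  case 0
  have "h = \<zero>\<^bsub>dualC 0\<^esub> \<longleftrightarrow> (\<forall>y\<in>carrier (free_module R (X 0)). h y = \<zero>\<^bsub>U\<^esub>)"
    using h 0 by (auto simp: dual_carrier extensional_def fun_eq_iff)
  then show ?thesis by (simp add: cob_part_def is_coboundary_def 0)
next
  case (Suc j)
  note D = resolutionD(3)[OF res] and F = free_left_module[OF ring_R]
  show ?thesis
  proof
    assume "h \<in> cob_part dualC dualD k"
    then show "is_coboundary R X D U k h" by (auto simp: is_coboundary_def cob_part_def Suc dual_hom)
  next
    assume "is_coboundary R X D U k h"
    then obtain g where g: "g \<in> mod_hom R (free_module R (X j)) U"
      "\<And>y. y \<in> carrier (free_module R (X k)) \<Longrightarrow> h y = g (D j y)"
      by (auto simp: is_coboundary_def Suc)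
    let ?g = "restrict g (carrier (free_module R (X j)))"
    have g': "?g \<in> carrier (dualC j)" by (rule dual_restrict[OF F g(1)])
    have "h = dualD j ?g"
      using g(2) mod_hom_closed[OF D] Suc
      by (intro dual_eqI[OF h]) (auto intro!: mod_hom_closed[OF pullback_hom[OF F D] g'])
    then show "h \<in> cob_part dualC dualD k" using g' by (auto simp: cob_part_def Suc)
  qed
qed

lemma dualD_zero_iff:
  assumes h: "h \<in> carrier (dualC k)"
  shows "dualD k h = \<zero>\<^bsub>dualC (Suc k)\<^esub> \<longleftrightarrow> is_cocycle R X D U k h"
  using dual_hom[OF h] by (auto simp: is_cocycle_def pullback_def compose_def fun_eq_iff)

lemma dualD_dualD:
  assumes h: "h \<in> carrier (dualC k)"
  shows "dualD (Suc k) (dualD k h) = \<zero>\<^bsub>dualC (Suc (Suc k))\<^esub>"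
proof -
  note D = resolutionD(3)[OF res] and F = free_left_module[OF ring_R]
  have "D k (D (Suc k) y) = \<zero>\<^bsub>free_module R (X k)\<^esub>" if "y \<in> carrier (free_module R (X (Suc (Suc k))))" for y
    using resolutionD(5)[OF res, of k] that by auto
  then show ?thesis
    using mod_hom_zero[OF F mod_U dual_hom[OF h]] mod_hom_closed[OF D]
    by (auto simp: pullback_def compose_def intro!: restrict_ext)
qed

end

end

locale dual_resolution = dualizing R S U V J e d
  for R :: "('r, 'c) ring_scheme" and S :: "('s, 'b) ring_scheme"
    and U :: "('r, 'u) module" and V :: "('s, 'u) module"
    and J :: "nat \<Rightarrow> ('s, 'i) module" and e d +
  fixes A :: "('r, 'a) module" and X :: "nat \<Rightarrow> 'x set" and D p
  assumes mod_A: "left_module R A" and res: "free_resolution R A X D p" and fin: "finite (X i)"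
begin

abbreviation F where "F k \<equiv> free_module R (X k)"
abbreviation W where "W k \<equiv> dual (F k)"
abbreviation \<delta> where "\<delta> k \<equiv> pullback (F (Suc k)) (D k)"
abbreviation im where "im k \<equiv> \<delta> k ` carrier (W k)"

lemma F: "left_module R (F k)" by (rule free_left_module[OF ring_R])
lemma W: "left_module S (W k)" by (rule dual_left_module[OF F])
lemma D: "D k \<in> mod_hom R (F (Suc k)) (F k)" by (rule resolutionD(3)[OF res])
lemma \<delta>: "\<delta> k \<in> mod_hom S (W k) (W (Suc k))" by (rule pullback_hom[OF F D])
lemma im_submodule: "submodule (im k) S (W (Suc k))" by (rule image_submodule[OF W W \<delta>])
lemma im: "left_module S ((W (Suc k))\<lparr>carrier := im k\<rparr>)"
  by (rule left_module.submodule_left_module[OF W im_submodule])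

lemma \<delta>_im: "\<delta> k \<in> mod_hom S (W k) ((W (Suc k))\<lparr>carrier := im k\<rparr>)"
  using \<delta> by (rule mod_hom_restrict_cod) blast

lemma kernel_D:
  assumes "y \<in> carrier (F (Suc k))" "D k y = \<zero>\<^bsub>F k\<^esub>"
  obtains z where "z \<in> carrier (F (Suc (Suc k)))" "y = D (Suc k) z"
proof -
  have "y \<in> D (Suc k) ` carrier (F (Suc (Suc k)))" using assms unfolding resolutionD(5)[OF res] by simp
  then show ?thesis using that by auto
qed

lemma \<delta>_eq_zero_iff:
  assumes "h \<in> carrier (W k)"
  shows "\<delta> k h = \<zero>\<^bsub>W (Suc k)\<^esub> \<longleftrightarrow> (\<forall>y\<in>carrier (F (Suc k)). h (D k y) = \<zero>\<^bsub>U\<^esub>)"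
  by (auto simp: pullback_def compose_def fun_eq_iff)

lemma \<delta>_\<delta>: "h \<in> carrier (W k) \<Longrightarrow> \<delta> (Suc k) (\<delta> k h) = \<zero>\<^bsub>W (Suc (Suc k))\<^esub>"
  by (rule dualD_dualD[OF res])

lemma im_iff_coboundary: "h \<in> carrier (W (Suc k)) \<Longrightarrow> h \<in> im k \<longleftrightarrow> is_coboundary R X D U (Suc k) h"
  using cob_part_iff[OF res, of h "Suc k"] by (simp add: cob_part_def)

lemma cocycle_iff: "h \<in> carrier (W k) \<Longrightarrow> is_cocycle R X D U k h \<longleftrightarrow> \<delta> k h = \<zero>\<^bsub>W (Suc k)\<^esub>"
  by (rule dualD_zero_iff[OF res, symmetric])

text \<open>If every \<open>Ext\<close> of \<open>A\<close> into \<open>U\<close> vanishes, the dual \<open>W\<close> of its free resolution is an infinite exact sequence that starts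
  with an injection. As the injective dimension of \<open>V\<close> is finite, dimension shifting along \<open>W\<close> makes all its images orthogonal to
  \<open>V\<close>. So dualizing \<open>W\<close> gives an exact sequence that ends with a surjection; but this is the free resolution of \<open>A\<close>.\<close>

lemma zero_if_all_ext_zero:
  assumes fin_dim: "\<And>i. i > n \<Longrightarrow> zero_module (J i)"
    and van: "\<And>i f. is_cocycle R X D U i f \<Longrightarrow> is_coboundary R X D U i f"
  shows "zero_module A"
proof -
  have surj: "inj_res_surjection S V J e d (W k) ((W (Suc k))\<lparr>carrier := im k\<rparr>) (\<delta> k)" for k
    by (intro inj_res_surjection.intro inj_res_axioms inj_res_surjection_axioms.intro W im \<delta>_im) simp
  have ker: "inj_res_surjection.ker (W (Suc k)) ((W (Suc (Suc k)))\<lparr>carrier := im (Suc k)\<rparr>) (\<delta> (Suc k)) = im k" for k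
    unfolding inj_res_surjection.ker_def[OF surj]
    using van cocycle_iff[of _ "Suc k"] im_iff_coboundary[of _ k] \<delta>_\<delta>[of _ k] mod_hom_closed[OF \<delta>[of k]] by auto
  have ext_im: "ext_zero S J d (Suc k) ((W (Suc i))\<lparr>carrier := im i\<rparr>)" for k i
  proof (induct "n - k" arbitrary: k i)
    case 0
    then show ?case using fin_dim[of "Suc k"] by (intro ext_zero_beyond) auto
  next
    case (Suc m)
    then have "ext_zero S J d (Suc (Suc k)) ((W (Suc (Suc i)))\<lparr>carrier := im (Suc i)\<rparr>)" by (intro Suc(1)) auto
    from inj_res_surjection.ext_zero_kernel[OF surj ext_zero_dual[OF fin] this]
    show ?case unfolding ker .
  qed
  have pz: "p y = \<zero>\<^bsub>A\<^esub>" if y: "y \<in> carrier (F 0)" for y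
  proof -
    obtain t where t: "t \<in> mod_hom S ((W (Suc 0))\<lparr>carrier := im 0\<rparr>) V"
      "\<And>h. h \<in> carrier (W 0) \<Longrightarrow> t (\<delta> 0 h) = h y"
    proof (rule factor_through_surjection[OF W im mod_V \<delta>_im _ eval_hom[OF y]])
      fix h assume h: "h \<in> carrier (W 0)" "\<delta> 0 h = \<zero>\<^bsub>(W (Suc 0))\<lparr>carrier := im 0\<rparr>\<^esub>"
      then have "is_coboundary R X D U 0 h" by (intro van) (simp add: cocycle_iff)
      then show "h y = \<zero>\<^bsub>V\<^esub>" using y by (simp add: is_coboundary_def zero_V)
    qed auto
    obtain t' where t': "t' \<in> mod_hom S (W (Suc 0)) V" "\<And>h. h \<in> im 0 \<Longrightarrow> t' h = t h"
      by (rule inj_res_surjection.extend_from_kernel[OF surj[of "Suc 0"] ext_im[of 0 "Suc 0"], unfolded ker, OF t(1)]) blast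
    obtain z where z: "z \<in> carrier (F (Suc 0))" "\<And>h. h \<in> carrier (W (Suc 0)) \<Longrightarrow> t' h = h z"
      by (rule eval_surj[OF fin t'(1)]) blast
    interpret F0: left_module R "F 0" by (rule F)
    interpret U: left_module R U by (rule mod_U)
    have Dz: "D 0 z \<in> carrier (F 0)" by (rule mod_hom_closed[OF D z(1)])
    have "h (y \<ominus>\<^bsub>F 0\<^esub> D 0 z) = \<zero>\<^bsub>U\<^esub>" if h: "h \<in> carrier (W 0)" for h
    proof -
      have "h y = t' (\<delta> 0 h)" using t(2)[OF h] t'(2)[of "\<delta> 0 h"] h by simp
      also have "\<dots> = h (D 0 z)" using z(2)[OF mod_hom_closed[OF \<delta> h]] z(1) by simp
      finally show ?thesis
        using y Dz mod_hom_closed[OF dual_hom[OF h]] by (simp add: mod_hom_diff[OF F mod_U dual_hom[OF h]])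
    qed
    then have "y \<ominus>\<^bsub>F 0\<^esub> D 0 z = \<zero>\<^bsub>F 0\<^esub>" using y Dz by (intro separates) auto
    then have "y = D 0 z" using y Dz by simp
    then show ?thesis using resolutionD(4)[OF res] z(1) by auto
  qed
  interpret F0: left_module R "F 0" by (rule F)
  have "\<zero>\<^bsub>F 0\<^esub> \<in> carrier (F 0)" by simp
  then have "\<exists>y. y \<in> carrier (F 0)" by blast
  then have "p ` carrier (F 0) = {\<zero>\<^bsub>A\<^esub>}" using pz by (auto simp: image_iff)
  then show ?thesis unfolding zero_module_def resolutionD(2)[OF res] .
qed

end

section \<open>The second action on Ext\<close>

context bimodule begin

text \<open>All general facts about quotients apply to \<open>Ext_module\<close>, as it is literally the quotient of the cocycles in
  \<open>Hom_S(F i, V)\<close>, with the action of \<open>R\<close>, by the coboundaries.\<close>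

lemma Ext_module_quotient:
  fixes N :: "('s, 'n) module" and i :: nat
  assumes res: "free_resolution S N X D p" and chosen: "chosen_resolution S N = (X, D)"
  defines "C \<equiv> dual_module S (free_module S (X i)) V U"
  shows "submodule (cocycles S X D V i) R C"
    and "submodule (coboundaries S X D V i) R (C\<lparr>carrier := cocycles S X D V i\<rparr>)"
    and "Ext_module S N V (smult U) i = quotient_module (C\<lparr>carrier := cocycles S X D V i\<rparr>) (coboundaries S X D V i)"
proof -
  interpret swap: bimodule S R V U by (rule swap)
  let ?F = "\<lambda>k. free_module S (X k)"
  note F = free_left_module[OF ring_S]
  note D = resolutionD(3)[OF res]
  have C: "left_module R (swap.dual (?F k))" for k by (rule swap.dual_left_module[OF F])
  have coc: "cocycles S X D V i = {f \<in> carrier C. pullback (?F (Suc i)) (D i) f = \<zero>\<^bsub>swap.dual (?F (Suc i))\<^esub>}"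
    by (simp add: cocycles_def a_kernel_def' C_def dual_carrier)
  show 1: "submodule (cocycles S X D V i) R C"
    unfolding coc unfolding C_def by (rule kernel_submodule[OF C C swap.pullback_hom[OF F D]])
  have cob: "submodule (coboundaries S X D V i) R C"
  proof (cases i)
    case 0
    then have "coboundaries S X D V i = {\<zero>\<^bsub>C\<^esub>}" by (simp add: coboundaries_def C_def)
    then show ?thesis using left_module.submodule_zero[OF C[of i]] by (simp add: C_def)
  next
    case (Suc j)
    then have "coboundaries S X D V i = pullback (?F (Suc j)) (D j) ` carrier (swap.dual (?F j))"
      by (simp add: coboundaries_def dual_carrier)
    then show ?thesis using image_submodule[OF C C swap.pullback_hom[OF F D]] by (simp add: C_def Suc)
  qed
  have sub: "coboundaries S X D V i \<subseteq> cocycles S X D V i"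
  proof
    fix f assume f: "f \<in> coboundaries S X D V i"
    then have fC: "f \<in> carrier C" using cob C by (auto simp: left_module.submodule_iff C_def)
    have "f (D i y) = \<zero>\<^bsub>V\<^esub>" if y: "y \<in> carrier (?F (Suc i))" for y
    proof (cases i)
      case 0
      then show ?thesis using f mod_hom_closed[OF D[of i] y] by (auto simp: coboundaries_def)
    next
      case (Suc j)
      then obtain g where g: "g \<in> mod_hom S (?F j) V" "f = pullback (?F (Suc j)) (D j) g"
        using f by (auto simp: coboundaries_def)
      have "D j (D (Suc j) y) = \<zero>\<^bsub>?F j\<^esub>" using resolutionD(5)[OF res, of j] y Suc by auto
      then show ?thesis
        using g mod_hom_closed[OF D[of i] y] mod_hom_zero[OF F mod_V g(1)] Suc by (simp add: pullback_def compose_def)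
    qed
    then show "f \<in> cocycles S X D V i" unfolding coc using fC by (auto simp: pullback_def compose_def fun_eq_iff)
  qed
  show "submodule (coboundaries S X D V i) R (C\<lparr>carrier := cocycles S X D V i\<rparr>)"
    using submodule_inter_sub[OF C[of i] cob[unfolded C_def] 1[unfolded C_def]] sub
    by (simp add: C_def Int_absorb2)
  show "Ext_module S N V (smult U) i = quotient_module (C\<lparr>carrier := cocycles S X D V i\<rparr>) (coboundaries S X D V i)"
    by (simp add: Ext_module_def Ext_group_def chosen cohomology_def Let_def ring.extend_def module.fields_def
        quotient_module_def C_def A_RCOSETS_def' a_r_coset_def' cohomology_smult_def[abs_def]
        cocycle_group_def) (simp add: fun_eq_iff set_add_def')
qed

text \<open>The grade condition is used only for cyclic submodules \<open>R[f]\<close> of \<open>Ext\<close>. Such a submodule is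
  known through its surjection from \<open>R\<close>, whose kernel is the annihilator of the class of the cocycle \<open>f\<close>.\<close>

lemma cyclic_submodule_of_Ext:
  fixes N :: "('s, 'n) module"
  assumes noeth: "left_noetherian R" and res: "free_resolution S N X D p"
    and chosen: "chosen_resolution S N = (X, D)"
    and grade: "s_grade_ge R U (Ext_module S N V (smult U) i) i" and f: "is_cocycle S X D V i f"
  obtains Y :: "('r, ((('n + 's) list \<Rightarrow> 's) \<Rightarrow> 'u) set) module" and g
    and Q :: "nat \<Rightarrow> (((('n + 's) list \<Rightarrow> 's) \<Rightarrow> 'u) set + 'r) list set" and E q
  where "fg_module R Y" "g \<in> mod_hom R (regular_module R) Y" "g ` carrier R = carrier Y"
    "\<forall>r\<in>carrier R. g r = \<zero>\<^bsub>Y\<^esub> \<longleftrightarrow> is_coboundary S X D V i (\<lambda>y. r \<odot>\<^bsub>U\<^esub> f y)"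
    "free_resolution R Y Q E q"
    "\<forall>k<i. \<forall>h. is_cocycle R Q E U k h \<longrightarrow> is_coboundary R Q E U k h"
proof -
  interpret swap: bimodule S R V U by (rule swap)
  let ?F = "free_module S (X i)"
  let ?C = "(swap.dual ?F)\<lparr>carrier := cocycles S X D V i\<rparr>" and ?B = "coboundaries S X D V i"
  note q = Ext_module_quotient[OF res chosen, of i]
  have C: "left_module R ?C"
    by (rule left_module.submodule_left_module[OF swap.dual_left_module[OF free_left_module[OF ring_S]] q(1)])
  let ?E = "quotient_module ?C ?B"
  note Q = quotient_left_module[OF C q(2)] quotient_hom[OF C q(2)] quotient_ker[OF C q(2)]
  let ?f = "restrict f (carrier ?F)"
  have f': "?f \<in> carrier ?C"
    using cocycle_restrict[OF ring_S resolutionD(3)[OF res] f] by simp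
  let ?z = "?B +>\<^bsub>?C\<^esub> ?f"
  have z: "?z \<in> carrier ?E" by (rule mod_hom_closed[OF Q(2) f'])
  let ?g = "\<lambda>r. r \<odot>\<^bsub>?E\<^esub> ?z"
  let ?H = "?g ` carrier R"
  let ?Y = "?E\<lparr>carrier := ?H\<rparr>"
  have H: "submodule ?H R ?E" and fg: "fg_module R ?Y" by (rule cyclic_fin_gen[OF Q(1) z])+
  have g: "?g \<in> mod_hom R (regular_module R) ?Y"
    by (rule mod_hom_restrict_cod[OF smult_hom[OF Q(1) z]]) simp
  have ker: "?g r = \<zero>\<^bsub>?Y\<^esub> \<longleftrightarrow> is_coboundary S X D V i (\<lambda>y. r \<odot>\<^bsub>U\<^esub> f y)" if r: "r \<in> carrier R" for r
  proof -
    have rf: "r \<odot>\<^bsub>?C\<^esub> ?f \<in> carrier ?C"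
      using left_module.smult_closed[OF C r f'] .
    have "?g r = ?B +>\<^bsub>?C\<^esub> (r \<odot>\<^bsub>?C\<^esub> ?f)" by (rule mod_hom_smult[OF Q(2) r f', symmetric])
    then have "?g r = \<zero>\<^bsub>?Y\<^esub> \<longleftrightarrow> r \<odot>\<^bsub>?C\<^esub> ?f \<in> ?B" using Q(3)[OF rf] by simp
    also have "\<dots> \<longleftrightarrow> is_coboundary S X D V i (r \<odot>\<^bsub>?C\<^esub> ?f)"
      by (rule coboundaries_iff[where X=X and d=D, OF ring_S resolutionD(3)[OF res]]) simp
    also have "\<dots> \<longleftrightarrow> is_coboundary S X D V i (\<lambda>y. r \<odot>\<^bsub>U\<^esub> f y)"
      by (auto simp: is_coboundary_def split: nat.split)
    finally show ?thesis .
  qed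
  obtain Q' E' where ch: "chosen_resolution R ?Y = (Q', E')" by (cases "chosen_resolution R ?Y") auto
  obtain q' where res': "free_resolution R ?Y Q' E' q'"
    using chosen_resolution_is_resolution[OF noeth fg ch] by blast
  have "is_coboundary R Q' E' U k h" if "k < i" "is_cocycle R Q' E' U k h" for k h
  proof (rule zero_cohomologyD[OF ring_R resolutionD(3)[OF res'] mod_U _ that(2)])
    have "grade_ge R U ?Y i" using grade H unfolding s_grade_ge_def q(3) by blast
    then show "zero_module (cohomology R Q' E' U k)"
      using that(1) by (simp add: grade_ge_def Ext_group_def ch)
  qed
  then show ?thesis using ker by (intro that[OF fg g _ _ res']) auto
qed

text \<open>As an \<open>S\<close>-module, the dual of a free module is a product of copies of \<open>V\<close>. So a cocycle with values in it is a
  coboundary as soon as its components, the values on the basis, are.\<close>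

lemma cocycle_into_dual:
  assumes res: "free_resolution S A Q E q"
    and van: "\<And>f. is_cocycle S Q E V k f \<Longrightarrow> is_coboundary S Q E V k f"
    and f: "is_cocycle S Q E (dual (free_module R X)) k f"
  shows "is_coboundary S Q E (dual (free_module R X)) k f"
proof -
  let ?F = "free_module R X" and ?Q = "\<lambda>k. free_module S (Q k)"
  note F = free_left_module[OF ring_R]
  note E = resolutionD(3)[OF res]
  have f1: "f \<in> mod_hom S (?Q k) (dual ?F)" using f by (simp add: is_cocycle_def)
  have fc: "f y \<in> carrier (dual ?F)" if "y \<in> carrier (?Q k)" for y by (rule mod_hom_closed[OF f1 that])
  have comp: "is_coboundary S Q E V k (\<lambda>y. f y (unit_vec R x))" if x: "x \<in> X" for x
  proof (rule van)
    show "is_cocycle S Q E V k (\<lambda>y. f y (unit_vec R x))"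
      using f mod_hom_comp[OF f1 eval_hom[OF unit_vec_closed[OF ring_R x]]] unit_vec_closed[OF ring_R x]
      by (auto simp: is_cocycle_def zero_V)
  qed
  show ?thesis
  proof (cases k)
    case 0
    have "f y = \<zero>\<^bsub>dual ?F\<^esub>" if y: "y \<in> carrier (?Q 0)" for y
    proof (rule dual_eqI)
      show "f y \<in> carrier (dual ?F)" using fc y 0 by simp
      show "\<zero>\<^bsub>dual ?F\<^esub> \<in> carrier (dual ?F)"
        using dual_restrict[OF F mod_hom_const_zero[OF mod_U]] by simp
      fix x assume x: "x \<in> carrier ?F"
      have "f y x = \<zero>\<^bsub>U\<^esub>"
        by (rule free_hom_eq[OF ring_R mod_U dual_hom[OF \<open>f y \<in> carrier (dual ?F)\<close>] mod_hom_const_zero[OF mod_U] _ x])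
          (use comp y 0 in \<open>auto simp: is_coboundary_def zero_V\<close>)
      then show "f y x = \<zero>\<^bsub>dual ?F\<^esub> x" using x by simp
    qed
    then show ?thesis by (simp add: is_coboundary_def 0)
  next
    case (Suc j)
    have "\<forall>x\<in>X. \<exists>g\<in>mod_hom S (?Q j) V. \<forall>y\<in>carrier (?Q k). f y (unit_vec R x) = g (E j y)"
      using comp by (simp add: is_coboundary_def Suc)
    then obtain g where g: "\<And>x. x \<in> X \<Longrightarrow> g x \<in> mod_hom S (?Q j) V"
      "\<And>x y. x \<in> X \<Longrightarrow> y \<in> carrier (?Q k) \<Longrightarrow> f y (unit_vec R x) = g x (E j y)"
      using bchoice[of X "\<lambda>x g. g \<in> mod_hom S (?Q j) V \<and> (\<forall>y\<in>carrier (?Q k). f y (unit_vec R x) = g (E j y))"]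
      by blast
    have gU: "g x y \<in> carrier U" if "x \<in> X" "y \<in> carrier (?Q j)" for x y
      using mod_hom_closed[OF g(1)] that by (simp add: carrier_V)
    let ?h = "\<lambda>y. free_ext R U (\<lambda>x. g x y)"
    have hh: "?h y \<in> mod_hom R ?F U" if "y \<in> carrier (?Q j)" for y
      by (rule free_ext_hom[OF mod_U gU[OF _ that]])
    have hu: "?h y (unit_vec R x) = g x y" if "y \<in> carrier (?Q j)" "x \<in> X" for x y
      by (rule free_ext_unit_vec[where v="\<lambda>x. g x y", OF mod_U gU[OF _ that(1)] that(2)])
    let ?g = "\<lambda>y. restrict (?h y) (carrier ?F)"
    have gd: "?g y \<in> carrier (dual ?F)" if "y \<in> carrier (?Q j)" for y
      by (rule dual_restrict[OF F hh[OF that]])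
    have eqI: "h = k" if "h \<in> carrier (dual ?F)" "k \<in> carrier (dual ?F)"
      "\<And>x. x \<in> X \<Longrightarrow> h (unit_vec R x) = k (unit_vec R x)" for h k
      by (rule dual_eqI[OF that(1,2)], rule free_hom_eq[OF ring_R mod_U dual_hom[OF that(1)] dual_hom[OF that(2)] that(3)])
    interpret Dm: left_module S "dual ?F" by (rule dual_left_module[OF F])
    interpret Qj: left_module S "?Q j" by (rule free_left_module[OF ring_S])
    note u = unit_vec_closed[OF ring_R, where X=X]
    have "?g \<in> mod_hom S (?Q j) (dual ?F)"
    proof (rule mod_homI)
      fix y z assume y: "y \<in> carrier (?Q j)" and z: "z \<in> carrier (?Q j)"
      show "?g (y \<oplus>\<^bsub>?Q j\<^esub> z) = ?g y \<oplus>\<^bsub>dual ?F\<^esub> ?g z"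
      proof (rule eqI)
        show "?g (y \<oplus>\<^bsub>?Q j\<^esub> z) \<in> carrier (dual ?F)" using y z by (intro gd) simp
        show "?g y \<oplus>\<^bsub>dual ?F\<^esub> ?g z \<in> carrier (dual ?F)" by (rule Dm.M.a_closed[OF gd[OF y] gd[OF z]])
        fix x assume x: "x \<in> X"
        then show "?g (y \<oplus>\<^bsub>?Q j\<^esub> z) (unit_vec R x) = (?g y \<oplus>\<^bsub>dual ?F\<^esub> ?g z) (unit_vec R x)"
          using y z u[OF x] mod_hom_add[OF g(1)[OF x] y z] by (simp add: hu add_V)
      qed
    next
      fix s y assume s: "s \<in> carrier S" and y: "y \<in> carrier (?Q j)"
      show "?g (s \<odot>\<^bsub>?Q j\<^esub> y) = s \<odot>\<^bsub>dual ?F\<^esub> ?g y"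
      proof (rule eqI)
        show "?g (s \<odot>\<^bsub>?Q j\<^esub> y) \<in> carrier (dual ?F)" using y s by (intro gd) simp
        show "s \<odot>\<^bsub>dual ?F\<^esub> ?g y \<in> carrier (dual ?F)" by (rule Dm.smult_closed[OF s gd[OF y]])
        fix x assume x: "x \<in> X"
        then show "?g (s \<odot>\<^bsub>?Q j\<^esub> y) (unit_vec R x) = (s \<odot>\<^bsub>dual ?F\<^esub> ?g y) (unit_vec R x)"
          using y s u[OF x] mod_hom_smult[OF g(1)[OF x] s y] by (simp add: hu)
      qed
    qed (rule gd)
    moreover have "f y = ?g (E j y)" if y: "y \<in> carrier (?Q k)" for y
    proof (rule eqI[OF fc[OF y]])
      have Ey: "E j y \<in> carrier (?Q j)" using mod_hom_closed[OF E[of j]] y Suc by simp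
      then show "?g (E j y) \<in> carrier (dual ?F)" by (rule gd)
      show "f y (unit_vec R x) = ?g (E j y) (unit_vec R x)" if "x \<in> X" for x
        using g(2)[OF that y] u[OF that] hu[OF Ey that] by simp
    qed
    ultimately show ?thesis by (auto simp: is_coboundary_def Suc)
  qed
qed

end

section \<open>A staircase lemma\<close>

text \<open>A homomorphism from \<open>A\<close> to the cokernel of \<open>C (j - 1) \<rightarrow> C j\<close> is given as \<open>f\<close> on the first term of a free resolution of \<open>A\<close>,
  modulo coboundaries. As \<open>C\<close> is exact below \<open>j\<close>, it shifts down to a class in \<open>Ext j (A, C 0) = 0\<close>, and coming back up it can be
  corrected step by step because \<open>Ext\<close> from \<open>A\<close> into each \<open>C q\<close> vanishes.\<close>

lemma staircase:
  assumes R: "ring R" and res: "free_resolution R A Q E q"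
    and C: "\<And>q. left_module R (C q)" and c: "\<And>q. c q \<in> mod_hom R (C q) (C (Suc q))"
    and cc: "\<And>q x. x \<in> carrier (C q) \<Longrightarrow> c (Suc q) (c q x) = \<zero>\<^bsub>C (Suc (Suc q))\<^esub>"
    and ex: "\<And>q x. q < j \<Longrightarrow> x \<in> carrier (C q) \<Longrightarrow> c q x = \<zero>\<^bsub>C (Suc q)\<^esub> \<Longrightarrow> x \<in> cob_part C c q"
    and van: "\<And>k q f. k \<le> j \<Longrightarrow> q \<le> j \<Longrightarrow> is_cocycle R Q E (C q) k f \<Longrightarrow> is_coboundary R Q E (C q) k f"
    and f: "f \<in> mod_hom R (free_module R (Q 0)) (C j)"
    and fE: "\<And>y. y \<in> carrier (free_module R (Q (Suc 0))) \<Longrightarrow> f (E 0 y) \<in> cob_part C c j"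
    and y: "y \<in> carrier (free_module R (Q 0))"
  shows "f y \<in> cob_part C c j"
proof -
  let ?F = "\<lambda>k. free_module R (Q k)"
  note F = free_left_module[OF R]
  note E = resolutionD(3)[OF res]
  have EE: "E k (E (Suc k) y) = \<zero>\<^bsub>?F k\<^esub>" if "y \<in> carrier (?F (Suc (Suc k)))" for k y
    using resolutionD(5)[OF res, of k] that by auto
  have step: "\<exists>h\<in>mod_hom R (?F k) (C (Suc q)). (\<forall>y\<in>carrier (?F k). h y \<in> c q ` carrier (C q)) \<and>
      (\<forall>y\<in>carrier (?F (Suc k)). g y = h (E k y))"
    if "Suc k + q \<le> j" "q < j" "g \<in> mod_hom R (?F (Suc k)) (C (Suc q))"
      "\<And>y. y \<in> carrier (?F (Suc k)) \<Longrightarrow> g y \<in> c q ` carrier (C q)"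
      "\<And>y. y \<in> carrier (?F (Suc (Suc k))) \<Longrightarrow> g (E (Suc k) y) = \<zero>\<^bsub>C (Suc q)\<^esub>" for k q g
    using that
  proof (induct q arbitrary: k g)
    case (0 k g)
    obtain l where l: "l \<in> mod_hom R (?F (Suc k)) (C 0)" "\<And>y. y \<in> carrier (?F (Suc k)) \<Longrightarrow> c 0 (l y) = g y"
      by (rule free_lift[OF C C 0(3) c]) (use 0(4)[OF unit_vec_closed[OF R]] in auto)
    have "l (E (Suc k) y) = \<zero>\<^bsub>C 0\<^esub>" if "y \<in> carrier (?F (Suc (Suc k)))" for y
      using ex[OF 0(2), of "l (E (Suc k) y)"] mod_hom_closed[OF l(1) mod_hom_closed[OF E that]]
        l(2)[OF mod_hom_closed[OF E that]] 0(5)[OF that] by (simp add: cob_part_def)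
    then have "is_cocycle R Q E (C 0) (Suc k) l" using l(1) by (simp add: is_cocycle_def)
    then have "is_coboundary R Q E (C 0) (Suc k) l" using 0(1) by (intro van) auto
    then obtain h where h: "h \<in> mod_hom R (?F k) (C 0)" "\<And>y. y \<in> carrier (?F (Suc k)) \<Longrightarrow> l y = h (E k y)"
      by (auto simp: is_coboundary_def)
    then show ?case
      using l(2) mod_hom_closed[OF h(1)] by (intro bexI[OF _ mod_hom_comp[OF h(1) c]]) auto
  next
    case (Suc q k g)
    interpret Cq: left_module R "C (Suc q)" by (rule C)
    interpret Cq2: left_module R "C (Suc (Suc q))" by (rule C)
    obtain l where l: "l \<in> mod_hom R (?F (Suc k)) (C (Suc q))"
      "\<And>y. y \<in> carrier (?F (Suc k)) \<Longrightarrow> c (Suc q) (l y) = g y"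
      by (rule free_lift[OF C C Suc(4) c]) (use Suc(5)[OF unit_vec_closed[OF R]] in auto)
    have lE: "l (E (Suc k) y) \<in> c q ` carrier (C q)" if "y \<in> carrier (?F (Suc (Suc k)))" for y
      using ex[OF Suc(3), of "l (E (Suc k) y)"] mod_hom_closed[OF l(1) mod_hom_closed[OF E that]]
        l(2)[OF mod_hom_closed[OF E that]] Suc(6)[OF that] by (simp add: cob_part_def)
    obtain h where h: "h \<in> mod_hom R (?F (Suc k)) (C (Suc q))"
      "\<And>y. y \<in> carrier (?F (Suc k)) \<Longrightarrow> h y \<in> c q ` carrier (C q)"
      "\<And>y. y \<in> carrier (?F (Suc (Suc k))) \<Longrightarrow> l (E (Suc k) y) = h (E (Suc k) y)"
      using Suc(1)[of "Suc k" "\<lambda>y. l (E (Suc k) y)"] Suc(2,3) mod_hom_comp[OF E l(1)] lE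
        mod_hom_zero[OF F C l(1)] by (auto simp: EE)
    let ?w = "\<lambda>y. l y \<ominus>\<^bsub>C (Suc q)\<^esub> h y"
    have w: "?w \<in> mod_hom R (?F (Suc k)) (C (Suc q))" by (rule mod_hom_minus[OF C l(1) h(1)])
    have "is_cocycle R Q E (C (Suc q)) (Suc k) ?w"
      using w h(3) mod_hom_closed[OF h(1) mod_hom_closed[OF E]] by (simp add: is_cocycle_def)
    then have "is_coboundary R Q E (C (Suc q)) (Suc k) ?w" using Suc(2,3) by (intro van) auto
    then obtain v where v: "v \<in> mod_hom R (?F k) (C (Suc q))" "\<And>y. y \<in> carrier (?F (Suc k)) \<Longrightarrow> ?w y = v (E k y)"
      by (auto simp: is_coboundary_def)
    have "g y = c (Suc q) (v (E k y))" if y: "y \<in> carrier (?F (Suc k))" for y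
    proof -
      have "c (Suc q) (h y) = \<zero>\<^bsub>C (Suc (Suc q))\<^esub>" using h(2)[OF y] cc by auto
      then have "c (Suc q) (?w y) = g y"
        using y l(2)[OF y] mod_hom_closed[OF l(1) y] mod_hom_closed[OF h(1) y]
          mod_hom_closed[OF c, of "l y" "Suc q"] by (simp add: mod_hom_diff[OF C C c])
      then show ?thesis using v(2)[OF y] by simp
    qed
    then show ?case
      using mod_hom_closed[OF v(1)] by (intro bexI[OF _ mod_hom_comp[OF v(1) c]]) auto
  qed
  show ?thesis
  proof (cases j)
    case 0
    then have "is_cocycle R Q E (C 0) 0 f" using f fE by (auto simp: is_cocycle_def cob_part_def)
    then have "is_coboundary R Q E (C 0) 0 f" using 0 by (intro van) auto
    then show ?thesis using y 0 by (auto simp: is_coboundary_def cob_part_def)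
  next
    case (Suc q)
    interpret Cj: left_module R "C (Suc q)" by (rule C)
    have f': "f \<in> mod_hom R (?F 0) (C (Suc q))" using f Suc by simp
    obtain h where h: "h \<in> mod_hom R (?F 0) (C (Suc q))"
      "\<And>y. y \<in> carrier (?F 0) \<Longrightarrow> h y \<in> c q ` carrier (C q)"
      "\<And>y. y \<in> carrier (?F (Suc 0)) \<Longrightarrow> f (E 0 y) = h (E 0 y)"
      using step[of 0 q "\<lambda>y. f (E 0 y)"] Suc mod_hom_comp[OF E f'] fE
        mod_hom_zero[OF F C f'] by (auto simp: EE cob_part_def)
    let ?w = "\<lambda>y. f y \<ominus>\<^bsub>C (Suc q)\<^esub> h y"
    have "is_cocycle R Q E (C (Suc q)) 0 ?w"
      using mod_hom_minus[OF C f' h(1)] h(3) mod_hom_closed[OF h(1) mod_hom_closed[OF E]]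
      by (simp add: is_cocycle_def)
    then have "is_coboundary R Q E (C (Suc q)) 0 ?w" using Suc by (intro van) auto
    then have "f y = h y"
      using y mod_hom_closed[OF f'] mod_hom_closed[OF h(1)] by (auto simp: is_coboundary_def)
    then show ?thesis using h(2)[OF y] by (simp add: Suc cob_part_def)
  qed
qed

section \<open>Left-right symmetry of the Gorenstein condition\<close>

context dual_resolution begin

text \<open>\<open>T m\<close> is the cokernel of \<open>W m \<rightarrow> W (m + 1)\<close>, and \<open>ext_part m\<close> is \<open>Ext (m + 1) (A, U)\<close> as a submodule of it:
  the kernel of the map to \<open>W (m + 2)\<close>.\<close>

definition T where "T m = quotient_module (W (Suc m)) (im m)"
abbreviation proj where "proj m h \<equiv> im m +>\<^bsub>W (Suc m)\<^esub> h"

lemma T: "left_module S (T m)"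
  and proj: "proj m \<in> mod_hom S (W (Suc m)) (T m)"
  and proj_sur: "proj m ` carrier (W (Suc m)) = carrier (T m)"
  and proj_ker: "h \<in> carrier (W (Suc m)) \<Longrightarrow> proj m h = \<zero>\<^bsub>T m\<^esub> \<longleftrightarrow> h \<in> im m"
  unfolding T_def
  using quotient_left_module[OF W im_submodule] quotient_hom[OF W im_submodule]
    quotient_surj[OF W im_submodule] quotient_ker[OF W im_submodule] by blast+

definition induced where "induced m = (SOME g. g \<in> mod_hom S (T m) (W (Suc (Suc m))) \<and>
    (\<forall>h\<in>carrier (W (Suc m)). g (proj m h) = \<delta> (Suc m) h))"

lemma induced: "induced m \<in> mod_hom S (T m) (W (Suc (Suc m)))"
  and induced_proj: "h \<in> carrier (W (Suc m)) \<Longrightarrow> induced m (proj m h) = \<delta> (Suc m) h"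
proof -
  have "\<exists>g. g \<in> mod_hom S (T m) (W (Suc (Suc m))) \<and> (\<forall>h\<in>carrier (W (Suc m)). g (proj m h) = \<delta> (Suc m) h)"
  proof (rule factor_through_surjection[OF W T W proj proj_sur \<delta>])
    fix h assume h: "h \<in> carrier (W (Suc m))" "proj m h = \<zero>\<^bsub>T m\<^esub>"
    then have "h \<in> im m" using proj_ker by blast
    then show "\<delta> (Suc m) h = \<zero>\<^bsub>W (Suc (Suc m))\<^esub>" using \<delta>_\<delta> by auto
  qed blast
  from someI_ex[OF this, folded induced_def]
  show "induced m \<in> mod_hom S (T m) (W (Suc (Suc m)))"
    "h \<in> carrier (W (Suc m)) \<Longrightarrow> induced m (proj m h) = \<delta> (Suc m) h" by blast+
qed

definition ext_part where "ext_part m = {t \<in> carrier (T m). induced m t = \<zero>\<^bsub>W (Suc (Suc m))\<^esub>}"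

lemma ext_part_submodule: "submodule (ext_part m) S (T m)"
  unfolding ext_part_def by (rule kernel_submodule[OF T W induced])

text \<open>An \<open>S\<close>-homomorphism \<open>W (m + 1) \<rightarrow> V\<close> is evaluation at some \<open>x\<close> in the free resolution. If it kills the image of \<open>W m\<close>, then
  \<open>D m x = 0\<close>, so that \<open>x\<close> is a boundary.\<close>

lemma hom_killing_im:
  assumes t: "t \<in> mod_hom S (W (Suc m)) V" and z: "\<And>h. h \<in> carrier (W m) \<Longrightarrow> t (\<delta> m h) = \<zero>\<^bsub>V\<^esub>"
  obtains y where "y \<in> carrier (F (Suc (Suc m)))" "\<And>h. h \<in> carrier (W (Suc m)) \<Longrightarrow> t h = h (D (Suc m) y)"
proof -
  obtain x where x: "x \<in> carrier (F (Suc m))" "\<And>h. h \<in> carrier (W (Suc m)) \<Longrightarrow> t h = h x"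
    by (rule eval_surj[OF fin t]) blast
  have "h (D m x) = \<zero>\<^bsub>U\<^esub>" if h: "h \<in> carrier (W m)" for h
    using z[OF h] x(2)[OF mod_hom_closed[OF \<delta> h]] x(1) by (simp add: zero_V)
  then have "D m x = \<zero>\<^bsub>F m\<^esub>" by (rule separates[OF mod_hom_closed[OF D x(1)]])
  then obtain y where "y \<in> carrier (F (Suc (Suc m)))" "x = D (Suc m) y" by (rule kernel_D[OF x(1)])
  then show ?thesis using that x(2) by blast
qed

text \<open>On \<open>W (m + 1)\<close> the homomorphism \<open>t\<close> is evaluation at a boundary. So it factors through the map to \<open>W (m + 2)\<close>, which vanishes on
  \<open>ext_part m\<close>.\<close>

lemma hom_T_kills_ext_part:
  assumes t: "t \<in> mod_hom S (T m) V" and x: "x \<in> ext_part m" shows "t x = \<zero>\<^bsub>V\<^esub>"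
proof -
  obtain y where y: "y \<in> carrier (F (Suc (Suc m)))" "\<And>h. h \<in> carrier (W (Suc m)) \<Longrightarrow> t (proj m h) = h (D (Suc m) y)"
  proof (rule hom_killing_im[OF mod_hom_comp[OF proj t]])
    fix h assume h: "h \<in> carrier (W m)"
    have "proj m (\<delta> m h) = \<zero>\<^bsub>T m\<^esub>" using proj_ker[OF mod_hom_closed[OF \<delta> h]] h by blast
    then show "t (proj m (\<delta> m h)) = \<zero>\<^bsub>V\<^esub>" using mod_hom_zero[OF T mod_V t] by simp
  qed blast
  obtain h where h: "h \<in> carrier (W (Suc m))" "x = proj m h" using x unfolding ext_part_def proj_sur[symmetric] by blast
  then have "\<delta> (Suc m) h = \<zero>\<^bsub>W (Suc (Suc m))\<^esub>" using x induced_proj by (simp add: ext_part_def)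
  then have "h (D (Suc m) y) = \<zero>\<^bsub>U\<^esub>" using y(1) \<delta>_eq_zero_iff[OF h(1)] by blast
  then show ?thesis using y(2)[OF h(1)] h(2) by (simp add: zero_V)
qed

text \<open>Dimension shifting: the kernel of \<open>W (m + 1) \<rightarrow> T m\<close> is the image of \<open>W m\<close>, and this is the quotient of \<open>T (m - 1)\<close> by
  \<open>ext_part (m - 1)\<close>. In degree one, homomorphisms from that kernel to \<open>V\<close> extend by \<open>hom_killing_im\<close>.\<close>

lemma ext_zero_T:
  assumes "\<And>k j. k < m \<Longrightarrow> j \<le> k \<Longrightarrow> ext_zero S J d j ((T k)\<lparr>carrier := ext_part k\<rparr>)"
    and "1 \<le> j" "j \<le> m"
  shows "ext_zero S J d j (T m)"
  using assms
proof (induct m arbitrary: j)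
  case (Suc m)
  have surj: "inj_res_surjection S V J e d (W (Suc (Suc m))) (T (Suc m)) (proj (Suc m))"
    by (intro inj_res_surjection.intro inj_res_axioms inj_res_surjection_axioms.intro W T proj proj_sur)
  have ker: "inj_res_surjection.ker (W (Suc (Suc m))) (T (Suc m)) (proj (Suc m)) = im (Suc m)"
  proof -
    have "im (Suc m) \<subseteq> carrier (W (Suc (Suc m)))" using mod_hom_closed[OF \<delta>[of "Suc m"]] by blast
    then have "{x \<in> carrier (W (Suc (Suc m))). x \<in> im (Suc m)} = im (Suc m)" by blast
    moreover have "{x \<in> carrier (W (Suc (Suc m))). proj (Suc m) x = \<zero>\<^bsub>T (Suc m)\<^esub>} =
        {x \<in> carrier (W (Suc (Suc m))). x \<in> im (Suc m)}"
      by (rule Collect_cong, rule conj_cong[OF refl], rule proj_ker)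
    ultimately show ?thesis unfolding inj_res_surjection.ker_def[OF surj] by (rule trans[rotated])
  qed
  obtain j' where j: "j = Suc j'" using Suc(3) by (cases j) auto
  show ?case
  proof (cases j')
    case 0
    have "ext_zero S J d (Suc 0) (T (Suc m))"
    proof (rule inj_res_surjection.ext_zero_quotient_1[OF surj ext_zero_dual[OF fin]], unfold ker)
      fix t assume t: "t \<in> mod_hom S ((W (Suc (Suc m)))\<lparr>carrier := im (Suc m)\<rparr>) V"
      obtain y where y: "y \<in> carrier (F (Suc (Suc m)))"
        "\<And>h. h \<in> carrier (W (Suc m)) \<Longrightarrow> t (\<delta> (Suc m) h) = h (D (Suc m) y)"
      proof (rule hom_killing_im[OF mod_hom_comp[OF \<delta>_im t]])
        fix h assume h: "h \<in> carrier (W m)"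
        show "t (\<delta> (Suc m) (\<delta> m h)) = \<zero>\<^bsub>V\<^esub>"
          using mod_hom_zero[OF im mod_V t] \<delta>_\<delta>[OF h] by simp
      qed blast
      have "h y = t h" if h: "h \<in> im (Suc m)" for h
      proof -
        obtain h' where "h' \<in> carrier (W (Suc m))" "h = \<delta> (Suc m) h'" using h by (rule imageE)
        then show ?thesis using y by simp
      qed
      then show "\<exists>t'\<in>mod_hom S (W (Suc (Suc m))) V. \<forall>x\<in>im (Suc m). t' x = t x"
        by (intro bexI[OF _ eval_hom[OF y(1)]] ballI)
    qed
    then show ?thesis by (simp add: j 0)
  next
    case (Suc k)
    have "induced m \<in> mod_hom S (T m) ((W (Suc (Suc m)))\<lparr>carrier := im (Suc m)\<rparr>)"
      by (rule mod_hom_restrict_cod[OF induced]) (auto simp: induced_proj simp flip: proj_sur)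
    moreover have "induced m ` carrier (T m) = im (Suc m)"
      unfolding proj_sur[symmetric] image_image by (rule image_cong) (auto simp: induced_proj)
    ultimately have surj': "inj_res_surjection S V J e d (T m) ((W (Suc (Suc m)))\<lparr>carrier := im (Suc m)\<rparr>) (induced m)"
      by (intro inj_res_surjection.intro inj_res_axioms inj_res_surjection_axioms.intro T im) simp_all
    have ker': "inj_res_surjection.ker (T m) ((W (Suc (Suc m)))\<lparr>carrier := im (Suc m)\<rparr>) (induced m) = ext_part m"
      unfolding inj_res_surjection.ker_def[OF surj'] ext_part_def by simp
    have "ext_zero S J d (Suc k) (T m)"
      using Suc.prems Suc j by (intro Suc.hyps) auto
    moreover have "ext_zero S J d k ((T m)\<lparr>carrier := ext_part m\<rparr>)"
      using Suc.prems Suc j by (intro Suc.prems(1)) auto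
    ultimately have "ext_zero S J d (Suc k) ((W (Suc (Suc m)))\<lparr>carrier := im (Suc m)\<rparr>)"
      by (intro inj_res_surjection.ext_zero_quotient[OF surj']) (simp_all add: ker')
    then have "ext_zero S J d (Suc (Suc k)) (T (Suc m))"
      by (intro inj_res_surjection.ext_zero_quotient[OF surj ext_zero_dual[OF fin]]) (simp add: ker)
    then show ?thesis by (simp add: j Suc)
  qed
qed simp

end

locale gorenstein_resolution = dual_resolution R S U V J e d A X D p
  for R :: "('r, 'c) ring_scheme" and S :: "('s, 'b) ring_scheme"
    and U :: "('r, 'u) module" and V :: "('s, 'u) module"
    and J :: "nat \<Rightarrow> ('s, 'i) module" and e d
    and A :: "('r, 'a) module" and X :: "nat \<Rightarrow> 'x set" and D p +
  assumes noeth_R: "left_noetherian R" and noeth_S: "left_noetherian S" and fg_V: "fg_module S V"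
    and gor: "\<And>(N :: ('s, (nat \<Rightarrow> 's) set) module) i. fg_module S N \<Longrightarrow> 1 \<le> i \<Longrightarrow>
      s_grade_ge R U (Ext_module S N V (smult U) i) i"
begin

lemma fg_T: "fg_module S (T m)"
  by (rule fg_module_image[OF dual_free_fg[OF fin fg_V] T proj proj_sur])

text \<open>Suppose \<open>Ext j (Y, V)\<close> contains a nonzero class \<open>f\<close>. Connecting \<open>Y \<rightarrow> T m \<rightarrow> T m / Y\<close> maps it to a
  class \<open>f'\<close> of \<open>Ext (j + 1) (T m / Y, V)\<close>, injectively because \<open>Ext j (T m, V) \<rightarrow> Ext j (Y, V)\<close> is zero.
  By the Gorenstein condition the cyclic module \<open>R[f']\<close> has \<open>U\<close>-grade at least \<open>j + 1\<close>. So \<open>[f'] \<mapsto> [f]\<close> is a well-defined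
  homomorphism from it to a cokernel in the \<open>V\<close>-dual of a free resolution of \<open>Y\<close>. This dual is exact below \<open>j\<close>, and by the staircase
  lemma the homomorphism is zero.\<close>

lemma ext_zero_submodule_step:
  assumes Y: "submodule Y S (T m)" and sub: "Y \<subseteq> ext_part m" and jm: "j \<le> m"
    and extT: "\<And>k. 1 \<le> k \<Longrightarrow> k \<le> m \<Longrightarrow> ext_zero S J d k (T m)"
    and lower: "\<And>k. k < j \<Longrightarrow> ext_zero S J d k ((T m)\<lparr>carrier := Y\<rparr>)"
  shows "ext_zero S J d j ((T m)\<lparr>carrier := Y\<rparr>)"
proof -
  let ?Y = "(T m)\<lparr>carrier := Y\<rparr>"
  have mY: "left_module S ?Y" by (rule left_module.submodule_left_module[OF T Y])
  have Ysub: "Y \<subseteq> carrier (T m)" using sub by (auto simp: ext_part_def)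
  interpret swap: bimodule S R V U by (rule swap)
  obtain X1 :: "nat \<Rightarrow> nat set" and D1 p1 where res1: "free_resolution S ?Y X1 D1 p1"
    using free_resolution_exists[OF noeth_S noetherian_fg_submodule[OF noeth_S fg_T Y] infinite_UNIV_nat] by metis
  interpret b1: balanced_resolutions S V J e d ?Y X1 D1 p1
    by (intro balanced_resolutions.intro inj_res_axioms balanced_resolutions_axioms.intro mY res1)
  let ?N = "quotient_module (T m) Y" and ?q = "\<lambda>x. Y +>\<^bsub>T m\<^esub> x"
  note N = quotient_left_module[OF T Y] and q = quotient_hom[OF T Y] and q_sur = quotient_surj[OF T Y]
    and q_ker = quotient_ker[OF T Y]
  obtain N' :: "('s, (nat \<Rightarrow> 's) set) module" and \<nu> where N': "fg_module S N'" "\<nu> \<in> mod_hom S N' ?N"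
    "\<nu> ` carrier N' = carrier ?N" "\<And>x. x \<in> carrier N' \<Longrightarrow> \<nu> x = \<zero>\<^bsub>?N\<^esub> \<Longrightarrow> x = \<zero>\<^bsub>N'\<^esub>"
    using fg_module_copy[OF fg_module_image[OF fg_T N q q_sur]] by metis
  obtain X2 D2 where ch: "chosen_resolution S N' = (X2, D2)" by (cases "chosen_resolution S N'") auto
  obtain p2 where res2': "free_resolution S N' X2 D2 p2"
    using chosen_resolution_is_resolution[OF noeth_S N'(1) ch] by blast
  have res2: "free_resolution S ?N X2 D2 (\<lambda>y. \<nu> (p2 y))"
    using N'(1) by (intro free_resolution_iso[OF res2' _ N N'(2,3,4)]) (auto simp: fg_module_def)
  interpret b2: balanced_resolutions S V J e d ?N X2 D2 "\<lambda>y. \<nu> (p2 y)"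
    by (intro balanced_resolutions.intro inj_res_axioms balanced_resolutions_axioms.intro N res2)
  show ?thesis
    unfolding b1.ext_zero_iff
  proof (intro allI impI)
    fix f assume f: "is_cocycle S X1 D1 V j f"
    obtain \<alpha> where \<alpha>: "b1.corresponds j f \<alpha>" by (rule b1.corresponds_right[OF f])
    obtain \<alpha>' where \<alpha>': "\<alpha>' \<in> mod_hom S (T m) (J j)" "\<And>x. x \<in> Y \<Longrightarrow> \<alpha>' x = \<alpha> x"
      by (rule baer_extend[OF baer_J T Y b1.corresponds_cocycle(2)[OF \<alpha>]]) blast
    obtain \<beta> where \<beta>: "\<beta> \<in> mod_hom S ?N (J (Suc j))" "\<And>x. x \<in> carrier (T m) \<Longrightarrow> \<beta> (?q x) = d j (\<alpha>' x)"
    proof (rule factor_through_surjection[OF T N J q q_sur mod_hom_comp[OF \<alpha>'(1) d]])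
      fix x assume x: "x \<in> carrier (T m)" "?q x = \<zero>\<^bsub>?N\<^esub>"
      then have "x \<in> Y" using q_ker by blast
      then show "d j (\<alpha>' x) = \<zero>\<^bsub>J (Suc j)\<^esub>" using \<alpha>'(2) b1.corresponds_cocycle(3)[OF \<alpha>] by simp
    qed blast
    obtain f' where f': "b2.corresponds (Suc j) f' \<beta>"
    proof (rule b2.corresponds_left[OF \<beta>(1)])
      fix x assume "x \<in> carrier ?N"
      then show "d (Suc j) (\<beta> x) = \<zero>\<^bsub>J (Suc (Suc j))\<^esub>"
        using \<beta>(2) d_d mod_hom_closed[OF \<alpha>'(1)] unfolding q_sur[symmetric] by auto
    qed blast
    have j1: "1 \<le> Suc j" by simp
    obtain Z :: "('r, (((((nat \<Rightarrow> 's) set + 's) list \<Rightarrow> 's) \<Rightarrow> 'u) set)) module" and g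
        and Q :: "nat \<Rightarrow> (((((nat \<Rightarrow> 's) set + 's) list \<Rightarrow> 's) \<Rightarrow> 'u) set + 'r) list set" and E z
      where Z: "fg_module R Z" "g \<in> mod_hom R (regular_module R) Z" "g ` carrier R = carrier Z"
        and g_zero: "\<forall>r\<in>carrier R. g r = \<zero>\<^bsub>Z\<^esub> \<longleftrightarrow> is_coboundary S X2 D2 V (Suc j) (\<lambda>y. r \<odot>\<^bsub>U\<^esub> f' y)"
        and resZ: "free_resolution R Z Q E z"
        and vanZ: "\<forall>k<Suc j. \<forall>h. is_cocycle R Q E U k h \<longrightarrow> is_coboundary R Q E U k h"
      by (rule cyclic_submodule_of_Ext[OF noeth_R res2' ch gor[OF N'(1) j1] b2.corresponds_cocycle(1)[OF f']]) (rule that)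
    \<comment> \<open>The annihilator of the class of \<open>f'\<close> annihilates that of \<open>f\<close>: if \<open>r\<close> kills the former, then \<open>r \<alpha>\<close> extends to a cocycle \<open>?k\<close> on
      \<open>T m\<close>, and \<open>Ext j (T m, V) \<rightarrow> Ext j (Y, V)\<close> is zero.\<close>
    have key: "is_coboundary S X1 D1 V j (\<lambda>y. r \<odot>\<^bsub>U\<^esub> f y)" if r: "r \<in> carrier R" "g r = \<zero>\<^bsub>Z\<^esub>" for r
    proof -
      obtain L where L: "\<And>q. L q \<in> mod_hom S (J q) (J q)" "\<And>u. u \<in> carrier V \<Longrightarrow> L 0 (e u) = e (r \<odot>\<^bsub>U\<^esub> u)"
        "\<And>q x. x \<in> carrier (J q) \<Longrightarrow> d q (L q x) = L (Suc q) (d q x)"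
        by (rule lift_endomorphism[OF swap.act_hom[OF r(1)]]) blast
      have c1: "b1.corresponds j (\<lambda>y. r \<odot>\<^bsub>U\<^esub> f y) (\<lambda>x. L j (\<alpha> x))"
        by (rule b1.corresponds_endo[OF swap.act_hom[OF r(1)] L \<alpha>])
      have c2: "b2.corresponds (Suc j) (\<lambda>y. r \<odot>\<^bsub>U\<^esub> f' y) (\<lambda>x. L (Suc j) (\<beta> x))"
        by (rule b2.corresponds_endo[OF swap.act_hom[OF r(1)] L f'])
      obtain \<gamma> where \<gamma>: "\<gamma> \<in> mod_hom S ?N (J j)" "\<And>x. x \<in> carrier ?N \<Longrightarrow> L (Suc j) (\<beta> x) = d j (\<gamma> x)"
        using b2.corresponds_coboundary[OF c2] g_zero r by auto
      let ?k = "\<lambda>x. L j (\<alpha>' x) \<ominus>\<^bsub>J j\<^esub> \<gamma> (?q x)"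
      have k: "?k \<in> mod_hom S (T m) (J j)"
        by (rule mod_hom_minus[OF J mod_hom_comp[OF \<alpha>'(1) L(1)] mod_hom_comp[OF q \<gamma>(1)]])
      interpret Jj: left_module S "J j" by (rule J)
      interpret Jj1: left_module S "J (Suc j)" by (rule J)
      have dk: "d j (?k x) = \<zero>\<^bsub>J (Suc j)\<^esub>" if x: "x \<in> carrier (T m)" for x
      proof -
        note c = mod_hom_closed[OF \<alpha>'(1) x] mod_hom_closed[OF q x]
        have "d j (L j (\<alpha>' x)) = d j (\<gamma> (?q x))"
          using L(3)[OF c(1)] \<beta>(2)[OF x] \<gamma>(2)[OF c(2)] by simp
        then show ?thesis
          using mod_hom_closed[OF L(1) c(1)] mod_hom_closed[OF \<gamma>(1) c(2)] mod_hom_closed[OF d]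
          by (simp add: mod_hom_diff[OF J J d])
      qed
      have kY: "L j (\<alpha> x) = ?k x" if x: "x \<in> Y" for x
      proof -
        have "?q x = \<zero>\<^bsub>?N\<^esub>" using q_ker x Ysub by blast
        moreover have "L j (\<alpha>' x) \<in> carrier (J j)"
          using x Ysub by (intro mod_hom_closed[OF L(1)] mod_hom_closed[OF \<alpha>'(1)]) auto
        ultimately show ?thesis using \<alpha>'(2)[OF x] mod_hom_zero[OF N J \<gamma>(1)] by simp
      qed
      show ?thesis
      proof (cases j)
        case 0
        obtain t where t: "t \<in> mod_hom S (T m) V" "\<And>x. x \<in> carrier (T m) \<Longrightarrow> ?k x = e (t x)"
          by (rule lift_to_U[of ?k "T m"]) (use k dk T 0 in auto)
        have "L j (\<alpha> x) = \<zero>\<^bsub>J j\<^esub>" if x: "x \<in> Y" for x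
        proof -
          have "x \<in> carrier (T m)" "t x = \<zero>\<^bsub>V\<^esub>"
            using sub Ysub x hom_T_kills_ext_part[OF t(1)] by blast+
          then show ?thesis using kY[OF x] t(2) mod_hom_zero[OF mod_V J e] 0 by simp
        qed
        then show ?thesis using b1.corresponds_coboundary[OF c1] 0 by auto
      next
        case (Suc i)
        obtain h where h: "h \<in> mod_hom S (T m) (J i)" "\<And>x. x \<in> carrier (T m) \<Longrightarrow> ?k x = d i (h x)"
          by (rule ext_zero_SucD[OF _ , of i "T m" ?k]) (use extT[of j] jm k dk Suc in auto)
        have "L j (\<alpha> x) = d i (h x)" if x: "x \<in> Y" for x
          using kY[OF x] h(2)[of x] Ysub x by auto
        moreover have "h \<in> mod_hom S ?Y (J i)" by (rule mod_hom_restrict_dom[OF h(1) Ysub])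
        ultimately show ?thesis using b1.corresponds_coboundary[OF c1] Suc by auto
      qed
    qed
    let ?C = "\<lambda>q. swap.dual (free_module S (X1 q))"
    let ?c = "\<lambda>q. pullback (free_module S (X1 (Suc q))) (D1 q)"
    let ?f = "restrict f (carrier (free_module S (X1 j)))"
    note FS = free_left_module[OF ring_S]
    have C: "left_module R (?C q)" for q by (rule swap.dual_left_module[OF FS])
    have c: "?c q \<in> mod_hom R (?C q) (?C (Suc q))" for q by (rule swap.pullback_hom[OF FS resolutionD(3)[OF res1]])
    have fC: "?f \<in> carrier (?C j)" using f by (intro swap.dual_restrict[OF FS]) (simp add: is_cocycle_def)
    have mZ: "left_module R Z" using Z(1) by (simp add: fg_module_def)
    interpret Cj: left_module R "?C j" by (rule C)
    have key': "r \<odot>\<^bsub>?C j\<^esub> ?f \<in> cob_part ?C ?c j" if r: "r \<in> carrier R" "g r = \<zero>\<^bsub>Z\<^esub>" for r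
    proof -
      have "is_coboundary S X1 D1 V j (r \<odot>\<^bsub>?C j\<^esub> ?f)"
        using key[OF r] by (auto simp: is_coboundary_def split: nat.splits)
      then show ?thesis using swap.cob_part_iff[OF res1 Cj.smult_closed[OF r(1) fC]] by blast
    qed
    let ?Q = "free_module R (Q 0)"
    have g': "g ` carrier (regular_module R) = carrier Z" using Z(3) by simp
    \<comment> \<open>As a map from the free cover \<open>?Q\<close> of \<open>Z\<close>, the assignment \<open>[f'] \<mapsto> [f]\<close> is \<open>y \<mapsto> l y f\<close>.\<close>
    obtain l where l: "l \<in> mod_hom R ?Q (regular_module R)" "\<And>y. y \<in> carrier ?Q \<Longrightarrow> g (l y) = z y"
    proof (rule free_lift[OF regular_left_module[OF ring_R] mZ resolutionD(1)[OF resZ] Z(2)])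
      fix x assume "x \<in> Q 0"
      then show "z (unit_vec R x) \<in> g ` carrier (regular_module R)"
        unfolding g' by (intro mod_hom_closed[OF resolutionD(1)[OF resZ]] unit_vec_closed[OF ring_R])
    qed blast
    have lf: "(\<lambda>y. l y \<odot>\<^bsub>?C j\<^esub> ?f) \<in> mod_hom R ?Q (?C j)"
      by (rule mod_hom_comp[OF l(1) smult_hom[OF C fC]])
    have st: "l y \<odot>\<^bsub>?C j\<^esub> ?f \<in> cob_part ?C ?c j" if y: "y \<in> carrier ?Q" for y
    proof (rule staircase[OF ring_R resZ C c _ _ _ lf _ y])
      show "?c (Suc q) (?c q x) = \<zero>\<^bsub>?C (Suc (Suc q))\<^esub>" if "x \<in> carrier (?C q)" for q x
        by (rule swap.dualD_dualD[OF res1 that])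
      show "x \<in> cob_part ?C ?c q" if qj: "q < j" and x: "x \<in> carrier (?C q)" "?c q x = \<zero>\<^bsub>?C (Suc q)\<^esub>" for q x
      proof -
        have "is_cocycle S X1 D1 V q x" using swap.dualD_zero_iff[OF res1 x(1)] x(2) by blast
        then have "is_coboundary S X1 D1 V q x" using lower[OF qj] b1.ext_zero_iff by blast
        then show ?thesis using swap.cob_part_iff[OF res1 x(1)] by blast
      qed
      show "is_coboundary R Q E (?C q) k h" if "k \<le> j" "q \<le> j" "is_cocycle R Q E (?C q) k h" for k q h
        by (rule swap.cocycle_into_dual[OF resZ _ that(3)]) (use vanZ that(1) in auto)
      show "l (E 0 y) \<odot>\<^bsub>?C j\<^esub> ?f \<in> cob_part ?C ?c j" if y: "y \<in> carrier (free_module R (Q (Suc 0)))" for y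
      proof (rule key')
        have Ey: "E 0 y \<in> carrier ?Q" by (rule mod_hom_closed[OF resolutionD(3)[OF resZ] y])
        show "l (E 0 y) \<in> carrier R" using mod_hom_closed[OF l(1) Ey] by simp
        have "E 0 y \<in> {y \<in> carrier ?Q. z y = \<zero>\<^bsub>Z\<^esub>}" unfolding resolutionD(4)[OF resZ, symmetric] using y by blast
        then show "g (l (E 0 y)) = \<zero>\<^bsub>Z\<^esub>" using l(2)[OF Ey] by simp
      qed
    qed
    have "g \<one>\<^bsub>R\<^esub> \<in> carrier Z" using Z(3) Cj.R.one_closed by blast
    then obtain y where y: "y \<in> carrier ?Q" "z y = g \<one>\<^bsub>R\<^esub>" unfolding resolutionD(2)[OF resZ, symmetric] by auto
    have ly: "l y \<in> carrier R" using mod_hom_closed[OF l(1) y(1)] by simp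
    interpret r: left_module R "regular_module R" by (rule regular_left_module[OF ring_R])
    interpret Z: left_module R Z by (rule mZ)
    let ?r = "\<one>\<^bsub>R\<^esub> \<ominus>\<^bsub>regular_module R\<^esub> l y"
    have rR: "?r \<in> carrier R" using r.M.minus_closed[of "\<one>\<^bsub>R\<^esub>" "l y"] ly by simp
    have "g ?r = \<zero>\<^bsub>Z\<^esub>"
      using ly l(2)[OF y(1)] y(2) \<open>g \<one>\<^bsub>R\<^esub> \<in> carrier Z\<close>
      by (simp add: mod_hom_diff[OF r.left_module_axioms mZ Z(2)])
    then have "?r \<odot>\<^bsub>?C j\<^esub> ?f \<in> cob_part ?C ?c j" by (rule key'[OF rR])
    then have "?r \<odot>\<^bsub>?C j\<^esub> ?f \<oplus>\<^bsub>?C j\<^esub> l y \<odot>\<^bsub>?C j\<^esub> ?f \<in> cob_part ?C ?c j"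
      using st[OF y(1)] swap.cob_part_submodule[OF res1, of j] unfolding Cj.submodule_iff by blast
    also have "?r \<odot>\<^bsub>?C j\<^esub> ?f \<oplus>\<^bsub>?C j\<^esub> l y \<odot>\<^bsub>?C j\<^esub> ?f = (?r \<oplus>\<^bsub>R\<^esub> l y) \<odot>\<^bsub>?C j\<^esub> ?f"
      by (rule Cj.smult_l_distr[OF rR ly fC, symmetric])
    also have "?r \<oplus>\<^bsub>R\<^esub> l y = \<one>\<^bsub>R\<^esub>"
      using r.add_diff_cancel[of "\<one>\<^bsub>R\<^esub>" "l y"] ly by simp
    also have "\<one>\<^bsub>R\<^esub> \<odot>\<^bsub>?C j\<^esub> ?f = ?f" by (rule Cj.smult_one[OF fC])
    finally have "is_coboundary S X1 D1 V j ?f" using swap.cob_part_iff[OF res1 fC] by blast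
    then show "is_coboundary S X1 D1 V j f" by (auto simp: is_coboundary_def split: nat.splits)
  qed
qed

text \<open>The step for \<open>m\<close> needs the orthogonality of \<open>T m\<close>, which by \<open>ext_zero_T\<close> follows from the claim for all smaller
  \<open>m\<close>, and the claim in the degrees below \<open>j\<close>.\<close>

lemma ext_zero_submodule:
  assumes "submodule Y S (T m)" "Y \<subseteq> ext_part m" "j \<le> m"
  shows "ext_zero S J d j ((T m)\<lparr>carrier := Y\<rparr>)"
  using assms
proof (induct m arbitrary: Y j rule: less_induct)
  case (less m)
  have extT: "ext_zero S J d k (T m)" if "1 \<le> k" "k \<le> m" for k
    by (rule ext_zero_T[OF less(1)[OF _ ext_part_submodule] that]) auto
  show ?case
    using less(4)
  proof (induct j rule: less_induct)
    case (less j)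
    show ?case
      by (rule ext_zero_submodule_step[OF \<open>submodule Y S (T m)\<close> \<open>Y \<subseteq> ext_part m\<close> less(2) extT]) (use less in auto)
  qed
qed

end

section \<open>The bimodule of a Wakamatsu tilting module\<close>

text \<open>The identity of \<open>P\<close> factors through \<open>U\<^sup>n\<close>, with components \<open>s k\<close> and \<open>t k\<close>; so \<open>P\<close> is in \<open>add U\<close>. In the module
  \<open>Hom(P, U)\<close> over the endomorphisms of \<open>U\<close>, the \<open>s k\<close> and the functionals \<open>h \<mapsto> h \<circ> t k\<close> are a dual basis in the usual sense, and
  the facts below are those of finitely generated projective modules.\<close>

definition dual_basis :: "('r, 'c) ring_scheme \<Rightarrow> ('r, 'u) module \<Rightarrow> ('r, 'p) module \<Rightarrow> nat
    \<Rightarrow> (nat \<Rightarrow> 'p \<Rightarrow> 'u) \<Rightarrow> (nat \<Rightarrow> 'u \<Rightarrow> 'p) \<Rightarrow> bool" where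
  "dual_basis R U P n s t \<longleftrightarrow> (\<forall>k<n. s k \<in> mod_hom R P U \<and> t k \<in> mod_hom R U P) \<and>
     (\<forall>x\<in>carrier P. (\<Oplus>\<^bsub>P\<^esub> k\<in>{..<n}. t k (s k x)) = x)"

lemma direct_summand_projection:
  assumes M: "left_module R M" and ds: "direct_summand R S M"
  obtains p where "p \<in> mod_hom R M (M\<lparr>carrier := S\<rparr>)" "\<And>x. x \<in> S \<Longrightarrow> p x = x"
proof -
  interpret M: left_module R M by fact
  obtain T where S: "submodule S R M" and T: "submodule T R M" and int: "S \<inter> T = {\<zero>\<^bsub>M\<^esub>}"
    and sum: "S <+>\<^bsub>M\<^esub> T = carrier M"
    using ds by (auto simp: direct_summand_def)
  note S' = S[unfolded M.submodule_iff] and T' = T[unfolded M.submodule_iff]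
  have neg: "\<ominus>\<^bsub>M\<^esub> x \<in> H" if "submodule H R M" "x \<in> H" for x H
    using that by (auto simp: M.submodule_iff M.neg_conv_smult)
  have uniq: "a = a'" if "a \<in> S" "b \<in> T" "a' \<in> S" "b' \<in> T" "a \<oplus>\<^bsub>M\<^esub> b = a' \<oplus>\<^bsub>M\<^esub> b'" for a b a' b'
  proof -
    have c: "a \<in> carrier M" "b \<in> carrier M" "a' \<in> carrier M" "b' \<in> carrier M" using that S' T' by auto
    have "(a \<ominus>\<^bsub>M\<^esub> a') \<oplus>\<^bsub>M\<^esub> (b \<ominus>\<^bsub>M\<^esub> b') = (a \<oplus>\<^bsub>M\<^esub> b) \<ominus>\<^bsub>M\<^esub> (a' \<oplus>\<^bsub>M\<^esub> b')"
      by (rule M.diff_add_diff[symmetric, OF c(1,2,3,4)])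
    also have "\<dots> = \<zero>\<^bsub>M\<^esub>" using that(5) c by simp
    finally have "\<ominus>\<^bsub>M\<^esub> (b \<ominus>\<^bsub>M\<^esub> b') = a \<ominus>\<^bsub>M\<^esub> a'" using c by (intro M.M.minus_equality) auto
    moreover have "\<ominus>\<^bsub>M\<^esub> (b \<ominus>\<^bsub>M\<^esub> b') \<in> T"
      using that T' neg[OF T] by (auto simp: a_minus_def)
    moreover have "a \<ominus>\<^bsub>M\<^esub> a' \<in> S" using that S' neg[OF S] by (auto simp: a_minus_def)
    ultimately have "a \<ominus>\<^bsub>M\<^esub> a' = \<zero>\<^bsub>M\<^esub>" using int by auto
    then show ?thesis using c by simp
  qed
  define p where "p x = (SOME a. a \<in> S \<and> (\<exists>b\<in>T. x = a \<oplus>\<^bsub>M\<^esub> b))" for x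
  have p: "p (a \<oplus>\<^bsub>M\<^esub> b) = a" if "a \<in> S" "b \<in> T" for a b
    unfolding p_def by (rule some_equality) (use that uniq in blast)+
  have dec: "\<exists>a\<in>S. \<exists>b\<in>T. x = a \<oplus>\<^bsub>M\<^esub> b" if "x \<in> carrier M" for x
    using that sum[symmetric] by (auto simp: set_add_def')
  have "p \<in> mod_hom R M (M\<lparr>carrier := S\<rparr>)"
  proof (rule mod_homI)
    fix x assume "x \<in> carrier M"
    then obtain a b where x: "a \<in> S" "b \<in> T" "x = a \<oplus>\<^bsub>M\<^esub> b" using dec by blast
    then show "p x \<in> carrier (M\<lparr>carrier := S\<rparr>)" using p by simp
    fix y assume "y \<in> carrier M"
    then obtain a' b' where y: "a' \<in> S" "b' \<in> T" "y = a' \<oplus>\<^bsub>M\<^esub> b'" using dec by blast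
    have c: "a \<in> carrier M" "b \<in> carrier M" "a' \<in> carrier M" "b' \<in> carrier M" using x y S' T' by auto
    have "x \<oplus>\<^bsub>M\<^esub> y = (a \<oplus>\<^bsub>M\<^esub> a') \<oplus>\<^bsub>M\<^esub> (b \<oplus>\<^bsub>M\<^esub> b')" using x(3) y(3) c by (simp add: M.M.a_ac)
    moreover have "a \<oplus>\<^bsub>M\<^esub> a' \<in> S" "b \<oplus>\<^bsub>M\<^esub> b' \<in> T" using x y S' T' by auto
    ultimately show "p (x \<oplus>\<^bsub>M\<^esub> y) = p x \<oplus>\<^bsub>M\<lparr>carrier := S\<rparr>\<^esub> p y" using p x y by simp
  next
    fix r x assume r: "r \<in> carrier R" and "x \<in> carrier M"
    then obtain a b where x: "a \<in> S" "b \<in> T" "x = a \<oplus>\<^bsub>M\<^esub> b" using dec by blast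
    then have "a \<in> carrier M" "b \<in> carrier M" using S' T' by auto
    then have "r \<odot>\<^bsub>M\<^esub> x = r \<odot>\<^bsub>M\<^esub> a \<oplus>\<^bsub>M\<^esub> r \<odot>\<^bsub>M\<^esub> b" using x(3) M.smult_r_distr[OF r] by simp
    moreover have "r \<odot>\<^bsub>M\<^esub> a \<in> S" "r \<odot>\<^bsub>M\<^esub> b \<in> T" using r x S' T' by auto
    ultimately show "p (r \<odot>\<^bsub>M\<^esub> x) = r \<odot>\<^bsub>M\<lparr>carrier := S\<rparr>\<^esub> p x" using p x by simp
  qed
  moreover have "p x = x" if "x \<in> S" for x
    using p[of x "\<zero>\<^bsub>M\<^esub>"] that S' T' by auto
  ultimately show ?thesis by (rule that)
qed

lemma in_add_dual_basis:
  assumes U: "left_module R U" and P: "in_add R U P"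
  obtains n s t where "dual_basis R U P n s t"
proof -
  obtain n :: nat and S where ds: "direct_summand R S (copower {..<n} U)"
    and iso: "mod_isomorphic R P ((copower {..<n} U)\<lparr>carrier := S\<rparr>)" and mP: "left_module R P"
    using P by (auto simp: in_add_def)
  let ?C = "copower {..<n} U"
  let ?S = "?C\<lparr>carrier := S\<rparr>"
  have C: "left_module R ?C" by (rule copower_left_module[OF U])
  have subS: "submodule S R ?C" using ds by (simp add: direct_summand_def)
  have mS: "left_module R ?S" by (rule left_module.submodule_left_module[OF C subS])
  obtain f where f: "f \<in> mod_hom R P ?S" "bij_betw f (carrier P) S"
    using iso unfolding mod_isomorphic_def by auto
  have sub: "S \<subseteq> carrier ?C" using subS unfolding left_module.submodule_iff[OF C] by blast
  obtain p where p: "p \<in> mod_hom R ?C ?S" "\<And>x. x \<in> S \<Longrightarrow> p x = x"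
    by (rule direct_summand_projection[OF C ds]) blast
  have fP: "f ` carrier P = carrier ?S" "inj_on f (carrier P)" using f(2) by (auto simp: bij_betw_def)
  have idP: "id \<in> mod_hom R P P" by (rule mod_homI) auto
  obtain g where g: "g \<in> mod_hom R ?S P" "\<And>x. x \<in> carrier P \<Longrightarrow> g (f x) = id x"
  proof (rule factor_through_surjection[OF mP mS mP f(1) fP(1) idP])
    fix x assume x: "x \<in> carrier P" "f x = \<zero>\<^bsub>?S\<^esub>"
    interpret P: left_module R P by (rule mP)
    have "f x = f \<zero>\<^bsub>P\<^esub>" using x(2) mod_hom_zero[OF mP mS f(1)] by simp
    then show "id x = \<zero>\<^bsub>P\<^esub>" using inj_onD[OF fP(2)] x(1) by simp
  qed blast
  let ?s = "\<lambda>k x. f x k" and ?t = "\<lambda>k u. g (p (coord_inj U k u))"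
  have fC: "f \<in> mod_hom R P ?C" by (rule mod_hom_extend_cod[OF f(1) sub])
  have s: "?s k \<in> mod_hom R P U" for k by (rule mod_hom_comp[OF fC copower_coord_hom[OF U]])
  have pg: "(\<lambda>x. g (p x)) \<in> mod_hom R ?C P" by (rule mod_hom_comp[OF p(1) g(1)])
  have t: "?t k \<in> mod_hom R U P" if "k < n" for k
    by (rule mod_hom_comp[OF coord_inj_hom[OF U] pg]) (use that in simp)
  have "(\<Oplus>\<^bsub>P\<^esub> k\<in>{..<n}. ?t k (?s k x)) = x" if x: "x \<in> carrier P" for x
  proof -
    have fx: "f x \<in> carrier ?C" by (rule mod_hom_closed[OF fC x])
    have ci: "coord_inj U k (f x k) \<in> carrier ?C" if "k \<in> {..<n}" for k
      by (rule mod_hom_closed[OF coord_inj_hom[OF U that] copower_component[OF U fx]])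
    have "(\<Oplus>\<^bsub>P\<^esub> k\<in>{..<n}. ?t k (?s k x)) = g (p (\<Oplus>\<^bsub>?C\<^esub> k\<in>{..<n}. coord_inj U k (f x k)))"
      using mod_hom_finsum[OF C mP pg, of "{..<n}" "\<lambda>k. coord_inj U k (f x k)"] ci by auto
    also have "(\<Oplus>\<^bsub>?C\<^esub> k\<in>{..<n}. coord_inj U k (f x k)) = f x"
      by (rule copower_expand[OF U fx, symmetric]) (use fx in \<open>auto simp: copower_carrier intro: ccontr\<close>)
    also have "g (p (f x)) = x" using p(2) g(2)[OF x] mod_hom_closed[OF f(1) x] by simp
    finally show ?thesis .
  qed
  then have "dual_basis R U P n ?s ?t" using s t by (simp add: dual_basis_def)
  then show ?thesis by (rule that)
qed

lemma op_ring_simps [simp]: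
  "carrier (op_ring R) = carrier R" "add (op_ring R) = add R" "zero (op_ring R) = zero R"
  "one (op_ring R) = one R" "mult (op_ring R) = (\<lambda>x y. y \<otimes>\<^bsub>R\<^esub> x)"
  by (simp_all add: op_ring_def)

lemma End_ring_simps [simp]:
  "carrier (End_ring R U) = mod_hom R U U \<inter> extensional (carrier U)"
  "zero (End_ring R U) = (\<lambda>x\<in>carrier U. \<zero>\<^bsub>U\<^esub>)"
  "add (End_ring R U) = (\<lambda>f g. \<lambda>x\<in>carrier U. f x \<oplus>\<^bsub>U\<^esub> g x)"
  "mult (End_ring R U) = (\<lambda>f g. compose (carrier U) g f)"
  "one (End_ring R U) = (\<lambda>x\<in>carrier U. x)"
  by (simp_all add: End_ring_def Hom_group_def)

lemma over_End_simps [simp]: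
  "carrier (over_End U) = carrier U" "zero (over_End U) = \<zero>\<^bsub>U\<^esub>" "add (over_End U) = add U"
  "smult (over_End U) = (\<lambda>f u. f u)"
  by (simp_all add: over_End_def)

locale endo_bimodule =
  fixes R :: "('r, 'c) ring_scheme" and U :: "('r, 'u) module"
  assumes left_U: "left_module R U" and ring_op_End: "ring (op_ring (End_ring R U))"
begin

abbreviation S where "S \<equiv> op_ring (End_ring R U)"
abbreviation V where "V \<equiv> over_End U"

sublocale bimodule R S U V
proof (rule bimodule.intro)
  interpret U: left_module R U by (rule left_U)
  show "left_module R U" by (rule left_U)
  show "left_module S V"
  proof (rule left_moduleI[OF ring_op_End])
    fix x assume "x \<in> carrier V"
    then show "\<exists>y\<in>carrier V. y \<oplus>\<^bsub>V\<^esub> x = \<zero>\<^bsub>V\<^esub>"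
      using U.M.l_neg by (intro bexI[of _ "\<ominus>\<^bsub>U\<^esub> x"]) auto
  qed (auto simp: U.M.a_ac mod_hom_closed mod_hom_add compose_def)
qed (auto simp: mod_hom_smult)

lemma S_mem: "f \<in> mod_hom R U U \<Longrightarrow> restrict f (carrier U) \<in> carrier S"
  using mod_hom_restrict[OF left_U] by simp

context
  fixes P :: "('r, 'p) module" and n s t
  assumes mP: "left_module R P" and db: "dual_basis R U P n s t"
begin

lemma s: "k < n \<Longrightarrow> s k \<in> mod_hom R P U" and t: "k < n \<Longrightarrow> t k \<in> mod_hom R U P"
  and st: "x \<in> carrier P \<Longrightarrow> (\<Oplus>\<^bsub>P\<^esub> k\<in>{..<n}. t k (s k x)) = x"
  using db by (auto simp: dual_basis_def)

definition coeff where "coeff k h = restrict (\<lambda>u. h (t k u)) (carrier U)"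
definition basis where "basis k = restrict (s k) (carrier P)"

lemma basis: "k < n \<Longrightarrow> basis k \<in> carrier (dual P)"
  unfolding basis_def by (rule dual_restrict[OF mP s])

lemma coeff_hom: "k < n \<Longrightarrow> coeff k \<in> mod_hom S (dual P) (regular_module S)"
proof (rule mod_homI)
  fix h assume k: "k < n" and h: "h \<in> carrier (dual P)"
  show "coeff k h \<in> carrier (regular_module S)"
    unfolding coeff_def using S_mem[OF mod_hom_comp[OF t[OF k] dual_hom[OF h]]] by simp
qed (auto simp: coeff_def fun_eq_iff compose_def mod_hom_closed[OF t])

lemma coeff_smult: "\<lbrakk>k < n; h \<in> carrier (dual P); x \<in> carrier P\<rbrakk> \<Longrightarrow> (coeff k h \<odot>\<^bsub>dual P\<^esub> basis k) x = h (t k (s k x))"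
  by (simp add: coeff_def basis_def mod_hom_closed[OF s])

lemma dual_expand:
  assumes h: "h \<in> carrier (dual P)"
  shows "h = (\<Oplus>\<^bsub>dual P\<^esub> k\<in>{..<n}. coeff k h \<odot>\<^bsub>dual P\<^esub> basis k)"
proof -
  interpret D: left_module S "dual P" by (rule dual_left_module[OF mP])
  have c: "coeff k h \<odot>\<^bsub>dual P\<^esub> basis k \<in> carrier (dual P)" if "k < n" for k
    using mod_hom_closed[OF coeff_hom[OF that] h] basis[OF that] by (intro D.smult_closed) auto
  show ?thesis
  proof (rule dual_eqI[OF h])
    show "(\<Oplus>\<^bsub>dual P\<^esub> k\<in>{..<n}. coeff k h \<odot>\<^bsub>dual P\<^esub> basis k) \<in> carrier (dual P)"
      using c by (intro D.M.finsum_closed) auto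
    fix x assume x: "x \<in> carrier P"
    have "(\<Oplus>\<^bsub>dual P\<^esub> k\<in>{..<n}. coeff k h \<odot>\<^bsub>dual P\<^esub> basis k) x =
        (\<Oplus>\<^bsub>V\<^esub> k\<in>{..<n}. (coeff k h \<odot>\<^bsub>dual P\<^esub> basis k) x)"
      by (rule mod_hom_finsum[OF D.left_module_axioms mod_V eval_hom[OF x]]) (use c in auto)
    also have "\<dots> = (\<Oplus>\<^bsub>U\<^esub> k\<in>{..<n}. (coeff k h \<odot>\<^bsub>dual P\<^esub> basis k) x)"
      by (simp add: finsum_def finprod_def del: dual_module_simps)
    also have "\<dots> = (\<Oplus>\<^bsub>U\<^esub> k\<in>{..<n}. h (t k (s k x)))"
    proof -
      interpret U: left_module R U by (rule left_U)
      show ?thesis using coeff_smult[OF _ h x] mod_hom_closed[OF dual_hom[OF h] mod_hom_closed[OF t mod_hom_closed[OF s x]]]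
        by (intro U.M.finsum_cong') auto
    qed
    also have "\<dots> = h x"
      using mod_hom_finsum[OF mP left_U dual_hom[OF h], of "{..<n}" "\<lambda>k. t k (s k x)"] st[OF x]
        mod_hom_closed[OF t mod_hom_closed[OF s x]] by auto
    finally show "h x = (\<Oplus>\<^bsub>dual P\<^esub> k\<in>{..<n}. coeff k h \<odot>\<^bsub>dual P\<^esub> basis k) x" by simp
  qed
qed

lemma dual_hom_apply:
  assumes N: "left_module S N" and f: "f \<in> mod_hom S (dual P) N" and h: "h \<in> carrier (dual P)"
  shows "f h = (\<Oplus>\<^bsub>N\<^esub> k\<in>{..<n}. coeff k h \<odot>\<^bsub>N\<^esub> f (basis k))"
proof -
  interpret D: left_module S "dual P" by (rule dual_left_module[OF mP])
  interpret N: left_module S N by fact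
  have co: "coeff k h \<in> carrier S" if "k < n" for k using mod_hom_closed[OF coeff_hom[OF that] h] by simp
  have c: "coeff k h \<odot>\<^bsub>dual P\<^esub> basis k \<in> carrier (dual P)" if "k < n" for k
    using co[OF that] basis[OF that] by (intro D.smult_closed) auto
  have "f h = (\<Oplus>\<^bsub>N\<^esub> k\<in>{..<n}. f (coeff k h \<odot>\<^bsub>dual P\<^esub> basis k))"
    using arg_cong[OF dual_expand[OF h], of f] mod_hom_finsum[OF D.left_module_axioms N f, of "{..<n}" "\<lambda>k. coeff k h \<odot>\<^bsub>dual P\<^esub> basis k"] c
    by auto
  also have "\<dots> = (\<Oplus>\<^bsub>N\<^esub> k\<in>{..<n}. coeff k h \<odot>\<^bsub>N\<^esub> f (basis k))"
    using mod_hom_smult[OF f co basis] N.smult_closed[OF co mod_hom_closed[OF f basis]]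
    by (intro N.M.finsum_cong') auto
  finally show ?thesis .
qed

lemma dual_eval:
  assumes f: "f \<in> mod_hom S (dual P) V"
  obtains v where "v \<in> carrier P" "\<And>h. h \<in> carrier (dual P) \<Longrightarrow> f h = h v"
proof -
  interpret U: left_module R U by (rule left_U)
  interpret P: left_module R P by (rule mP)
  have fb: "f (basis k) \<in> carrier U" if "k < n" for k using mod_hom_closed[OF f basis[OF that]] by simp
  have tb: "t k (f (basis k)) \<in> carrier P" if "k < n" for k by (rule mod_hom_closed[OF t[OF that] fb[OF that]])
  let ?v = "\<Oplus>\<^bsub>P\<^esub> k\<in>{..<n}. t k (f (basis k))"
  have "f h = h ?v" if h: "h \<in> carrier (dual P)" for h
  proof -
    have "f h = (\<Oplus>\<^bsub>V\<^esub> k\<in>{..<n}. coeff k h \<odot>\<^bsub>V\<^esub> f (basis k))" by (rule dual_hom_apply[OF mod_V f h])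
    also have "\<dots> = (\<Oplus>\<^bsub>U\<^esub> k\<in>{..<n}. coeff k h \<odot>\<^bsub>V\<^esub> f (basis k))" by (simp add: finsum_def finprod_def)
    also have "\<dots> = (\<Oplus>\<^bsub>U\<^esub> k\<in>{..<n}. h (t k (f (basis k))))"
      using fb mod_hom_closed[OF dual_hom[OF h] tb] by (intro U.M.finsum_cong') (auto simp: coeff_def)
    also have "\<dots> = h ?v"
      using tb by (intro mod_hom_finsum[OF mP left_U dual_hom[OF h], symmetric]) auto
    finally show ?thesis .
  qed
  moreover have "?v \<in> carrier P" using tb by (intro P.M.finsum_closed) auto
  ultimately show ?thesis using that by blast
qed

lemma dual_separates:
  assumes v: "v \<in> carrier P" and z: "\<And>h. h \<in> carrier (dual P) \<Longrightarrow> h v = \<zero>\<^bsub>U\<^esub>"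
  shows "v = \<zero>\<^bsub>P\<^esub>"
proof -
  interpret P: left_module R P by (rule mP)
  have "s k v = \<zero>\<^bsub>U\<^esub>" if "k < n" for k using z[OF basis[OF that]] v by (simp add: basis_def)
  then have "t k (s k v) = \<zero>\<^bsub>P\<^esub>" if "k < n" for k using that mod_hom_zero[OF left_U mP t] by simp
  then have "(\<Oplus>\<^bsub>P\<^esub> k\<in>{..<n}. t k (s k v)) = (\<Oplus>\<^bsub>P\<^esub> k\<in>{..<n}. \<zero>\<^bsub>P\<^esub>)"
    by (intro P.M.finsum_cong') auto
  then show ?thesis using st[OF v] by simp
qed

lemma dual_fg: "fg_module S (dual P)"
proof -
  interpret D: left_module S "dual P" by (rule dual_left_module[OF mP])
  have "carrier (dual P) \<subseteq> K" if K: "submodule K S (dual P)" "basis ` {..<n} \<subseteq> K" for K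
  proof
    fix h assume h: "h \<in> carrier (dual P)"
    have "(\<Oplus>\<^bsub>dual P\<^esub> k\<in>{..<n}. coeff k h \<odot>\<^bsub>dual P\<^esub> basis k) \<in> K"
    proof (rule submodule_finsum[OF D.left_module_axioms K(1)])
      fix k assume "k \<in> {..<n}"
      then have k: "k < n" by simp
      have "coeff k h \<in> carrier S" using mod_hom_closed[OF coeff_hom[OF k] h] by simp
      moreover have "basis k \<in> K" using K(2) k by blast
      moreover have "\<forall>a\<in>carrier S. \<forall>x\<in>K. a \<odot>\<^bsub>dual P\<^esub> x \<in> K" using K(1) unfolding D.submodule_iff by (elim conjE)
      ultimately show "coeff k h \<odot>\<^bsub>dual P\<^esub> basis k \<in> K" by (simp only: ball_simps)
    qed simp
    then show "h \<in> K" using dual_expand[OF h] by simp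
  qed
  then have "fin_gen S (dual P) (carrier (dual P))"
    unfolding fin_gen_def using basis by (intro exI[of _ "basis ` {..<n}"]) auto
  then show ?thesis by (simp add: fg_module_iff D.left_module_axioms)
qed

lemma dual_ext_zero:
  assumes "inj_res S V J e d" shows "ext_zero S J d (Suc j) (dual P)"
proof -
  interpret inj_res S V J e d by fact
  show ?thesis
  proof (rule ext_zero_SucI)
    fix f assume f: "f \<in> mod_hom S (dual P) (J (Suc j))"
      "\<And>h. h \<in> carrier (dual P) \<Longrightarrow> d (Suc j) (f h) = \<zero>\<^bsub>J (Suc (Suc j))\<^esub>"
    interpret J0: left_module S "J j" by (rule J)
    interpret J1: left_module S "J (Suc j)" by (rule J)
    have "\<forall>k\<in>{..<n}. \<exists>y. y \<in> carrier (J j) \<and> f (basis k) = d j y"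
      using kernel_d[OF mod_hom_closed[OF f(1) basis] f(2)[OF basis]] by auto
    then obtain y where y: "\<And>k. k < n \<Longrightarrow> y k \<in> carrier (J j)" "\<And>k. k < n \<Longrightarrow> f (basis k) = d j (y k)"
      using bchoice[of "{..<n}" "\<lambda>k y. y \<in> carrier (J j) \<and> f (basis k) = d j y"] by auto
    let ?g = "\<lambda>h. \<Oplus>\<^bsub>J j\<^esub> k\<in>{..<n}. coeff k h \<odot>\<^bsub>J j\<^esub> y k"
    have gk: "(\<lambda>h. coeff k h \<odot>\<^bsub>J j\<^esub> y k) \<in> mod_hom S (dual P) (J j)" if "k < n" for k
      by (rule mod_hom_comp[OF coeff_hom[OF that] smult_hom[OF J y(1)[OF that]]])
    have "?g \<in> mod_hom S (dual P) (J j)" by (rule mod_hom_sum_fun[OF J]) (use gk in auto)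
    moreover have "f h = d j (?g h)" if h: "h \<in> carrier (dual P)" for h
    proof -
      have co: "coeff k h \<in> carrier S" if "k < n" for k using mod_hom_closed[OF coeff_hom[OF that] h] by simp
      have "d j (?g h) = (\<Oplus>\<^bsub>J (Suc j)\<^esub> k\<in>{..<n}. d j (coeff k h \<odot>\<^bsub>J j\<^esub> y k))"
        by (rule mod_hom_finsum[OF J J d]) (use mod_hom_closed[OF gk h] in auto)
      also have "\<dots> = (\<Oplus>\<^bsub>J (Suc j)\<^esub> k\<in>{..<n}. coeff k h \<odot>\<^bsub>J (Suc j)\<^esub> f (basis k))"
        using y mod_hom_smult[OF d co y(1)] J1.smult_closed[OF co mod_hom_closed[OF f(1) basis]]
        by (intro J1.M.finsum_cong') auto
      also have "\<dots> = f h" by (rule dual_hom_apply[OF J f(1) h, symmetric])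
      finally show ?thesis by simp
    qed
    ultimately show "\<exists>g\<in>mod_hom S (dual P) (J j). \<forall>h\<in>carrier (dual P). f h = d j (g h)"
      by (intro bexI[of _ ?g] ballI)
  qed
qed

end

end

text \<open>The coresolution \<open>0 \<rightarrow> R \<rightarrow> P 0 \<rightarrow> P 1 \<rightarrow> \<dots>\<close> by modules in \<open>add U\<close>. A homomorphism \<open>R \<rightarrow> U\<close> is identified with its value at \<open>1\<close>.\<close>

locale wakamatsu = endo_bimodule R U
  for R :: "('r, 'c) ring_scheme" and U :: "('r, 'u) module" +
  fixes P :: "nat \<Rightarrow> ('r, 'p) module" and \<epsilon> and \<tau>
  assumes P_add: "in_add R U (P i)"
    and \<epsilon>: "\<epsilon> \<in> mod_hom R (regular_module R) (P 0)" and inj_\<epsilon>: "inj_on \<epsilon> (carrier R)"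
    and \<tau>: "\<tau> i \<in> mod_hom R (P i) (P (Suc i))"
    and exact_\<epsilon>: "\<epsilon> ` carrier R = {x \<in> carrier (P 0). \<tau> 0 x = \<zero>\<^bsub>P (Suc 0)\<^esub>}"
    and exact_\<tau>: "\<tau> i ` carrier (P i) = {x \<in> carrier (P (Suc i)). \<tau> (Suc i) x = \<zero>\<^bsub>P (Suc (Suc i))\<^esub>}"
    and Hom_sur: "u \<in> carrier U \<Longrightarrow> \<exists>h\<in>carrier (dual (P 0)). h (\<epsilon> \<one>\<^bsub>R\<^esub>) = u"
    and Hom_exact_\<epsilon>: "pullback (P 0) (\<tau> 0) ` carrier (dual (P (Suc 0))) = {h \<in> carrier (dual (P 0)). h (\<epsilon> \<one>\<^bsub>R\<^esub>) = \<zero>\<^bsub>U\<^esub>}"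
    and Hom_exact_\<tau>: "pullback (P (Suc i)) (\<tau> (Suc i)) ` carrier (dual (P (Suc (Suc i)))) =
      {h \<in> carrier (dual (P (Suc i))). pullback (P i) (\<tau> i) h = \<zero>\<^bsub>dual (P i)\<^esub>}"
begin

lemma P: "left_module R (P i)" using P_add by (simp add: in_add_def)

lemma P_eval:
  assumes "f \<in> mod_hom S (dual (P i)) V"
  obtains v where "v \<in> carrier (P i)" "\<And>h. h \<in> carrier (dual (P i)) \<Longrightarrow> f h = h v"
proof -
  obtain n s t where db: "dual_basis R U (P i) n s t" by (rule in_add_dual_basis[OF left_U P_add])
  show ?thesis by (rule dual_eval[OF P db assms]) (rule that)
qed

lemma P_separates:
  assumes "v \<in> carrier (P i)" "\<And>h. h \<in> carrier (dual (P i)) \<Longrightarrow> h v = \<zero>\<^bsub>U\<^esub>"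
  shows "v = \<zero>\<^bsub>P i\<^esub>"
proof -
  obtain n s t where db: "dual_basis R U (P i) n s t" by (rule in_add_dual_basis[OF left_U P_add])
  show ?thesis by (rule dual_separates[OF P db assms(1)]) (rule assms(2))
qed

abbreviation one_P where "one_P \<equiv> \<epsilon> \<one>\<^bsub>R\<^esub>"
abbreviation M where "M i \<equiv> dual (P i)"
abbreviation \<rho> where "\<rho> i \<equiv> pullback (P i) (\<tau> i)"
abbreviation im where "im i \<equiv> \<rho> i ` carrier (M (Suc i))"

lemma one_P: "one_P \<in> carrier (P 0)"
proof -
  interpret ring R by (rule ring_R)
  show ?thesis using mod_hom_closed[OF \<epsilon>] by simp
qed

lemma \<epsilon>_eq: "r \<in> carrier R \<Longrightarrow> \<epsilon> r = r \<odot>\<^bsub>P 0\<^esub> one_P"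
proof -
  assume r: "r \<in> carrier R"
  interpret ring R by (rule ring_R)
  show ?thesis using mod_hom_smult[OF \<epsilon> r, of "\<one>\<^bsub>R\<^esub>"] r by simp
qed

lemma \<tau>_one: "\<tau> 0 one_P = \<zero>\<^bsub>P (Suc 0)\<^esub>"
proof -
  interpret ring R by (rule ring_R)
  have "one_P \<in> \<epsilon> ` carrier R" by blast
  then show ?thesis unfolding exact_\<epsilon> by blast
qed

lemma M: "left_module S (M i)" by (rule dual_left_module[OF P])
lemma \<rho>: "\<rho> i \<in> mod_hom S (M (Suc i)) (M i)" by (rule pullback_hom[OF P \<tau>])
lemma im_submodule: "submodule (im i) S (M i)" by (rule image_submodule[OF M M \<rho>])
lemma im: "left_module S ((M i)\<lparr>carrier := im i\<rparr>)" by (rule left_module.submodule_left_module[OF M im_submodule])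
lemma ev_one: "(\<lambda>h. h one_P) \<in> mod_hom S (M 0) V" by (rule eval_hom[OF one_P])

lemma ev_one_sur: "(\<lambda>h. h one_P) ` carrier (M 0) = carrier V"
  using mod_hom_closed[OF ev_one] Hom_sur by force

text \<open>The double centralizer property. An endomorphism of the \<open>S\<close>-module \<open>V\<close> induces a homomorphism \<open>Hom(P 0, U) \<rightarrow> V\<close>, which is
  evaluation at an element of \<open>P 0\<close>; it is killed by \<open>\<tau> 0\<close> and so comes from \<open>R\<close>.\<close>

lemma endo:
  assumes t: "t \<in> mod_hom S V V"
  shows "\<exists>r\<in>carrier R. \<forall>u\<in>carrier U. t u = r \<odot>\<^bsub>U\<^esub> u"
proof -
  obtain v where v: "v \<in> carrier (P 0)" "\<And>h. h \<in> carrier (M 0) \<Longrightarrow> t (h one_P) = h v"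
    by (rule P_eval[OF mod_hom_comp[OF ev_one t]]) blast
  have "\<tau> 0 v = \<zero>\<^bsub>P (Suc 0)\<^esub>"
  proof (rule P_separates[OF mod_hom_closed[OF \<tau> v(1)]])
    fix h assume h: "h \<in> carrier (M (Suc 0))"
    have "h (\<tau> 0 v) = t (\<rho> 0 h one_P)" using v(2)[OF mod_hom_closed[OF \<rho> h]] v(1) by simp
    also have "\<rho> 0 h one_P = \<zero>\<^bsub>V\<^esub>" using one_P \<tau>_one mod_hom_zero[OF P left_U dual_hom[OF h]] by simp
    finally show "h (\<tau> 0 v) = \<zero>\<^bsub>U\<^esub>" using mod_hom_zero[OF mod_V mod_V t] by simp
  qed
  then have "v \<in> \<epsilon> ` carrier R" unfolding exact_\<epsilon> using v(1) by simp
  then obtain r where r: "r \<in> carrier R" "v = \<epsilon> r" by auto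
  have "t u = r \<odot>\<^bsub>U\<^esub> u" if u: "u \<in> carrier U" for u
  proof -
    obtain h where h: "h \<in> carrier (M 0)" "h one_P = u" using Hom_sur[OF u] by blast
    then have "t u = h (r \<odot>\<^bsub>P 0\<^esub> one_P)" using v(2)[OF h(1)] r \<epsilon>_eq by simp
    then show ?thesis using mod_hom_smult[OF dual_hom[OF h(1)] r(1) one_P] h(2) by simp
  qed
  then show ?thesis using r(1) by blast
qed

lemma faithful:
  assumes r: "r \<in> carrier R" and z: "\<And>u. u \<in> carrier U \<Longrightarrow> r \<odot>\<^bsub>U\<^esub> u = \<zero>\<^bsub>U\<^esub>"
  shows "r = \<zero>\<^bsub>R\<^esub>"
proof -
  interpret R: ring R by (rule ring_R)
  have "\<epsilon> r = \<zero>\<^bsub>P 0\<^esub>"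
  proof (rule P_separates)
    show "\<epsilon> r \<in> carrier (P 0)" using mod_hom_closed[OF \<epsilon>] r by simp
    fix h assume h: "h \<in> carrier (M 0)"
    show "h (\<epsilon> r) = \<zero>\<^bsub>U\<^esub>"
      using mod_hom_smult[OF dual_hom[OF h] r one_P] z[OF mod_hom_closed[OF dual_hom[OF h] one_P]] \<epsilon>_eq[OF r] by simp
  qed
  also have "\<zero>\<^bsub>P 0\<^esub> = \<epsilon> \<zero>\<^bsub>R\<^esub>" using mod_hom_zero[OF regular_left_module[OF ring_R] P \<epsilon>] by simp
  finally show ?thesis using inj_onD[OF inj_\<epsilon>] r by simp
qed

text \<open>\<open>V\<close> is a quotient of the finitely generated module \<open>Hom(P 0, U)\<close>, by exactness of \<open>Hom(-, U)\<close> on the coresolution.\<close>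

lemma fg_V: "fg_module S V"
proof -
  obtain n s t where db: "dual_basis R U (P 0) n s t" by (rule in_add_dual_basis[OF left_U P_add])
  show ?thesis by (rule fg_module_image[OF dual_fg[OF P db] mod_V ev_one ev_one_sur])
qed

text \<open>\<open>Hom (-, U)\<close> turns the coresolution of \<open>R\<close> into a resolution of \<open>V\<close> by projective \<open>S\<close>-modules \<open>M i\<close>. Dualizing it
  into \<open>V\<close> gives back the coresolution, so \<open>Ext (k + 1) (V, V) = 0\<close>; it is enough to treat \<open>k = 0\<close> for all
  syzygies.\<close>

lemma self_orth:
  assumes "inj_res S V J e d" shows "ext_zero S J d (Suc k) V"
proof -
  interpret inj_res S V J e d by fact
  have M_ext: "ext_zero S J d (Suc j) (M i)" for i j
  proof -
    obtain n s t where db: "dual_basis R U (P i) n s t" by (rule in_add_dual_basis[OF left_U P_add])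
    show ?thesis by (rule dual_ext_zero[OF P db assms])
  qed
  have sur0: "inj_res_surjection S V J e d (M 0) V (\<lambda>h. h one_P)"
    by (intro inj_res_surjection.intro assms inj_res_surjection_axioms.intro M mod_V ev_one ev_one_sur)
  have ker0: "inj_res_surjection.ker (M 0) V (\<lambda>h. h one_P) = im 0"
    unfolding inj_res_surjection.ker_def[OF sur0] Hom_exact_\<epsilon> by simp
  have \<rho>_im: "\<rho> i \<in> mod_hom S (M (Suc i)) ((M i)\<lparr>carrier := im i\<rparr>)" for i
    by (rule mod_hom_restrict_cod[OF \<rho>]) blast
  have sur: "inj_res_surjection S V J e d (M (Suc i)) ((M i)\<lparr>carrier := im i\<rparr>) (\<rho> i)" for i
    by (intro inj_res_surjection.intro assms inj_res_surjection_axioms.intro M im \<rho>_im) simp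
  have ker: "inj_res_surjection.ker (M (Suc i)) ((M i)\<lparr>carrier := im i\<rparr>) (\<rho> i) = im (Suc i)" for i
    unfolding inj_res_surjection.ker_def[OF sur] Hom_exact_\<tau> by simp
  have ext: "\<exists>t'\<in>mod_hom S (M i) V. \<forall>h\<in>im i. t' h = t h" if t: "t \<in> mod_hom S ((M i)\<lparr>carrier := im i\<rparr>) V" for i t
  proof -
    obtain v where v: "v \<in> carrier (P (Suc i))" "\<And>h. h \<in> carrier (M (Suc i)) \<Longrightarrow> t (\<rho> i h) = h v"
      by (rule P_eval[OF mod_hom_comp[OF \<rho>_im t]]) blast
    have "\<tau> (Suc i) v = \<zero>\<^bsub>P (Suc (Suc i))\<^esub>"
    proof (rule P_separates[OF mod_hom_closed[OF \<tau> v(1)]])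
      fix h assume h: "h \<in> carrier (M (Suc (Suc i)))"
      have "\<rho> (Suc i) h \<in> im (Suc i)" using h by blast
      then have "\<rho> i (\<rho> (Suc i) h) = \<zero>\<^bsub>M i\<^esub>" unfolding Hom_exact_\<tau> by blast
      then have "t (\<rho> i (\<rho> (Suc i) h)) = \<zero>\<^bsub>V\<^esub>" using mod_hom_zero[OF im mod_V t] by simp
      then show "h (\<tau> (Suc i) v) = \<zero>\<^bsub>U\<^esub>"
        using v(2)[OF mod_hom_closed[OF \<rho> h]] v(1) by simp
    qed
    then have "v \<in> \<tau> i ` carrier (P i)" unfolding exact_\<tau> using v(1) by simp
    then obtain w where w: "w \<in> carrier (P i)" "v = \<tau> i w" by auto
    have "h w = t h" if h: "h \<in> im i" for h
    proof -
      obtain h' where h': "h' \<in> carrier (M (Suc i))" "h = \<rho> i h'" using h by (rule imageE)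
      then show ?thesis using v(2)[OF h'(1)] w by simp
    qed
    then show ?thesis by (intro bexI[OF _ eval_hom[OF w(1)]] ballI)
  qed
  have "ext_zero S J d (Suc k) V \<and> (\<forall>i. ext_zero S J d (Suc k) ((M i)\<lparr>carrier := im i\<rparr>))" for k
  proof (induct k)
    case 0
    have "ext_zero S J d (Suc 0) V"
      by (rule inj_res_surjection.ext_zero_quotient_1[OF sur0 M_ext], unfold ker0, rule ext)
    moreover have "ext_zero S J d (Suc 0) ((M i)\<lparr>carrier := im i\<rparr>)" for i
      by (rule inj_res_surjection.ext_zero_quotient_1[OF sur M_ext], unfold ker, rule ext)
    ultimately show ?case by blast
  next
    case (Suc k)
    have "ext_zero S J d (Suc (Suc k)) V"
      by (rule inj_res_surjection.ext_zero_quotient[OF sur0 M_ext], unfold ker0) (use Suc in blast)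
    moreover have "ext_zero S J d (Suc (Suc k)) ((M i)\<lparr>carrier := im i\<rparr>)" for i
      by (rule inj_res_surjection.ext_zero_quotient[OF sur M_ext], unfold ker) (use Suc in blast)
    ultimately show ?case by blast
  qed
  then show ?thesis by blast
qed

lemma dualizing: "inj_res S V J e d \<Longrightarrow> dualizing R S U V J e d"
  by (intro dualizing.intro bimodule_axioms dualizing_axioms.intro endo faithful self_orth)

end

lemma wakamatsu_tilting_locale:
  assumes w: "wakamatsu_tilting R U" and S: "ring (op_ring (End_ring R U))"
  obtains P :: "nat \<Rightarrow> ('r, nat \<Rightarrow> 'u) module" and \<epsilon> \<tau> where "wakamatsu (R :: ('r, 'c) ring_scheme) (U :: ('r, 'u) module) P \<epsilon> \<tau>"
proof -
  have U: "left_module R U" using w by (simp add: wakamatsu_tilting_def fg_module_def)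
  interpret endo_bimodule R U by (intro endo_bimodule.intro U S)
  interpret R: ring R by (rule ring_R)
  obtain P :: "nat \<Rightarrow> ('r, nat \<Rightarrow> 'u) module" and \<epsilon> \<tau> where
    h: "\<And>i. in_add R U (P i)"
      "\<epsilon> \<in> mod_hom R (regular_module R) (P 0)"
      "\<And>i. \<tau> i \<in> mod_hom R (P i) (P (Suc i))"
      "inj_on \<epsilon> (carrier R)"
      "exact_at (regular_module R) \<epsilon> (P 0) (\<tau> 0) (P 1)"
      "\<And>i. exact_at (P i) (\<tau> i) (P (Suc i)) (\<tau> (Suc i)) (P (Suc (Suc i)))"
      "pullback (regular_module R) \<epsilon> ` carrier (Hom_group R (P 0) U) = carrier (Hom_group R (regular_module R) U)"
      "exact_at (Hom_group R (P 1) U) (pullback (P 0) (\<tau> 0)) (Hom_group R (P 0) U)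
          (pullback (regular_module R) \<epsilon>) (Hom_group R (regular_module R) U)"
      "\<And>i. exact_at (Hom_group R (P (Suc (Suc i))) U) (pullback (P (Suc i)) (\<tau> (Suc i)))
               (Hom_group R (P (Suc i)) U) (pullback (P i) (\<tau> i)) (Hom_group R (P i) U)"
    using w unfolding wakamatsu_tilting_def by metis
  have dualH: "carrier (dual A) = carrier (Hom_group R A U)" for A :: "('r, 'x) module"
    by (simp add: dual_carrier)
  note r = regular_left_module[OF ring_R]
  have "wakamatsu R U P \<epsilon> \<tau>"
  proof (intro wakamatsu.intro endo_bimodule_axioms wakamatsu_axioms.intro h(1-4))
    show "\<epsilon> ` carrier R = {x \<in> carrier (P 0). \<tau> 0 x = \<zero>\<^bsub>P (Suc 0)\<^esub>}"
      using h(5) by (simp add: exact_at_def a_kernel_def')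
    show "\<tau> i ` carrier (P i) = {x \<in> carrier (P (Suc i)). \<tau> (Suc i) x = \<zero>\<^bsub>P (Suc (Suc i))\<^esub>}" for i
      using h(6)[of i] by (simp add: exact_at_def a_kernel_def')
    show "\<exists>f\<in>carrier (dual (P 0)). f (\<epsilon> \<one>\<^bsub>R\<^esub>) = u" if u: "u \<in> carrier U" for u
    proof -
      have "restrict (\<lambda>r. r \<odot>\<^bsub>U\<^esub> u) (carrier R) \<in> carrier (Hom_group R (regular_module R) U)"
        using mod_hom_restrict[OF r smult_hom[OF U u]] by simp
      then obtain f where f: "f \<in> carrier (Hom_group R (P 0) U)"
        "restrict (\<lambda>r. r \<odot>\<^bsub>U\<^esub> u) (carrier R) = pullback (regular_module R) \<epsilon> f"
        unfolding h(7)[symmetric] by (rule imageE)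
      from fun_cong[OF f(2), of "\<one>\<^bsub>R\<^esub>"] have "f (\<epsilon> \<one>\<^bsub>R\<^esub>) = u"
        using left_module.smult_one[OF U u] by simp
      then show ?thesis using f(1) dualH by blast
    qed
    show "pullback (P 0) (\<tau> 0) ` carrier (dual (P (Suc 0))) = {f \<in> carrier (dual (P 0)). f (\<epsilon> \<one>\<^bsub>R\<^esub>) = \<zero>\<^bsub>U\<^esub>}"
    proof -
      have "pullback (regular_module R) \<epsilon> f = \<zero>\<^bsub>Hom_group R (regular_module R) U\<^esub> \<longleftrightarrow> f (\<epsilon> \<one>\<^bsub>R\<^esub>) = \<zero>\<^bsub>U\<^esub>"
        if f: "f \<in> carrier (dual (P 0))" for f
      proof
        assume "pullback (regular_module R) \<epsilon> f = \<zero>\<^bsub>Hom_group R (regular_module R) U\<^esub>"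
        from fun_cong[OF this, of "\<one>\<^bsub>R\<^esub>"] show "f (\<epsilon> \<one>\<^bsub>R\<^esub>) = \<zero>\<^bsub>U\<^esub>" by simp
      next
        assume z: "f (\<epsilon> \<one>\<^bsub>R\<^esub>) = \<zero>\<^bsub>U\<^esub>"
        have "f (\<epsilon> x) = \<zero>\<^bsub>U\<^esub>" if x: "x \<in> carrier R" for x
          using mod_hom_smult[OF mod_hom_comp[OF h(2) dual_hom[OF f]] x, of "\<one>\<^bsub>R\<^esub>"] x z
            left_module.smult_zero_right[OF U x] by simp
        then show "pullback (regular_module R) \<epsilon> f = \<zero>\<^bsub>Hom_group R (regular_module R) U\<^esub>"
          by (auto simp: pullback_def compose_def intro!: restrict_ext)
      qed
      then show ?thesis using h(8) unfolding exact_at_def a_kernel_def' dualH by (auto simp del: Hom_group_simps)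
    qed
    show "pullback (P (Suc i)) (\<tau> (Suc i)) ` carrier (dual (P (Suc (Suc i)))) =
      {f \<in> carrier (dual (P (Suc i))). pullback (P i) (\<tau> i) f = \<zero>\<^bsub>dual (P i)\<^esub>}" for i
      using h(9)[of i] unfolding exact_at_def a_kernel_def' dualH by simp
  qed
  then show ?thesis by (rule that)
qed

section \<open>The two injective dimensions\<close>

lemma inj_dim_attained:
  assumes "inj_dim R M \<noteq> \<infinity>"
  obtains n where "inj_dim R M = enat n" "inj_dim_le R M n" "\<And>k. k < n \<Longrightarrow> \<not> inj_dim_le R M k"
proof -
  have "\<exists>n. inj_dim_le R M n"
  proof (rule ccontr)
    assume "\<not> ?thesis"
    then have "{enat n |n. inj_dim_le R M n} = {}" by blast
    then show False using assms by (simp add: inj_dim_def top_enat_def)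
  qed
  then have L: "inj_dim_le R M (LEAST n. inj_dim_le R M n)" by (rule LeastI_ex)
  have "inj_dim R M = enat (LEAST n. inj_dim_le R M n)"
    unfolding inj_dim_def by (rule Inf_eqI) (use L Least_le in \<open>auto simp: \<close>)
  then show ?thesis using L not_less_Least by (intro that) auto
qed

lemma ext_nonzero_in_top_degree:
  fixes U :: "('r, 'u) module" and J :: "nat \<Rightarrow> ('r, ('r, 'u) large) module"
  assumes U: "left_module R U" and res: "injective_resolution R U J e d"
    and zero: "\<forall>i>n. zero_module (J i)" and k: "Suc k = n" "\<not> inj_dim_le R U k"
  obtains L where "submodule L R (regular_module R)" "\<not> ext_zero R J d n (quotient_module (regular_module R) L)"
proof -
  have "inj_res R U J e d" by (rule inj_res_of_injective_resolution[OF U res])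
  then show ?thesis using inj_dim_le_truncate[of R U J e d k] zero k that by blast
qed

lemma regular_fg: "ring R \<Longrightarrow> fg_module R (regular_module R)"
proof -
  assume R: "ring R"
  interpret ring R by fact
  interpret r: left_module R "regular_module R" by (rule regular_left_module[OF R])
  show ?thesis unfolding fg_module_def
    by (intro conjI r.left_module_axioms exI[of _ "{\<one>\<^bsub>R\<^esub>}"]) (auto simp: r.submodule_iff, metis r_one)
qed

lemma quotient_fg:
  assumes "ring R" "submodule L R (regular_module R)"
  shows "fg_module R (quotient_module (regular_module R) L)"
proof -
  note r = regular_left_module[OF assms(1)]
  show ?thesis
    by (rule fg_module_image[OF regular_fg[OF assms(1)] quotient_left_module[OF r assms(2)]
        quotient_hom[OF r assms(2)] quotient_surj[OF r assms(2)]])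
qed

text \<open>\<open>zero_if_all_ext_zero\<close> with its hypothesis moved to an injective resolution of \<open>U\<close>, where \<open>Ext\<close> visibly vanishes in high
  degrees.\<close>

lemma zero_if_all_ext_zero_both_sides:
  assumes dz: "dualizing R S U V J e d" and I: "inj_res R U I e' d'"
    and noeth: "left_noetherian R" and A: "fg_module R A"
    and fin_dim: "\<And>i. i > n \<Longrightarrow> zero_module (J i)" and van: "\<And>k. ext_zero R I d' k A"
  shows "zero_module A"
proof -
  obtain X :: "nat \<Rightarrow> nat set" and D p where res: "free_resolution R A X D p" "\<And>i. finite (X i)"
    using free_resolution_exists[OF noeth A infinite_UNIV_nat] by metis
  have mA: "left_module R A" using A by (simp add: fg_module_def)
  interpret dual_resolution R S U V J e d A X D p
    by (intro dual_resolution.intro dz dual_resolution_axioms.intro mA res)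
  have "balanced_resolutions R U I e' d' A X D p"
    by (intro balanced_resolutions.intro I balanced_resolutions_axioms.intro mA res(1))
  from balanced_resolutions.ext_zero_iff[OF this] van show ?thesis
    by (intro zero_if_all_ext_zero[OF fin_dim]) auto
qed

theorem proposition2p6:
  fixes \<Lambda> :: "'r ring" and U :: "('r, 'u) module" and \<Gamma> :: "('u \<Rightarrow> 'u) ring"
  assumes "left_noetherian \<Lambda>" and "right_noetherian \<Lambda>"
    and "wakamatsu_tilting \<Lambda> U"
    and "\<Gamma> = End_ring \<Lambda> U"
    and "left_noetherian \<Gamma>" and "right_noetherian \<Gamma>"
    and "\<forall>k. gorenstein \<Lambda> U k"
    and "inj_dim \<Lambda> U \<noteq> \<infinity>"
    and "inj_dim (op_ring \<Gamma>) (over_End U) \<noteq> \<infinity>"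
  shows "inj_dim \<Lambda> U = inj_dim (op_ring \<Gamma>) (over_End U)"
proof -
  let ?S = "op_ring (End_ring \<Lambda> U)" and ?V = "over_End U"
  have nR: "left_noetherian \<Lambda>" by fact
  have nS: "left_noetherian ?S" using assms(4,6) by (simp add: right_noetherian_def)
  have rS: "ring ?S" using nS by (simp add: left_noetherian_def)
  have w: "wakamatsu_tilting \<Lambda> U" by fact
  obtain P :: "nat \<Rightarrow> ('r, nat \<Rightarrow> 'u) module" and \<epsilon> \<tau> where "wakamatsu \<Lambda> U P \<epsilon> \<tau>"
    by (rule wakamatsu_tilting_locale[OF w rS])
  then interpret wakamatsu \<Lambda> U P \<epsilon> \<tau> .
  obtain m where m: "inj_dim \<Lambda> U = enat m" "inj_dim_le \<Lambda> U m" "\<And>k. k < m \<Longrightarrow> \<not> inj_dim_le \<Lambda> U k"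
    by (rule inj_dim_attained[OF assms(8)]) blast
  obtain n where n: "inj_dim ?S ?V = enat n" "inj_dim_le ?S ?V n" "\<And>k. k < n \<Longrightarrow> \<not> inj_dim_le ?S ?V k"
    by (rule inj_dim_attained[OF assms(9)[unfolded assms(4)]]) blast
  obtain I :: "nat \<Rightarrow> ('r, ('r, 'u) large) module" and eI dI
    where I: "injective_resolution \<Lambda> U I eI dI" "\<forall>i>m. zero_module (I i)"
    using m(2) unfolding inj_dim_le_def by blast
  obtain J :: "nat \<Rightarrow> ('u \<Rightarrow> 'u, ('u \<Rightarrow> 'u, 'u) large) module" and eJ dJ
    where J: "injective_resolution ?S ?V J eJ dJ" "\<forall>i>n. zero_module (J i)"
    using n(2) unfolding inj_dim_le_def by blast
  have resI: "inj_res \<Lambda> U I eI dI" by (rule inj_res_of_injective_resolution[OF left_U I(1)])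
  have resJ: "inj_res ?S ?V J eJ dJ" by (rule inj_res_of_injective_resolution[OF mod_V J(1)])
  have zI: "\<And>i. i > m \<Longrightarrow> zero_module (I i)" and zJ: "\<And>i. i > n \<Longrightarrow> zero_module (J i)"
    using I(2) J(2) by auto
  have dz: "dualizing \<Lambda> ?S U ?V J eJ dJ" by (rule dualizing[OF resJ])
  have dz': "dualizing ?S \<Lambda> ?V U I eI dI"
  proof (intro dualizing.intro swap resI dualizing_axioms.intro)
    fix t assume "t \<in> mod_hom \<Lambda> U U"
    then show "\<exists>s\<in>carrier ?S. \<forall>u\<in>carrier ?V. t u = s \<odot>\<^bsub>?V\<^esub> u"
      using S_mem by (intro bexI[of _ "restrict t (carrier U)"]) auto
  next
    fix s assume "s \<in> carrier ?S" "\<And>u. u \<in> carrier ?V \<Longrightarrow> s \<odot>\<^bsub>?V\<^esub> u = \<zero>\<^bsub>?V\<^esub>"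
    then show "s = \<zero>\<^bsub>?S\<^esub>" by (auto simp: fun_eq_iff extensional_def)
  next
    fix k
    have fgU: "fg_module \<Lambda> U" using w by (simp add: wakamatsu_tilting_def)
    obtain Q E where ch: "chosen_resolution \<Lambda> U = (Q, E)" by (cases "chosen_resolution \<Lambda> U") auto
    obtain q where res: "free_resolution \<Lambda> U Q E q"
      using chosen_resolution_is_resolution[OF nR fgU ch] by blast
    have b: "balanced_resolutions \<Lambda> U I eI dI U Q E q"
      by (intro balanced_resolutions.intro resI balanced_resolutions_axioms.intro left_U res)
    have "1 \<le> Suc k" by simp
    then have "zero_module (Ext_group \<Lambda> U U (Suc k))" using w unfolding wakamatsu_tilting_def by blast
    then have "zero_module (cohomology \<Lambda> Q E U (Suc k))" by (simp add: Ext_group_def ch)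
    then show "ext_zero \<Lambda> I dI (Suc k) U"
      unfolding balanced_resolutions.ext_zero_iff[OF b]
      using zero_cohomologyD[where X=Q and d=E, OF ring_R resolutionD(3)[OF res] left_U] by blast
  qed
  have gor: "s_grade_ge \<Lambda> U (Ext_module ?S N ?V (smult U) i) i"
    if "fg_module ?S N" "1 \<le> i" for N :: "('u \<Rightarrow> 'u, (nat \<Rightarrow> 'u \<Rightarrow> 'u) set) module" and i
    using assms(7) that unfolding gorenstein_def by blast
  \<comment> \<open>A cyclic \<open>\<Lambda>\<close>-submodule \<open>Z\<close> of \<open>Ext n\<close> of some \<open>S\<close>-module, generated by a nonzero class, would be zero.\<close>
  have "\<not> m < n"
  proof
    assume "m < n"
    then obtain k where k: "Suc k = n" by (cases n) auto
    obtain L where L: "submodule L ?S (regular_module ?S)"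
      "\<not> ext_zero ?S J dJ n (quotient_module (regular_module ?S) L)"
      by (rule ext_nonzero_in_top_degree[OF mod_V J k]) (use n(3) k in auto)
    obtain N :: "('u \<Rightarrow> 'u, (nat \<Rightarrow> 'u \<Rightarrow> 'u) set) module" and g where N: "fg_module ?S N"
      "g \<in> mod_hom ?S N (quotient_module (regular_module ?S) L)"
      "g ` carrier N = carrier (quotient_module (regular_module ?S) L)"
      "\<And>x. x \<in> carrier N \<Longrightarrow> g x = \<zero>\<^bsub>quotient_module (regular_module ?S) L\<^esub> \<Longrightarrow> x = \<zero>\<^bsub>N\<^esub>"
      using fg_module_copy[OF quotient_fg[OF rS L(1)]] by metis
    have mN: "left_module ?S N" using N(1) by (simp add: fg_module_def)
    have nz: "\<not> ext_zero ?S J dJ n N"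
      using L(2) inj_res.ext_zero_iso[OF resJ mN quotient_left_module[OF regular_left_module[OF rS] L(1)] N(2,3,4)] by blast
    obtain X D where ch: "chosen_resolution ?S N = (X, D)" by (cases "chosen_resolution ?S N") auto
    obtain p where res: "free_resolution ?S N X D p"
      using chosen_resolution_is_resolution[OF nS N(1) ch] by blast
    have "balanced_resolutions ?S ?V J eJ dJ N X D p"
      by (intro balanced_resolutions.intro resJ balanced_resolutions_axioms.intro mN res)
    from nz[unfolded balanced_resolutions.ext_zero_iff[OF this]]
    obtain f where f: "is_cocycle ?S X D ?V n f" "\<not> is_coboundary ?S X D ?V n f" by blast
    have n1: "1 \<le> n" using k by simp
    obtain Z :: "('r, (((((nat \<Rightarrow> 'u \<Rightarrow> 'u) set + ('u \<Rightarrow> 'u)) list \<Rightarrow> 'u \<Rightarrow> 'u) \<Rightarrow> 'u) set)) module" and g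
        and Q :: "nat \<Rightarrow> (((((nat \<Rightarrow> 'u \<Rightarrow> 'u) set + ('u \<Rightarrow> 'u)) list \<Rightarrow> 'u \<Rightarrow> 'u) \<Rightarrow> 'u) set + 'r) list set" and E z
      where Z: "fg_module \<Lambda> Z" "g \<in> mod_hom \<Lambda> (regular_module \<Lambda>) Z" "g ` carrier \<Lambda> = carrier Z"
        and g_zero: "\<forall>r\<in>carrier \<Lambda>. g r = \<zero>\<^bsub>Z\<^esub> \<longleftrightarrow> is_coboundary ?S X D ?V n (\<lambda>y. r \<odot>\<^bsub>U\<^esub> f y)"
        and resZ: "free_resolution \<Lambda> Z Q E z"
        and vanZ: "\<forall>k<n. \<forall>h. is_cocycle \<Lambda> Q E U k h \<longrightarrow> is_coboundary \<Lambda> Q E U k h"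
      by (rule cyclic_submodule_of_Ext[OF nR res ch gor[OF N(1) n1] f(1)])
    have mZ: "left_module \<Lambda> Z" using Z(1) by (simp add: fg_module_def)
    have bZ: "balanced_resolutions \<Lambda> U I eI dI Z Q E z"
      by (intro balanced_resolutions.intro resI balanced_resolutions_axioms.intro mZ resZ)
    have van: "ext_zero \<Lambda> I dI j Z" for j
    proof (cases "j < n")
      case True
      then show ?thesis unfolding balanced_resolutions.ext_zero_iff[OF bZ] using vanZ by blast
    next
      case False
      then obtain j' where j': "j = Suc j'" using k by (cases j) auto
      then have "m < Suc j'" using \<open>m < n\<close> False by simp
      then show ?thesis unfolding j' by (rule inj_res.ext_zero_beyond[OF resI zI])
    qed
    have "zero_module Z"
      by (rule zero_if_all_ext_zero_both_sides[where n=n, OF dz resI nR Z(1)]) (rule zJ, assumption, rule van)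
    moreover interpret R: ring \<Lambda> by (rule ring_R)
    have "g \<one>\<^bsub>\<Lambda>\<^esub> \<in> carrier Z" using Z(3) by blast
    ultimately have "g \<one>\<^bsub>\<Lambda>\<^esub> = \<zero>\<^bsub>Z\<^esub>" by (simp add: zero_module_def)
    then have "is_coboundary ?S X D ?V n (\<lambda>y. \<one>\<^bsub>\<Lambda>\<^esub> \<odot>\<^bsub>U\<^esub> f y)" using g_zero by simp
    moreover have "\<one>\<^bsub>\<Lambda>\<^esub> \<odot>\<^bsub>U\<^esub> f y = f y" if "y \<in> carrier (free_module ?S (X n))" for y
      using left_module.smult_one[OF left_U] mod_hom_closed[of f ?S "free_module ?S (X n)" ?V y] f(1) that
      by (simp add: is_cocycle_def)
    ultimately have "is_coboundary ?S X D ?V n f" by (auto simp: is_coboundary_def split: nat.splits)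
    then show False using f(2) by simp
  qed
  \<comment> \<open>A cyclic \<open>S\<close>-submodule \<open>?Y\<close> of \<open>Ext m\<close> of some \<open>\<Lambda>\<close>-module, generated by a nonzero class, would be zero.\<close>
  moreover have "\<not> n < m"
  proof
    assume "n < m"
    then obtain k where k: "Suc k = m" by (cases m) auto
    obtain L where L: "submodule L \<Lambda> (regular_module \<Lambda>)"
      "\<not> ext_zero \<Lambda> I dI m (quotient_module (regular_module \<Lambda>) L)"
      by (rule ext_nonzero_in_top_degree[OF left_U I k]) (use m(3) k in auto)
    let ?A = "quotient_module (regular_module \<Lambda>) L"
    have fgA: "fg_module \<Lambda> ?A" by (rule quotient_fg[OF ring_R L(1)])
    then have mA: "left_module \<Lambda> ?A" by (simp add: fg_module_def)
    obtain X :: "nat \<Rightarrow> nat set" and D p where res: "free_resolution \<Lambda> ?A X D p" "\<And>i. finite (X i)"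
      using free_resolution_exists[OF nR fgA infinite_UNIV_nat] by metis
    interpret G: gorenstein_resolution \<Lambda> ?S U ?V J eJ dJ ?A X D p
      by (intro gorenstein_resolution.intro dual_resolution.intro dz dual_resolution_axioms.intro mA res
          gorenstein_resolution_axioms.intro nR nS fg_V gor)
    have "balanced_resolutions \<Lambda> U I eI dI ?A X D p"
      by (intro balanced_resolutions.intro resI balanced_resolutions_axioms.intro mA res(1))
    from L(2)[unfolded balanced_resolutions.ext_zero_iff[OF this]]
    obtain f where f: "is_cocycle \<Lambda> X D U m f" "\<not> is_coboundary \<Lambda> X D U m f" by blast
    let ?f = "restrict f (carrier (G.F m))"
    have fW: "?f \<in> carrier (G.W (Suc k))"
      using dual_restrict[OF G.F, of f m] f(1) k by (simp add: is_cocycle_def)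
    have "is_cocycle \<Lambda> X D U (Suc k) ?f" 
      using f(1) k mod_hom_closed[OF G.D[of m]] dual_hom[OF fW] by (auto simp: is_cocycle_def)
    then have df: "G.\<delta> (Suc k) ?f = \<zero>\<^bsub>G.W (Suc (Suc k))\<^esub>" using G.cocycle_iff[OF fW] by blast
    have "is_coboundary \<Lambda> X D U (Suc k) ?f \<Longrightarrow> is_coboundary \<Lambda> X D U m f"
      by (simp add: is_coboundary_def k[symmetric])
    with f(2) have "\<not> is_coboundary \<Lambda> X D U (Suc k) ?f" by blast
    then have fim: "?f \<notin> G.im k" using G.im_iff_coboundary[OF fW] by blast
    let ?x = "G.proj k ?f"
    have x: "?x \<in> carrier (G.T k)" by (rule mod_hom_closed[OF G.proj fW])
    have x_ext: "?x \<in> G.ext_part k" using x df G.induced_proj[OF fW] by (simp add: G.ext_part_def)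
    let ?Y = "(\<lambda>s. s \<odot>\<^bsub>G.T k\<^esub> ?x) ` carrier ?S"
    have Y: "submodule ?Y ?S (G.T k)" and fgY: "fg_module ?S ((G.T k)\<lparr>carrier := ?Y\<rparr>)"
      by (rule cyclic_fin_gen[OF G.T x])+
    have "\<forall>a\<in>carrier ?S. \<forall>y\<in>G.ext_part k. a \<odot>\<^bsub>G.T k\<^esub> y \<in> G.ext_part k"
      using G.ext_part_submodule[of k] unfolding left_module.submodule_iff[OF G.T] by (elim conjE)
    then have Ysub: "?Y \<subseteq> G.ext_part k" using x_ext by blast
    have van: "ext_zero ?S J dJ j ((G.T k)\<lparr>carrier := ?Y\<rparr>)" for j
    proof (cases "j \<le> k")
      case True
      then show ?thesis by (rule G.ext_zero_submodule[OF Y Ysub])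
    next
      case False
      then obtain j' where j': "j = Suc j'" by (cases j) auto
      then have "n < Suc j'" using \<open>n < m\<close> False k by simp
      then show ?thesis unfolding j' by (rule inj_res.ext_zero_beyond[OF resJ zJ])
    qed
    have "zero_module ((G.T k)\<lparr>carrier := ?Y\<rparr>)"
      by (rule zero_if_all_ext_zero_both_sides[where n=m, OF dz' resJ nS fgY]) (rule zI, assumption, rule van)
    then have Y0: "?Y = {\<zero>\<^bsub>G.T k\<^esub>}" by (simp add: zero_module_def)
    interpret S: ring ?S by (rule rS)
    have "\<one>\<^bsub>?S\<^esub> \<odot>\<^bsub>G.T k\<^esub> ?x \<in> ?Y" using S.one_closed by (rule imageI)
    then have "?x = \<zero>\<^bsub>G.T k\<^esub>" using Y0 left_module.smult_one[OF G.T x] by simp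
    then show False using G.proj_ker[OF fW] fim by blast
  qed
  ultimately have "m = n" by simp
  then show ?thesis using m(1) n(1) assms(4) by simp
qed

end
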